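(* Given a functional vset-automaton $A$ with $n$ states and $m$ transitions, and a string $\mathbf{s}\in\Sigma^*$, one can enumerate $[\![A]\!](\mathbf{s})$ (each tuple exactly once) with polynomial delay of $O(n^2|\mathbf{s}|)$, following a polynomial preprocessing of $O(n^2|\mathbf{s}|+mn)$.
   Context: Strings and spans. $\Sigma$ is a fixed finite alphabet with $|\Sigma|\ge 2$. A span of a string $\mathbf{s}=\sigma_1\cdots\sigma_\ell\in\Sigma^*$ is an expression $[i,j\rangle$ with $1\le i\le j\le \ell+1$. $\mathsf{Vars}$ is an infinite set of variables, disjoint from $\Sigma$. For finite $V\subset\mathsf{Vars}$, a $(V,\mathbf{s})$-tuple is a function from $V$ to the spans of $\mathbf{s}$. Ref-words. For finite $V\subset\mathsf{Vars}$ let $\Gamma_V=\{x{\vdash},\ {\dashv}x \mid x\in V\}$ (open/close symbols), disjoint from $\Sigma$. A word $\mathbf{r}\in(\Sigma\cup\Gamma_V)^*$ is valid for $V$ if for each $x\in V$ it contains exactly one $x{\vdash}$ and exactly one ${\dashv}x$, the former to the left of the latter. Let $\mathsf{clr}$ be the morphism erasing $\Gamma_V$ and fixing $\Sigma$. A valid $\mathbf{r}$ with $\mathsf{clr}(\mathbf{r})=\mathbf{s}$ defines the $(V,\mathbf{s})$-tuple $\mu^{\mathbf{r}}$: writing $\mathbf{r}=\mathbf{r}'_x\, x{\vdash}\,\mathbf{r}_x\,{\dashv}x\,\mathbf{r}''_x$, $\mu^{\mathbf{r}}(x)=[i,j\rangle$ with $i=|\mathsf{clr}(\mathbf{r}'_x)|+1$,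 $j=i+|\mathsf{clr}(\mathbf{r}_x)|$. Vset-automata. A vset-automaton is a tuple $A=(V,Q,q_0,q_f,\delta)$ with $V\subset\mathsf{Vars}$ finite, $Q$ a finite set of states, $q_0,q_f\in Q$ initial and final states, and $\delta\colon Q\times(\Sigma\cup\{\epsilon\}\cup\Gamma_V)\to 2^Q$. $\mathcal{R}(A)$ is the set of words over $\Sigma\cup\Gamma_V$ accepted by $A$ viewed as an $\epsilon$-NFA. $[\![A]\!](\mathbf{s})=\{\mu^{\mathbf{r}}\mid\mathbf{r}\in\mathcal{R}(A)\text{ valid for }V,\ \mathsf{clr}(\mathbf{r})=\mathbf{s}\}$. $A$ is functional if every word in $\mathcal{R}(A)$ is valid for $V$. Complexity. An enumeration algorithm prints every answer exactly once; its delay is the time between consecutive answers. Running times are in the unit-cost RAM model with machine words of size logarithmic in the input size. *)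

theory Defs
  imports Main
begin

section \<open>Spans, ref-words and vset-automata\<close>

text \<open>
  The alphabet is a finite type \<open>'a\<close>, the set of variables an infinite type \<open>'v\<close>.
  The span written \<open>[i,j>\<close> is the pair \<open>(i, j)\<close>; a \<open>(V, s)\<close>-tuple is a map
  with domain \<open>V\<close>.
\<close>

type_synonym span = "nat \<times> nat"

definition spans :: "'a list \<Rightarrow> span set" where
  "spans s = {(i, j). 1 \<le> i \<and> i \<le> j \<and> j \<le> length s + 1}"

definition tuples :: "'v set \<Rightarrow> 'a list \<Rightarrow> ('v \<rightharpoonup> span) set" where
  "tuples V s = {\<mu>. dom \<mu> = V \<and> ran \<mu> \<subseteq> spans s}"

datatype ('a, 'v) letter = Sym 'a | Open 'v | Close 'v

definition ref_alphabet :: "'v set \<Rightarrow> ('a, 'v) letter set" where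
  "ref_alphabet V = range Sym \<union> Open ` V \<union> Close ` V"

fun clr :: "('a, 'v) letter list \<Rightarrow> 'a list" where
  "clr [] = []"
| "clr (Sym a # r) = a # clr r"
| "clr (Open x # r) = clr r"
| "clr (Close x # r) = clr r"

definition valid :: "'v set \<Rightarrow> ('a, 'v) letter list \<Rightarrow> bool" where
  "valid V r \<longleftrightarrow> set r \<subseteq> ref_alphabet V \<and>
     (\<forall>x\<in>V. count_list r (Open x) = 1 \<and> count_list r (Close x) = 1 \<and>
            (\<exists>r1 r2 r3. r = r1 @ Open x # r2 @ Close x # r3))"

definition ref_tuple :: "'v set \<Rightarrow> ('a, 'v) letter list \<Rightarrow> ('v \<rightharpoonup> span)" where
  "ref_tuple V r = (\<lambda>x. if x \<in> V then
     Some (THE ij. \<exists>r1 r2 r3. r = r1 @ Open x # r2 @ Close x # r3 \<and>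
             fst ij = length (clr r1) + 1 \<and> snd ij = fst ij + length (clr r2))
     else None)"

text \<open>The label \<open>None\<close> of a transition is the empty word.\<close>

record ('a, 'v, 'q) vset_automaton =
  vars :: "'v set"
  states :: "'q set"
  initial :: 'q
  final :: 'q
  delta :: "'q \<Rightarrow> ('a, 'v) letter option \<Rightarrow> 'q set"

definition labels :: "'v set \<Rightarrow> ('a, 'v) letter option set" where
  "labels V = insert None (Some ` ref_alphabet V)"

definition wf_vset_automaton :: "('a, 'v, 'q) vset_automaton \<Rightarrow> bool" where
  "wf_vset_automaton A \<longleftrightarrow> finite (vars A) \<and> finite (states A) \<and>
     initial A \<in> states A \<and> final A \<in> states A \<and>
     (\<forall>p\<in>states A. \<forall>l\<in>labels (vars A). delta A p l \<subseteq> states A)"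

definition transitions ::
    "('a, 'v, 'q) vset_automaton \<Rightarrow> ('q \<times> ('a, 'v) letter option \<times> 'q) set" where
  "transitions A = {(p, l, q). p \<in> states A \<and> l \<in> labels (vars A) \<and> q \<in> delta A p l}"

inductive path ::
    "('a, 'v, 'q) vset_automaton \<Rightarrow> 'q \<Rightarrow> ('a, 'v) letter list \<Rightarrow> 'q \<Rightarrow> bool"
  for A where
  refl: "path A p [] p"
| eps: "(p, None, q) \<in> transitions A \<Longrightarrow> path A q w r \<Longrightarrow> path A p w r"
| letter: "(p, Some a, q) \<in> transitions A \<Longrightarrow> path A q w r \<Longrightarrow> path A p (a # w) r"

definition ref_language :: "('a, 'v, 'q) vset_automaton \<Rightarrow> ('a, 'v) letter list set" where
  "ref_language A = {w. path A (initial A) w (final A)}"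

definition evaluate :: "('a, 'v, 'q) vset_automaton \<Rightarrow> 'a list \<Rightarrow> ('v \<rightharpoonup> span) set" where
  "evaluate A s = {ref_tuple (vars A) r | r. r \<in> ref_language A \<and> valid (vars A) r \<and> clr r = s}"

definition functional :: "('a, 'v, 'q) vset_automaton \<Rightarrow> bool" where
  "functional A \<longleftrightarrow> (\<forall>r\<in>ref_language A. valid (vars A) r)"

lemma clr_append [simp]: "clr (r @ r') = clr r @ clr r'"
  by (induction r rule: clr.induct) auto

lemma ref_tuple_eq:
  assumes "valid V r" "x \<in> V" "r = r1 @ Open x # r2 @ Close x # r3"
  shows "ref_tuple V r x = Some (length (clr r1) + 1, length (clr r1) + 1 + length (clr r2))"
proof -
  have c: "count_list r (Open x) = 1" "count_list r (Close x) = 1"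
    using assms(1,2) by (auto simp: valid_def)
  have uniq: "s1 = r1 \<and> s2 = r2" if s: "r = s1 @ Open x # s2 @ Close x # s3" for s1 s2 s3
  proof -
    have "Open x \<notin> set r1" "Open x \<notin> set (r2 @ Close x # r3)" "Close x \<notin> set r2" "Close x \<notin> set r3"
      using c unfolding assms(3) by (auto simp: count_list_0_iff)
    moreover have "Open x \<notin> set s1" "Open x \<notin> set (s2 @ Close x # s3)" "Close x \<notin> set s2"
      "Close x \<notin> set s3"
      using c unfolding s by (auto simp: count_list_0_iff)
    ultimately show ?thesis
      using s assms(3) append_Cons_eq_iff by metis
  qed
  have "(THE ij. \<exists>r1 r2 r3. r = r1 @ Open x # r2 @ Close x # r3 \<and>
             fst ij = length (clr r1) + 1 \<and> snd ij = fst ij + length (clr r2))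
        = (length (clr r1) + 1, length (clr r1) + 1 + length (clr r2))"
  proof (rule the_equality)
    show "\<exists>r1' r2' r3. r = r1' @ Open x # r2' @ Close x # r3 \<and>
         fst (length (clr r1) + 1, length (clr r1) + 1 + length (clr r2)) = length (clr r1') + 1 \<and>
         snd (length (clr r1) + 1, length (clr r1) + 1 + length (clr r2)) =
         fst (length (clr r1) + 1, length (clr r1) + 1 + length (clr r2)) + length (clr r2')"
      using assms(3) by auto
  next
    fix ij :: "nat \<times> nat"
    assume "\<exists>r1 r2 r3. r = r1 @ Open x # r2 @ Close x # r3 \<and>
             fst ij = length (clr r1) + 1 \<and> snd ij = fst ij + length (clr r2)"
    then show "ij = (length (clr r1) + 1, length (clr r1) + 1 + length (clr r2))"
      using uniq by (cases ij) auto
  qed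
  then show ?thesis
    using assms(2) unfolding ref_tuple_def by simp
qed

lemma evaluate_subset_tuples: "evaluate A s \<subseteq> tuples (vars A) s"
proof
  fix \<mu> assume "\<mu> \<in> evaluate A s"
  then obtain r where r: "\<mu> = ref_tuple (vars A) r" "valid (vars A) r" "clr r = s"
    by (auto simp: evaluate_def)
  have "\<exists>ij. \<mu> x = Some ij \<and> ij \<in> spans s" if x: "x \<in> vars A" for x
  proof -
    obtain r1 r2 r3 where d: "r = r1 @ Open x # r2 @ Close x # r3"
      using r(2) x unfolding valid_def by blast
    then have "s = clr r1 @ clr r2 @ clr r3"
      using r(3) by auto
    then show ?thesis
      using ref_tuple_eq[OF r(2) x d] r(1) by (auto simp: spans_def)
  qed
  moreover have "\<mu> x = None" if "x \<notin> vars A" for x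
    using that r(1) by (simp add: ref_tuple_def)
  ultimately have *: "\<mu> x \<noteq> None \<longleftrightarrow> x \<in> vars A" "\<mu> x = Some ij \<Longrightarrow> ij \<in> spans s" for x ij
    by (metis option.distinct(1), metis option.distinct(1) option.inject)
  then show "\<mu> \<in> tuples (vars A) s"
    unfolding tuples_def by (auto simp: dom_def ran_def simp del: not_None_eq)
qed


section \<open>Random access machines\<close>

text \<open>
  A program has its own registers, addressed directly, and a memory, addressed through
  registers. Answers are printed word by word on a write-only output: \<open>Out r\<close> prints
  one word, and \<open>Emit\<close> completes the current answer. Every instruction takes one time
  unit, so the time needed to print an answer is counted. The machine halts when the program
  counter leaves the program. The arithmetic is exact; that the machine only needs short
  words is the separate condition \<open>word_bounded\<close> below.
\<close>

datatype instr =
    Const nat nat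
  | Move nat nat
  | Add nat nat nat
  | Sub nat nat nat
  | Mul nat nat nat
  | Load nat nat
  | Store nat nat
  | Jump nat
  | JumpLess nat nat nat
  | Out nat
  | Emit

type_synonym program = "instr list"

record config =
  pc :: nat
  reg :: "nat \<Rightarrow> nat"
  mem :: "nat \<Rightarrow> nat"
  buffer :: "nat list"  \<comment> \<open>the words printed since the last completed answer\<close>

fun exec :: "instr \<Rightarrow> config \<Rightarrow> config" where
  "exec (Const r c) C = C\<lparr>pc := pc C + 1, reg := (reg C)(r := c)\<rparr>"
| "exec (Move r a) C = C\<lparr>pc := pc C + 1, reg := (reg C)(r := reg C a)\<rparr>"
| "exec (Add r a b) C = C\<lparr>pc := pc C + 1, reg := (reg C)(r := reg C a + reg C b)\<rparr>"
| "exec (Sub r a b) C = C\<lparr>pc := pc C + 1, reg := (reg C)(r := reg C a - reg C b)\<rparr>"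
| "exec (Mul r a b) C = C\<lparr>pc := pc C + 1, reg := (reg C)(r := reg C a * reg C b)\<rparr>"
| "exec (Load r a) C = C\<lparr>pc := pc C + 1, reg := (reg C)(r := mem C (reg C a))\<rparr>"
| "exec (Store a r) C = C\<lparr>pc := pc C + 1, mem := (mem C)(reg C a := reg C r)\<rparr>"
| "exec (Jump l) C = C\<lparr>pc := l\<rparr>"
| "exec (JumpLess a b l) C = C\<lparr>pc := (if reg C a < reg C b then l else pc C + 1)\<rparr>"
| "exec (Out r) C = C\<lparr>pc := pc C + 1, buffer := buffer C @ [reg C r]\<rparr>"
| "exec Emit C = C\<lparr>pc := pc C + 1, buffer := []\<rparr>"

definition halted :: "program \<Rightarrow> config \<Rightarrow> bool" where
  "halted P C \<longleftrightarrow> length P \<le> pc C"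

definition step :: "program \<Rightarrow> config \<Rightarrow> config" where
  "step P C = (if halted P C then C else exec (P ! pc C) C)"

definition start :: "nat list \<Rightarrow> config" where
  "start inp = \<lparr>pc = 0, reg = (\<lambda>_. 0),
     mem = (\<lambda>a. if a < length inp then inp ! a else 0), buffer = []\<rparr>"

definition config_at :: "program \<Rightarrow> nat list \<Rightarrow> nat \<Rightarrow> config" where
  "config_at P inp t = (step P ^^ t) (start inp)"

definition emits_at :: "program \<Rightarrow> nat list \<Rightarrow> nat \<Rightarrow> bool" where
  "emits_at P inp t \<longleftrightarrow>
     \<not> halted P (config_at P inp t) \<and> P ! pc (config_at P inp t) = Emit"

text \<open>
  The program halts and completes exactly the answers \<open>enc x\<close> with \<open>x \<in> X\<close>, one for each
  \<open>x\<close>. The list \<open>ts\<close> contains the times at which an answer is completed; the preprocessing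
  ends at time \<open>p\<close>. The delay also bounds the time from the end of the preprocessing to
  the first answer and from the last answer (or from \<open>p\<close>, if there is none) to halting.
\<close>

definition enumerates ::
    "program \<Rightarrow> nat list \<Rightarrow> ('x \<Rightarrow> nat list) \<Rightarrow> 'x set \<Rightarrow> nat \<Rightarrow> nat \<Rightarrow> bool" where
  "enumerates P inp enc X preprocessing delay \<longleftrightarrow>
     (\<exists>ts xs p T.
        sorted_wrt (<) ts \<and> set ts = {t. emits_at P inp t} \<and>
        distinct xs \<and> set xs = X \<and>
        map (\<lambda>t. buffer (config_at P inp t)) ts = map enc xs \<and>
        halted P (config_at P inp T) \<and> buffer (config_at P inp T) = [] \<and>
        p \<le> preprocessing \<and>
        successively (\<lambda>t t'. t \<le> t' \<and> t' \<le> t + delay) (p # ts @ [T]))"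

text \<open>
  Words of \<open>O(log N)\<close> bits, for inputs of size \<open>N\<close>, correspond to a bound \<open>B\<close> that is
  polynomial in \<open>N\<close>.
\<close>

definition word_bounded :: "program \<Rightarrow> nat list \<Rightarrow> nat \<Rightarrow> bool" where
  "word_bounded P inp B \<longleftrightarrow>
     (\<forall>t i. reg (config_at P inp t) i < B \<and> mem (config_at P inp t) i < B)"


section \<open>Representation of inputs and answers\<close>

text \<open>
  Symbols, variables and states are given to the machine as numbers, by arbitrary
  numberings; the transitions are listed in an arbitrary order.
\<close>

definition numbering :: "('b \<Rightarrow> nat) \<Rightarrow> 'b set \<Rightarrow> bool" where
  "numbering f X \<longleftrightarrow> bij_betw f X {..<card X}"

fun encode_label :: "('a \<Rightarrow> nat) \<Rightarrow> ('v \<Rightarrow> nat) \<Rightarrow> ('a, 'v) letter option \<Rightarrow> nat list" where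
  "encode_label fa fv None = [0, 0]"
| "encode_label fa fv (Some (Sym a)) = [1, fa a]"
| "encode_label fa fv (Some (Open x)) = [2, fv x]"
| "encode_label fa fv (Some (Close x)) = [3, fv x]"

definition encode_input ::
    "('a \<Rightarrow> nat) \<Rightarrow> ('v \<Rightarrow> nat) \<Rightarrow> ('q \<Rightarrow> nat) \<Rightarrow> ('a, 'v, 'q) vset_automaton \<Rightarrow>
     ('q \<times> ('a, 'v) letter option \<times> 'q) list \<Rightarrow> 'a list \<Rightarrow> nat list" where
  "encode_input fa fv fq A trs s =
     [card (states A), length trs, card (vars A), length s, fq (initial A), fq (final A)] @
     concat (map (\<lambda>(p, l, q). fq p # encode_label fa fv l @ [fq q]) trs) @
     map fa s"

text \<open>The tuple is printed as the bounds of its spans, in the order of the variable numbers.\<close>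

definition encode_tuple :: "('v \<Rightarrow> nat) \<Rightarrow> 'v set \<Rightarrow> ('v \<rightharpoonup> span) \<Rightarrow> nat list" where
  "encode_tuple fv V \<mu> =
     concat (map (\<lambda>i. case the (\<mu> (inv_into V fv i)) of (a, b) \<Rightarrow> [a, b]) [0..<card V])"

text \<open>
  Time bounds are stated as \<open>c * (f + 1)\<close>: for a nonempty string the summand \<open>n\<^sup>2 * |s|\<close>
  is at least 1 and absorbs the 1, which only matters for the empty string. The number of
  transitions alone does not measure the input, since there may be unused variables and states.
\<close>

definition input_size :: "('a, 'v, 'q) vset_automaton \<Rightarrow> 'a list \<Rightarrow> nat" where
  "input_size A s = card (vars A) + card (states A) + card (transitions A) + length s"

end

theory Submission
  imports Defs
begin

text \<open>
  In a functional automaton, every state \<open>q\<close> on an accepting path has a configuration, which says for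
  each variable whether it is unopened, open or closed, and which does not depend on the path.
  A tuple of the answer corresponds to the sequence of the configurations that are reached
  immediately before the symbols of \<open>s\<close> are read: the variable \<open>x\<close> is opened at the position
  given by the number of entries in which it is unopened, and similarly for closing.
  These sequences are the words of a levelled nondeterministic automaton with \<open>|s|\<close> levels. They are
  enumerated by a depth-first search over sets of states with the same configuration. Only states from
  which the rest of \<open>s\<close> can be accepted are kept, so the search never
  runs into a dead end, and moving up or down one level takes time \<open>O(n\<^sup>2)\<close>.

  Both the number of variables and the cost of comparing two configurations are at most \<open>n\<close>, as each
  variable operation on an accepting path changes the configuration. Every worklist
  has at most \<open>min n (m + 1)\<close> entries, whence \<open>O(m n)\<close> time suffices for the preprocessing
  even if \<open>s\<close> is empty and most states are isolated.
\<close>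

section \<open>A structured language\<close>

text \<open>The bounds concern an actual program of the random access machine, down to its word
  size. Hence the small language with an exact cost function, for which a compiler is verified once.
  Many runs can yield the same tuple. The search follows all runs with the same sequence of
  configurations at once, as in an on-the-fly determinisation, so no table of earlier answers is
  required. The delay leaves time of order n^2 per level: at most n states compare configurations of
  length at most n with a single representative. States off the accepting paths may have several
  configurations. The table stores an arbitrary one for each state, and the backward filter removes
  the states for which the choice could matter. The bound on the number of variables holds only if
  some word is accepted, so every loop over the variables is run after acceptance has been tested.
  Without transitions and with an empty string only constant time is granted, too little to
  initialise an array of length n; automata without transitions are therefore treated separately.
  The time for the first answer is charged to the preprocessing.\<close>

text \<open>
  All loops are bounded, so that the semantics is a total function. Variable 0 is never assigned and
  holds a number \<open>D\<close> at which \<open>Inc\<close> saturates: all values of variables and arrays are bounded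
  by \<open>D\<close>, and only the temporary values of expressions can be larger.
\<close>

datatype expr = N nat | V nat | Plus expr expr | Minus expr expr | Times expr expr | Arr nat expr expr

datatype com =
    Skip
  | Assign nat expr
  | Inc nat
  | Write nat expr expr expr
  | Read nat expr
  | Print nat
  | Seq com com (infixr ";;" 60)
  | IfLess expr expr com com
  | For nat nat com

record state =
  var :: "nat \<Rightarrow> nat"
  arr :: "nat \<Rightarrow> nat \<Rightarrow> nat \<Rightarrow> nat"
  inp :: "nat \<Rightarrow> nat"
  outp :: "nat list"

abbreviation set_var :: "nat \<Rightarrow> nat \<Rightarrow> state \<Rightarrow> state" where
  "set_var x v \<sigma> \<equiv> \<sigma>\<lparr>var := (var \<sigma>)(x := v)\<rparr>"

abbreviation set_arr :: "nat \<Rightarrow> nat \<Rightarrow> nat \<Rightarrow> nat \<Rightarrow> state \<Rightarrow> state" where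
  "set_arr j p q v \<sigma> \<equiv> \<sigma>\<lparr>arr := (arr \<sigma>)(j := (arr \<sigma> j)(p := (arr \<sigma> j p)(q := v)))\<rparr>"

primrec eval :: "expr \<Rightarrow> state \<Rightarrow> nat" where
  "eval (N c) \<sigma> = c"
| "eval (V x) \<sigma> = var \<sigma> x"
| "eval (Plus a b) \<sigma> = eval a \<sigma> + eval b \<sigma>"
| "eval (Minus a b) \<sigma> = eval a \<sigma> - eval b \<sigma>"
| "eval (Times a b) \<sigma> = eval a \<sigma> * eval b \<sigma>"
| "eval (Arr j a b) \<sigma> = arr \<sigma> j (eval a \<sigma>) (eval b \<sigma>)"

text \<open>Loop counters are incremented without the test of \<open>Inc\<close>: they never exceed
  the loop limit, which is itself bounded by \<open>D\<close>.\<close>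

definition bump :: "nat \<Rightarrow> state \<Rightarrow> state" where
  "bump x \<sigma> = set_var x (var \<sigma> x + 1) \<sigma>"

primrec sem :: "com \<Rightarrow> state \<Rightarrow> state" where
  "sem Skip \<sigma> = \<sigma>"
| "sem (Assign x e) \<sigma> = set_var x (eval e \<sigma>) \<sigma>"
| "sem (Inc x) \<sigma> = set_var x (if var \<sigma> x < var \<sigma> 0 then var \<sigma> x + 1 else var \<sigma> x) \<sigma>"
| "sem (Write j a b e) \<sigma> = set_arr j (eval a \<sigma>) (eval b \<sigma>) (eval e \<sigma>) \<sigma>"
| "sem (Read x e) \<sigma> = set_var x (inp \<sigma> (eval e \<sigma>)) \<sigma>"
| "sem (Print x) \<sigma> = \<sigma>\<lparr>outp := outp \<sigma> @ [var \<sigma> x]\<rparr>"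
| "sem (c ;; d) \<sigma> = sem d (sem c \<sigma>)"
| "sem (IfLess a b c d) \<sigma> = (if eval a \<sigma> < eval b \<sigma> then sem c \<sigma> else sem d \<sigma>)"
| "sem (For x y c) \<sigma> = ((\<lambda>\<sigma>. bump x (sem c \<sigma>)) ^^ var \<sigma> y) (set_var x 0 \<sigma>)"

primrec mods :: "com \<Rightarrow> nat set" where
  "mods Skip = {}"
| "mods (Assign x e) = {x}"
| "mods (Inc x) = {x}"
| "mods (Write j a b e) = {}"
| "mods (Read x e) = {x}"
| "mods (Print x) = {}"
| "mods (c ;; d) = mods c \<union> mods d"
| "mods (IfLess a b c d) = mods c \<union> mods d"
| "mods (For x y c) = insert x (mods c)"

primrec amods :: "com \<Rightarrow> nat set" where
  "amods Skip = {}"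
| "amods (Assign x e) = {}"
| "amods (Inc x) = {}"
| "amods (Write j a b e) = {j}"
| "amods (Read x e) = {}"
| "amods (Print x) = {}"
| "amods (c ;; d) = amods c \<union> amods d"
| "amods (IfLess a b c d) = amods c \<union> amods d"
| "amods (For x y c) = amods c"

primrec silent :: "com \<Rightarrow> bool" where
  "silent Skip = True"
| "silent (Assign x e) = True"
| "silent (Inc x) = True"
| "silent (Write j a b e) = True"
| "silent (Read x e) = True"
| "silent (Print x) = False"
| "silent (c ;; d) = (silent c \<and> silent d)"
| "silent (IfLess a b c d) = (silent c \<and> silent d)"
| "silent (For x y c) = silent c"

lemma var_bump [simp]: "var (bump x \<sigma>) = (var \<sigma>)(x := var \<sigma> x + 1)"
  and arr_bump [simp]: "arr (bump x \<sigma>) = arr \<sigma>"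
  and inp_bump [simp]: "inp (bump x \<sigma>) = inp \<sigma>"
  and outp_bump [simp]: "outp (bump x \<sigma>) = outp \<sigma>"
  by (simp_all add: bump_def)

lemma funpow_invariant: "I \<sigma> \<Longrightarrow> (\<And>\<sigma>. I \<sigma> \<Longrightarrow> I (f \<sigma>)) \<Longrightarrow> I ((f ^^ n) \<sigma>)"
  by (induction n) auto

lemma var_sem: "x \<notin> mods c \<Longrightarrow> var (sem c \<sigma>) x = var \<sigma> x"
proof (induction c arbitrary: \<sigma>)
  case (For z y c)
  then show ?case
    by (simp, intro funpow_invariant[where I = "\<lambda>\<tau>. var \<tau> x = var \<sigma> x"]) auto
qed auto

lemma arr_sem: "j \<notin> amods c \<Longrightarrow> arr (sem c \<sigma>) j = arr \<sigma> j"
proof (induction c arbitrary: \<sigma>)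
  case (For z y c)
  then show ?case
    by (simp, intro funpow_invariant[where I = "\<lambda>\<tau>. arr \<tau> j = arr \<sigma> j"]) auto
qed auto

lemma inp_sem [simp]: "inp (sem c \<sigma>) = inp \<sigma>"
proof (induction c arbitrary: \<sigma>)
  case (For z y c)
  then show ?case
    by (simp, intro funpow_invariant[where I = "\<lambda>\<tau>. inp \<tau> = inp \<sigma>"]) auto
qed auto

lemma outp_sem: "silent c \<Longrightarrow> outp (sem c \<sigma>) = outp \<sigma>"
proof (induction c arbitrary: \<sigma>)
  case (For z y c)
  then show ?case
    by (simp, intro funpow_invariant[where I = "\<lambda>\<tau>. outp \<tau> = outp \<sigma>"]) auto
qed auto

text \<open>The body changes neither the counter nor the limit, so the counter equals the number of
  completed rounds and the invariant can be indexed by it.\<close>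

lemma for_rule:
  assumes "x \<notin> mods c" "y \<notin> mods c" "x \<noteq> y"
    and I0: "I 0 (set_var x 0 \<sigma>)"
    and IS: "\<And>k \<tau>. I k \<tau> \<Longrightarrow> k < var \<sigma> y \<Longrightarrow> var \<tau> x = k \<Longrightarrow> var \<tau> y = var \<sigma> y \<Longrightarrow>
               I (Suc k) (bump x (sem c \<tau>))"
  shows "I (var \<sigma> y) (sem (For x y c) \<sigma>)"
proof -
  have "I k (((\<lambda>\<sigma>. bump x (sem c \<sigma>)) ^^ k) (set_var x 0 \<sigma>)) \<and>
      var (((\<lambda>\<sigma>. bump x (sem c \<sigma>)) ^^ k) (set_var x 0 \<sigma>)) x = k \<and>
      var (((\<lambda>\<sigma>. bump x (sem c \<sigma>)) ^^ k) (set_var x 0 \<sigma>)) y = var \<sigma> y"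
    if "k \<le> var \<sigma> y" for k
    using that
  proof (induction k)
    case (Suc k)
    then show ?case using assms(1-3) IS by (auto simp: var_sem)
  qed (use I0 assms in auto)
  then show ?thesis by simp
qed

section \<open>Running times\<close>

primrec ecost :: "expr \<Rightarrow> nat" where
  "ecost (N c) = 1"
| "ecost (V x) = 1"
| "ecost (Plus a b) = ecost a + ecost b + 1"
| "ecost (Minus a b) = ecost a + ecost b + 1"
| "ecost (Times a b) = ecost a + ecost b + 1"
| "ecost (Arr j a b) = ecost a + ecost b + 9"

text \<open>These are exact instruction counts of the code generated by \<open>ccode\<close>. For
  \<open>For\<close>, 3 stands for the initial assignment, the failing test and the exit jump, and 4
  per round for the test, the two instructions of the increment and the jump back. In
  \<open>IfLess\<close> only the second branch ends with a jump.\<close>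

primrec cost :: "com \<Rightarrow> state \<Rightarrow> nat" where
  "cost Skip \<sigma> = 0"
| "cost (Assign x e) \<sigma> = ecost e + 1"
| "cost (Inc x) \<sigma> = 3"
| "cost (Write j a b e) \<sigma> = ecost a + ecost b + 8 + ecost e + 1"
| "cost (Read x e) \<sigma> = ecost e + 3"
| "cost (Print x) \<sigma> = 1"
| "cost (c ;; d) \<sigma> = cost c \<sigma> + cost d (sem c \<sigma>)"
| "cost (IfLess a b c d) \<sigma> = ecost a + ecost b + 1 +
     (if eval a \<sigma> < eval b \<sigma> then cost c \<sigma> else cost d \<sigma> + 1)"
| "cost (For x y c) \<sigma> = 3 +
     (\<Sum>k<var \<sigma> y. 4 + cost c (((\<lambda>\<sigma>. bump x (sem c \<sigma>)) ^^ k) (set_var x 0 \<sigma>)))"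

primrec lims :: "com \<Rightarrow> nat set" where
  "lims Skip = {}"
| "lims (Assign x e) = {}"
| "lims (Inc x) = {}"
| "lims (Write j a b e) = {}"
| "lims (Read x e) = {}"
| "lims (Print x) = {}"
| "lims (c ;; d) = lims c \<union> lims d"
| "lims (IfLess a b c d) = lims c \<union> lims d"
| "lims (For x y c) = insert y (lims c)"

text \<open>
  A bound that depends only on the initial values of the loop limits, provided that these are
  not modified.
\<close>

primrec scost :: "com \<Rightarrow> (nat \<Rightarrow> nat) \<Rightarrow> nat" where
  "scost Skip \<rho> = 0"
| "scost (Assign x e) \<rho> = ecost e + 1"
| "scost (Inc x) \<rho> = 3"
| "scost (Write j a b e) \<rho> = ecost a + ecost b + 8 + ecost e + 1"
| "scost (Read x e) \<rho> = ecost e + 3"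
| "scost (Print x) \<rho> = 1"
| "scost (c ;; d) \<rho> = scost c \<rho> + scost d \<rho>"
| "scost (IfLess a b c d) \<rho> = ecost a + ecost b + 2 + scost c \<rho> + scost d \<rho>"
| "scost (For x y c) \<rho> = 3 + \<rho> y * (4 + scost c \<rho>)"

lemma scost_cong: "(\<And>y. y \<in> lims c \<Longrightarrow> \<rho> y = \<rho>' y) \<Longrightarrow> scost c \<rho> = scost c \<rho>'"
  by (induction c) auto

lemma cost_le_scost: "lims c \<inter> mods c = {} \<Longrightarrow> cost c \<sigma> \<le> scost c (var \<sigma>)"
proof (induction c arbitrary: \<sigma>)
  case (Seq c d)
  have "scost d (var (sem c \<sigma>)) = scost d (var \<sigma>)"
    using Seq.prems by (intro scost_cong var_sem) auto
  moreover have "cost c \<sigma> \<le> scost c (var \<sigma>)" "cost d (sem c \<sigma>) \<le> scost d (var (sem c \<sigma>))"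
    using Seq.prems by (auto intro!: Seq.IH)
  ultimately show ?case by simp
next
  case (IfLess a b c d)
  then have "cost c \<sigma> \<le> scost c (var \<sigma>)" "cost d \<sigma> \<le> scost d (var \<sigma>)"
    by auto
  then show ?case by simp
next
  case (For x y c)
  let ?s = "\<lambda>k. ((\<lambda>\<sigma>. bump x (sem c \<sigma>)) ^^ k) (set_var x 0 \<sigma>)"
  have "cost c (?s k) \<le> scost c (var \<sigma>)" for k
  proof -
    have "\<forall>z\<in>lims c. var (?s k) z = var \<sigma> z"
      using For.prems
      by (intro funpow_invariant[where I = "\<lambda>\<tau>. \<forall>z\<in>lims c. var \<tau> z = var \<sigma> z"])
        (auto simp: var_sem disjoint_iff)
    then have "scost c (var (?s k)) = scost c (var \<sigma>)"
      by (intro scost_cong) auto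
    moreover have "cost c (?s k) \<le> scost c (var (?s k))"
      using For.prems by (intro For.IH) auto
    ultimately show ?thesis by simp
  qed
  then have "(\<Sum>k<var \<sigma> y. 4 + cost c (?s k)) \<le> (\<Sum>k<var \<sigma> y. 4 + scost c (var \<sigma>))"
    by (intro sum_mono) auto
  then show ?case by simp
qed auto

section \<open>Bounds on stored and temporary values\<close>

primrec wf_expr :: "nat \<Rightarrow> expr \<Rightarrow> bool" where
  "wf_expr b (N c) \<longleftrightarrow> c \<le> b"
| "wf_expr b (V x) \<longleftrightarrow> x < 32"
| "wf_expr b (Plus d e) \<longleftrightarrow> wf_expr b d \<and> wf_expr b e"
| "wf_expr b (Minus d e) \<longleftrightarrow> wf_expr b d \<and> wf_expr b e"
| "wf_expr b (Times d e) \<longleftrightarrow> wf_expr b d \<and> wf_expr b e"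
| "wf_expr b (Arr j d e) \<longleftrightarrow> j < 16 \<and> wf_expr b d \<and> wf_expr b e"

text \<open>Only such expressions may be assigned or written: their values never exceed the largest
  stored value or constant, so the bound \<open>D\<close> on stored values survives every command.
  Sums and products are left to indices and tests.\<close>

primrec nongrowing :: "expr \<Rightarrow> bool" where
  "nongrowing (N c) \<longleftrightarrow> True"
| "nongrowing (V x) \<longleftrightarrow> True"
| "nongrowing (Plus d e) \<longleftrightarrow> False"
| "nongrowing (Minus d e) \<longleftrightarrow> nongrowing d"
| "nongrowing (Times d e) \<longleftrightarrow> False"
| "nongrowing (Arr j d e) \<longleftrightarrow> True"

primrec wf_com :: "nat \<Rightarrow> com \<Rightarrow> bool" where
  "wf_com b Skip \<longleftrightarrow> True"
| "wf_com b (Assign x e) \<longleftrightarrow> 0 < x \<and> x < 32 \<and> wf_expr b e \<and> nongrowing e"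
| "wf_com b (Inc x) \<longleftrightarrow> 0 < x \<and> x < 32"
| "wf_com b (Write j d e f) \<longleftrightarrow> j < 16 \<and> wf_expr b d \<and> wf_expr b e \<and> wf_expr b f \<and> nongrowing f"
| "wf_com b (Read x e) \<longleftrightarrow> 0 < x \<and> x < 32 \<and> wf_expr b e"
| "wf_com b (Print x) \<longleftrightarrow> x < 32"
| "wf_com b (c ;; d) \<longleftrightarrow> wf_com b c \<and> wf_com b d"
| "wf_com b (IfLess d e c c') \<longleftrightarrow> wf_expr b d \<and> wf_expr b e \<and> wf_com b c \<and> wf_com b c'"
| "wf_com b (For x y c) \<longleftrightarrow> 0 < x \<and> x < 32 \<and> y < 32 \<and> x \<noteq> y \<and> x \<notin> mods c \<and> y \<notin> mods c \<and> wf_com b c"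

definition small :: "nat \<Rightarrow> state \<Rightarrow> bool" where
  "small D \<sigma> \<longleftrightarrow> var \<sigma> 0 = D \<and> (\<forall>x. var \<sigma> x \<le> D) \<and> (\<forall>j p q. arr \<sigma> j p q \<le> D) \<and> (\<forall>a. inp \<sigma> a \<le> D)"

lemma eval_nongrowing_le: "small D \<sigma> \<Longrightarrow> wf_expr b e \<Longrightarrow> b \<le> D \<Longrightarrow> nongrowing e \<Longrightarrow> eval e \<sigma> \<le> D"
  by (induction e) (auto simp: small_def intro: le_trans[OF diff_le_self])

lemma small_sem: "small D \<sigma> \<Longrightarrow> wf_com b c \<Longrightarrow> b \<le> D \<Longrightarrow> small D (sem c \<sigma>)"
proof (induction c arbitrary: \<sigma>)
  case (For x y c)
  have "var \<sigma> y \<le> D" using For.prems by (simp add: small_def)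
  have "small D (sem (For x y c) \<sigma>) \<and> var (sem (For x y c) \<sigma>) x = var \<sigma> y"
  proof (rule for_rule[where I = "\<lambda>k \<tau>. small D \<tau> \<and> var \<tau> x = k"])
    fix k \<tau>
    assume a: "small D \<tau> \<and> var \<tau> x = k" "k < var \<sigma> y"
    then have "small D (sem c \<tau>)" using For by simp
    moreover have "var (sem c \<tau>) x = k" using a For.prems by (simp add: var_sem)
    moreover have "k + 1 \<le> D" using a \<open>var \<sigma> y \<le> D\<close> by simp
    ultimately show "small D (bump x (sem c \<tau>)) \<and> var (bump x (sem c \<tau>)) x = Suc k"
      using For.prems by (auto simp: small_def)
  qed (use For.prems in \<open>auto simp: small_def\<close>)
  then show ?case ..
next
  case (Assign x e)
  then show ?case using eval_nongrowing_le[of D \<sigma> b e] by (auto simp: small_def)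
next
  case (Write j d e f)
  then show ?case using eval_nongrowing_le[of D \<sigma> b f] by (auto simp: small_def)
qed (auto simp: small_def)

text \<open>The power of \<open>D\<close> with this exponent bounds every number met during the
  evaluation, not only the result. For \<open>Arr\<close> the exponent is that of the address, as
  computed in \<open>address_bounds\<close>.\<close>

primrec esize :: "expr \<Rightarrow> nat" where
  "esize (N c) = 1"
| "esize (V x) = 1"
| "esize (Plus a b) = esize a + esize b"
| "esize (Minus a b) = esize a + esize b"
| "esize (Times a b) = esize a + esize b"
| "esize (Arr j a b) = 2 * esize a + 3 * esize b + 3"

primrec csize :: "com \<Rightarrow> nat" where
  "csize Skip = 0"
| "csize (Assign x e) = esize e"
| "csize (Inc x) = 1"
| "csize (Write j a b e) = 2 * esize a + 3 * esize b + 3 + esize e"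
| "csize (Read x e) = esize e"
| "csize (Print x) = 0"
| "csize (c ;; d) = csize c + csize d"
| "csize (IfLess a b c d) = esize a + esize b + csize c + csize d"
| "csize (For x y c) = 2 + csize c"

lemma esize_pos: "0 < esize e"
  by (induction e) auto

text \<open>Both powers are at least 2, and (x + 2) * (y + 2) is at least (x + 2) + (y + 2).\<close>

lemma power_add_le:
  fixes D :: nat
  assumes "2 \<le> D" "0 < a" "0 < b"
  shows "D ^ a + D ^ b \<le> D ^ (a + b)"
proof -
  have "2 \<le> D ^ a" "2 \<le> D ^ b"
    using assms by (metis One_nat_def Suc_leI le_trans power_increasing power_one_right Suc_1 le_SucI le_numeral_extra(4) one_le_numeral)+
  then obtain x y where "D ^ a = x + 2" "D ^ b = y + 2"
    by (metis add.commute le_Suc_ex)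
  then show ?thesis by (simp add: power_add algebra_simps)
qed

lemma eval_le: "small D \<sigma> \<Longrightarrow> wf_expr b e \<Longrightarrow> b \<le> D \<Longrightarrow> 2 \<le> D \<Longrightarrow> eval e \<sigma> \<le> D ^ esize e"
proof (induction e)
  case (Plus a b)
  then show ?case
    using power_add_le[of D "esize a" "esize b"] esize_pos[of a] esize_pos[of b] by simp
next
  case (Minus a b)
  then have "eval a \<sigma> \<le> D ^ esize a" by simp
  also have "\<dots> \<le> D ^ (esize a + esize b)" using Minus.prems by (intro power_increasing) auto
  finally show ?case by simp
next
  case (Times a b)
  then show ?case by (simp add: power_add mult_le_mono)
next
  case (Arr j a b)
  then have "eval (Arr j a b) \<sigma> \<le> D ^ 1" by (simp add: small_def)
  also have "\<dots> \<le> D ^ esize (Arr j a b)" using Arr.prems by (intro power_increasing) auto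
  finally show ?case .
qed (auto simp: small_def)

section \<open>Compilation to the random access machine\<close>

text \<open>
  Register 0 holds \<open>D\<close>, which exceeds all addresses of the input, registers 1 to 31 hold the
  variables, and the registers from 32 on are temporary. Entry \<open>(p, q)\<close> of array \<open>j < 16\<close> lives
  at address \<open>D + 16 * ((p + q)\<^sup>2 + q) + j\<close>.
\<close>

definition addr_code :: "nat \<Rightarrow> nat \<Rightarrow> program" where
  "addr_code j d = [Add d d (d + 1), Mul d d d, Add d d (d + 1), Const (d + 1) 16,
     Mul d d (d + 1), Const (d + 1) j, Add d d (d + 1), Add d d 0]"

primrec ecode :: "expr \<Rightarrow> nat \<Rightarrow> program" where
  "ecode (N c) d = [Const d c]"
| "ecode (V x) d = [Move d x]"
| "ecode (Plus a b) d = ecode a d @ ecode b (d + 1) @ [Add d d (d + 1)]"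
| "ecode (Minus a b) d = ecode a d @ ecode b (d + 1) @ [Sub d d (d + 1)]"
| "ecode (Times a b) d = ecode a d @ ecode b (d + 1) @ [Mul d d (d + 1)]"
| "ecode (Arr j a b) d = ecode a d @ ecode b (d + 1) @ addr_code j d @ [Load d d]"

text \<open>Jumps are absolute, hence the argument \<open>l\<close> for the position of the code.
  \<open>Read\<close> tests its address against register 0, because from \<open>D\<close> on the
  memory holds the arrays, whereas \<open>inp\<close> is 0 there.\<close>

primrec ccode :: "com \<Rightarrow> nat \<Rightarrow> program" where
  "ccode Skip l = []"
| "ccode (Assign x e) l = ecode e 32 @ [Move x 32]"
| "ccode (Inc x) l = [Const 32 1, JumpLess x 0 (l + 3), Jump (l + 4), Add x x 32]"
| "ccode (Write j a b e) l =
     ecode a 32 @ ecode b 33 @ addr_code j 32 @ ecode e 33 @ [Store 32 33]"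
| "ccode (Read x e) l = (let l' = l + ecost e in
     ecode e 32 @ [Const x 0, JumpLess 32 0 (l' + 3), Jump (l' + 4), Load x 32])"
| "ccode (Print x) l = [Out x]"
| "ccode (c ;; d) l = (let c' = ccode c l in c' @ ccode d (l + length c'))"
| "ccode (IfLess a b c d) l =
     (let l1 = l + ecost a + ecost b + 1; d' = ccode d l1; l2 = l1 + length d' + 1;
          c' = ccode c l2
      in ecode a 32 @ ecode b 33 @ [JumpLess 32 33 l2] @ d' @ [Jump (l2 + length c')] @ c')"
| "ccode (For x y c) l =
     (let c' = ccode c (l + 3)
      in [Const x 0, JumpLess x y (l + 3), Jump (l + length c' + 6)] @ c' @
         [Const 32 1, Add x x 32, Jump (l + 1)])"

lemma length_addr_code [simp]: "length (addr_code j d) = 8"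
  by (simp add: addr_code_def)

lemma length_ecode [simp]: "length (ecode e d) = ecost e"
  by (induction e arbitrary: d) auto

definition code_at :: "program \<Rightarrow> nat \<Rightarrow> program \<Rightarrow> bool" where
  "code_at P l cs \<longleftrightarrow> l + length cs \<le> length P \<and> (\<forall>k<length cs. P ! (l + k) = cs ! k)"

lemma code_at_append [simp]:
  "code_at P l (xs @ ys) \<longleftrightarrow> code_at P l xs \<and> code_at P (l + length xs) ys"
proof -
  have "(\<forall>k<length xs + length ys. P ! (l + k) = (xs @ ys) ! k) \<longleftrightarrow>
    (\<forall>k<length xs. P ! (l + k) = xs ! k) \<and> (\<forall>k<length ys. P ! (l + length xs + k) = ys ! k)"
    (is "?L \<longleftrightarrow> ?R")
  proof
    assume L: ?L
    show ?R
    proof (intro conjI allI impI)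
      fix k assume "k < length xs" then show "P ! (l + k) = xs ! k"
        using L[rule_format, of k] by (simp add: nth_append)
    next
      fix k assume "k < length ys" then show "P ! (l + length xs + k) = ys ! k"
        using L[rule_format, of "length xs + k"] by (simp add: nth_append add.assoc)
    qed
  next
    assume R: ?R
    show ?L
    proof (intro allI impI)
      fix k assume k: "k < length xs + length ys"
      show "P ! (l + k) = (xs @ ys) ! k"
      proof (cases "k < length xs")
        case False
        then have "k - length xs < length ys" "l + length xs + (k - length xs) = l + k"
          using k by auto
        then show ?thesis using R False by (metis nth_append)
      qed (use R in \<open>simp add: nth_append\<close>)
    qed
  qed
  then show ?thesis by (auto simp: code_at_def)
qed

lemma code_at_Cons [simp]:
  "code_at P l (x # xs) \<longleftrightarrow> l < length P \<and> P ! l = x \<and> code_at P (Suc l) xs"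
  by (auto simp: code_at_def less_Suc_eq_0_disj all_conj_distrib nth_Cons split: nat.splits)

section \<open>Execution of code fragments\<close>

definition fits :: "nat \<Rightarrow> config \<Rightarrow> bool" where
  "fits B C \<longleftrightarrow> (\<forall>i. reg C i < B) \<and> (\<forall>a. mem C a < B)"

text \<open>Fragments without \<open>Emit\<close> are the unit of composition, so that answers can
  be completed only in the steps between them. The bound is demanded at all times before the last
  one; \<open>fits\<close> of the last configuration is carried along separately.\<close>

definition runs :: "program \<Rightarrow> nat \<Rightarrow> config \<Rightarrow> nat \<Rightarrow> config \<Rightarrow> bool" where
  "runs P B C t C' \<longleftrightarrow> (step P ^^ t) C = C' \<and>
     (\<forall>t'<t. fits B ((step P ^^ t') C) \<and> \<not> halted P ((step P ^^ t') C) \<and>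
        P ! pc ((step P ^^ t') C) \<noteq> Emit)"

lemma runs_0 [simp]: "runs P B C 0 C"
  by (simp add: runs_def)

lemma runs_trans:
  assumes "runs P B C t C'" "runs P B C' t' C''"
  shows "runs P B C (t + t') C''"
proof -
  have *: "(step P ^^ (k + t)) C = (step P ^^ k) C'" for k
    using assms(1) by (simp add: runs_def funpow_add)
  show ?thesis
    unfolding runs_def
  proof (intro conjI allI impI)
    show "(step P ^^ (t + t')) C = C''"
      using *[of t'] assms(2) by (simp add: runs_def add.commute)
    fix k assume "k < t + t'"
    then consider "k < t" | k' where "k = k' + t" "k' < t'"
      by (metis add.commute le_Suc_ex linorder_not_less nat_add_left_cancel_less)
    then have "fits B ((step P ^^ k) C) \<and> \<not> halted P ((step P ^^ k) C) \<and>
        P ! pc ((step P ^^ k) C) \<noteq> Emit"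
    proof cases
      case 2
      then show ?thesis using * assms(2) by (simp add: runs_def)
    qed (use assms(1) in \<open>simp add: runs_def\<close>)
    then show "fits B ((step P ^^ k) C)" "\<not> halted P ((step P ^^ k) C)"
      "P ! pc ((step P ^^ k) C) \<noteq> Emit" by auto
  qed
qed

lemma runs_step:
  assumes "pc C < length P" "P ! pc C \<noteq> Emit" "fits B C"
  shows "runs P B C 1 (exec (P ! pc C) C)"
  using assms by (auto simp: runs_def step_def halted_def)

primrec fits_along :: "nat \<Rightarrow> program \<Rightarrow> config \<Rightarrow> bool" where
  "fits_along B [] C \<longleftrightarrow> fits B C"
| "fits_along B (i # is) C \<longleftrightarrow> fits B C \<and> fits_along B is (exec i C)"

fun straight :: "instr \<Rightarrow> bool" where
  "straight (Jump l) = False"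
| "straight (JumpLess a b l) = False"
| "straight Emit = False"
| "straight _ = True"

lemma straight_addr_code: "list_all straight (addr_code j d)"
  by (simp add: addr_code_def)

lemma pc_exec_straight: "straight i \<Longrightarrow> pc (exec i C) = pc C + 1"
  by (cases i) auto

lemma runs_straight:
  assumes "code_at P (pc C) is" "list_all straight is" "fits_along B is C"
  shows "runs P B C (length is) (fold exec is C)" "fits B (fold exec is C)"
    "pc (fold exec is C) = pc C + length is"
proof -
  have "runs P B C (length is) (fold exec is C) \<and> fits B (fold exec is C) \<and>
      pc (fold exec is C) = pc C + length is"
    using assms
  proof (induction "is" arbitrary: C)
    case (Cons i "is")
    have i: "straight i" "fits B C" "pc C < length P" "P ! pc C = i" using Cons.prems by auto
    then have "runs P B C 1 (exec i C)"
      using runs_step[of C P B] by (metis straight.simps(3))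
    moreover have "runs P B (exec i C) (length is) (fold exec is (exec i C)) \<and>
        fits B (fold exec is (exec i C)) \<and>
        pc (fold exec is (exec i C)) = pc (exec i C) + length is"
      using Cons.prems i by (intro Cons.IH) (auto simp: pc_exec_straight)
    ultimately show ?case
      using runs_trans i by (fastforce simp: pc_exec_straight)
  qed auto
  then show "runs P B C (length is) (fold exec is C)" "fits B (fold exec is C)"
    "pc (fold exec is C) = pc C + length is" by auto
qed

lemma fits_set_reg [simp]:
  "fits B C \<Longrightarrow> v < B \<Longrightarrow> fits B (C\<lparr>pc := l, reg := (reg C)(r := v)\<rparr>)"
  by (simp add: fits_def)

lemma fits_set_mem [simp]:
  "fits B C \<Longrightarrow> v < B \<Longrightarrow> fits B (C\<lparr>pc := l, mem := (mem C)(a := v)\<rparr>)"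
  by (simp add: fits_def)

lemma fits_set_pc [simp]: "fits B (C\<lparr>pc := l\<rparr>) = fits B C"
  by (simp add: fits_def)

lemma fits_set_buffer [simp]: "fits B (C\<lparr>pc := l, buffer := b\<rparr>) = fits B C"
  by (simp add: fits_def)

definition pairing :: "nat \<Rightarrow> nat \<Rightarrow> nat" where
  "pairing p q = (p + q) * (p + q) + q"

definition address :: "nat \<Rightarrow> nat \<Rightarrow> nat \<Rightarrow> nat \<Rightarrow> nat" where
  "address D j p q = pairing p q * 16 + j + D"

text \<open>Since \<open>q\<close> is at most \<open>p + q\<close>, the number (p + q)^2 + q lies
  below the next square, so \<open>p + q\<close> and then \<open>q\<close> can be recovered. No
  bound on either index is involved, so arrays have no declared dimensions.\<close>

lemma pairing_inj:
  assumes "pairing p q = pairing p' q'"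
  shows "p = p' \<and> q = q'"
proof -
  have aux: "\<not> x < y" if "x * x + a = y * y + b" "a \<le> x" for x y a b :: nat
  proof
    assume "x < y"
    then have "(x + 1) * (x + 1) \<le> y * y" by (intro mult_le_mono) auto
    then show False using that by simp
  qed
  note assms = assms[unfolded pairing_def]
  have "p + q = p' + q'"
    using aux[OF assms] aux[OF assms[symmetric]] by simp
  then show ?thesis using assms by auto
qed

lemma address_eq_iff:
  assumes "j < 16" "j' < 16"
  shows "address D j p q = address D j' p' q' \<longleftrightarrow> j = j' \<and> p = p' \<and> q = q'"
proof
  assume eq: "address D j p q = address D j' p' q'"
  have "(pairing p q * 16 + j) mod 16 = j" "(pairing p' q' * 16 + j') mod 16 = j'"
    using assms by simp_all
  then have "j = j'" using eq unfolding address_def by (metis add_right_cancel)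
  then show "j = j' \<and> p = p' \<and> q = q'"
    using eq pairing_inj[of p q p' q'] by (simp add: address_def)
qed auto

text \<open>Nothing is said about the temporary registers. The output is compared with the buffer,
  so it consists of the words printed since the last \<open>Emit\<close>.\<close>

definition matches :: "nat \<Rightarrow> config \<Rightarrow> state \<Rightarrow> bool" where
  "matches l C \<sigma> \<longleftrightarrow> pc C = l \<and> (\<forall>x<32. reg C x = var \<sigma> x) \<and>
     (\<forall>a<var \<sigma> 0. mem C a = inp \<sigma> a) \<and> (\<forall>a\<ge>var \<sigma> 0. inp \<sigma> a = 0) \<and>
     (\<forall>j p q. j < 16 \<longrightarrow> mem C (address (var \<sigma> 0) j p q) = arr \<sigma> j p q) \<and>
     buffer C = outp \<sigma>"

text \<open>The square of \<open>p + q\<close> takes the exponent 2 * (a + b), adding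
  \<open>q\<close> another b, the factor 16 one more \<open>D\<close>, and the two last summands one
  each.\<close>

lemma address_bounds:
  assumes "small D \<sigma>" "p \<le> D ^ a" "q \<le> D ^ b" "0 < a" "0 < b" "16 \<le> D" "j < 16"
  shows "address D j p q \<le> D ^ (2 * a + 3 * b + 3)"
proof -
  have D: "2 \<le> D" using assms by simp
  have 1: "p + q \<le> D ^ (a + b)"
    using power_add_le[OF D assms(4,5)] assms by simp
  have "(p + q) * (p + q) \<le> D ^ (2 * a + 2 * b)"
    using mult_le_mono[OF 1 1] by (simp flip: power_add) (simp add: mult_2 add_ac)
  moreover have "D ^ (2 * a + 2 * b) + D ^ b \<le> D ^ (2 * a + 3 * b)"
    using power_add_le[OF D, of "2 * a + 2 * b" b] assms by (simp add: algebra_simps)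
  ultimately have "(p + q) * (p + q) + q \<le> D ^ (2 * a + 3 * b)" using assms by linarith
  then have "pairing p q * 16 \<le> D ^ (2 * a + 3 * b) * D"
    using assms unfolding pairing_def by (intro mult_le_mono) auto
  then have 2: "pairing p q * 16 \<le> D ^ (2 * a + 3 * b + 1)" by (simp add: mult.commute)
  have "address D j p q \<le> D ^ (2 * a + 3 * b + 1) + D ^ 1 + D ^ 1"
    using 2 assms(6,7) unfolding address_def by (intro add_mono) auto
  also have "\<dots> \<le> D ^ (2 * a + 3 * b + 2) + D ^ 1"
    using power_add_le[OF D, of "2 * a + 3 * b + 1" 1] by simp
  also have "\<dots> \<le> D ^ (2 * a + 3 * b + 3)"
    using power_add_le[OF D, of "2 * a + 3 * b + 2" 1] by (simp add: eval_nat_numeral)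
  finally show ?thesis .
qed

locale machine =
  fixes P :: program and B D b :: nat
  assumes D: "16 \<le> D" "b \<le> D" and B: "D < B"
begin

lemma addr_code_runs:
  assumes "code_at P l (addr_code j d)" "matches l C \<sigma>" "fits B C" "32 \<le> d" "small D \<sigma>"
    and "reg C d = p" "reg C (d + 1) = q" "j < 16"
    and "p \<le> D ^ e" "q \<le> D ^ f" "0 < e" "0 < f" "D ^ (2 * e + 3 * f + 3) < B"
  shows "\<exists>C'. runs P B C 8 C' \<and> fits B C' \<and> matches (l + 8) C' \<sigma> \<and>
    reg C' d = address D j p q \<and> (\<forall>r<d. reg C' r = reg C r) \<and> mem C' = mem C"
proof -
  have A: "address D j p q < B"
    using address_bounds assms D by (meson le_less_trans)
  have *: "p + q \<le> (p + q) * (p + q)" by (rule le_square)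
  \<comment> \<open>All numbers computed on the way are at most the address itself; only the
    constants 16 and \<open>j\<close> are compared with \<open>D\<close>.\<close>
  have b: "pairing p q * 16 + j < B" "pairing p q * 16 < B"
    "pairing p q < B" "(p + q) * (p + q) < B" "p + q < B" "16 < B" "j < B"
  proof -
    show "pairing p q * 16 + j < B" using A unfolding address_def by linarith
    then show "pairing p q * 16 < B" by linarith
    then show "pairing p q < B" by linarith
    then show "(p + q) * (p + q) < B" unfolding pairing_def by linarith
    then show "p + q < B" using * by linarith
  qed (use D B assms(8) in auto)
  have reg0: "reg C 0 = D" using assms by (auto simp: matches_def small_def)
  have fa: "fits_along B (addr_code j d) C"
    using assms(3,4,6-8) b A reg0
    by (simp add: addr_code_def address_def fits_def flip: pairing_def)
  define C' where "C' = fold exec (addr_code j d) C"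
  have "pc C = l" using assms by (simp add: matches_def)
  then have r: "runs P B C 8 C'" "fits B C'" "pc C' = l + 8"
    using runs_straight[OF _ straight_addr_code fa, of P] assms(1) by (auto simp: C'_def)
  have reg': "reg C' d = address D j p q"
    using assms(4,6,7) reg0 by (simp add: C'_def addr_code_def address_def flip: pairing_def)
  have regs: "\<forall>r<d. reg C' r = reg C r" "mem C' = mem C" "buffer C' = buffer C"
    using assms(4) by (simp_all add: C'_def addr_code_def)
  then have "matches (l + 8) C' \<sigma>"
    using assms(2,4) r(3) by (simp add: matches_def)
  then show ?thesis using r reg' regs by auto
qed

lemma power_less: "D ^ k < B \<Longrightarrow> i \<le> k \<Longrightarrow> D ^ i < B"
  using D power_increasing[of i k D] by linarith

lemma set_temp_runs:
  assumes "matches l C \<sigma>" "fits B C" "l < length P" "P ! l = i" "i \<noteq> Emit"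
    and "exec i C = C\<lparr>pc := pc C + 1, reg := (reg C)(d := v)\<rparr>" "v < B" "32 \<le> d"
  shows "\<exists>C'. runs P B C 1 C' \<and> fits B C' \<and> matches (l + 1) C' \<sigma> \<and> reg C' d = v \<and>
    (\<forall>r<d. reg C' r = reg C r) \<and> mem C' = mem C"
  using runs_step[of C P B] assms
  by (intro exI[of _ "exec i C"]) (simp add: matches_def)

text \<open>The code leaves the registers below \<open>d\<close> alone. Hence the first operand in
  \<open>d\<close> survives the evaluation of the second one in \<open>d + 1\<close>, and the
  variables are never touched.\<close>

lemma ecode_runs:
  assumes "code_at P l (ecode e d)" "matches l C \<sigma>" "fits B C" "32 \<le> d" "small D \<sigma>"
    and "wf_expr b e" "D ^ esize e < B"
  shows "\<exists>C'. runs P B C (ecost e) C' \<and> fits B C' \<and> matches (l + ecost e) C' \<sigma> \<and>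
    reg C' d = eval e \<sigma> \<and> (\<forall>r<d. reg C' r = reg C r) \<and> mem C' = mem C"
  using assms
proof (induction e arbitrary: l d C)
  case (N c)
  then show ?case using D B set_temp_runs[of l C \<sigma> "Const d c" d c] by simp
next
  case (V x)
  have "var \<sigma> x < B" using V.prems(5) B unfolding small_def by (meson le_less_trans)
  moreover have "reg C x = var \<sigma> x" using V by (simp add: matches_def)
  ultimately show ?case using V set_temp_runs[of l C \<sigma> "Move d x" d "var \<sigma> x"] by simp
next
  case (Plus e f)
  have pw: "D ^ esize e < B" "D ^ esize f < B"
    using Plus.prems(7) power_less[of "esize e + esize f" "esize e"] power_less[of "esize e + esize f" "esize f"] by simp_all
  obtain C1 where C1: "runs P B C (ecost e) C1" "fits B C1" "matches (l + ecost e) C1 \<sigma>"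
    "reg C1 d = eval e \<sigma>" "\<forall>r<d. reg C1 r = reg C r" "mem C1 = mem C"
    using Plus.IH(1)[of l d C] Plus.prems pw by auto
  obtain C2 where C2: "runs P B C1 (ecost f) C2" "fits B C2"
    "matches (l + ecost e + ecost f) C2 \<sigma>"
    "reg C2 (d + 1) = eval f \<sigma>" "\<forall>r<d + 1. reg C2 r = reg C1 r" "mem C2 = mem C1"
    using Plus.IH(2)[of "l + ecost e" "d + 1" C1] Plus.prems pw C1 by auto
  have v: "eval (Plus e f) \<sigma> < B"
    using eval_le[of D \<sigma> b "Plus e f"] Plus.prems D by simp
  obtain C3 where C3: "runs P B C2 1 C3" "fits B C3" "matches (l + ecost e + ecost f + 1) C3 \<sigma>"
    "reg C3 d = eval (Plus e f) \<sigma>" "\<forall>r<d. reg C3 r = reg C2 r" "mem C3 = mem C2"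
    using set_temp_runs[OF C2(3,2) _ _ _ _ v, of "Add d d (d + 1)" d] Plus.prems C1 C2
    by (auto simp: add.assoc)
  then show ?case
    using runs_trans[OF runs_trans[OF C1(1) C2(1)] C3(1)] C1 C2 Plus.prems
    by (intro exI[of _ C3]) (simp add: add.assoc)
next
  case (Minus e f)
  have pw: "D ^ esize e < B" "D ^ esize f < B"
    using Minus.prems(7) power_less[of "esize e + esize f" "esize e"] power_less[of "esize e + esize f" "esize f"] by simp_all
  obtain C1 where C1: "runs P B C (ecost e) C1" "fits B C1" "matches (l + ecost e) C1 \<sigma>"
    "reg C1 d = eval e \<sigma>" "\<forall>r<d. reg C1 r = reg C r" "mem C1 = mem C"
    using Minus.IH(1)[of l d C] Minus.prems pw by auto
  obtain C2 where C2: "runs P B C1 (ecost f) C2" "fits B C2"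
    "matches (l + ecost e + ecost f) C2 \<sigma>"
    "reg C2 (d + 1) = eval f \<sigma>" "\<forall>r<d + 1. reg C2 r = reg C1 r" "mem C2 = mem C1"
    using Minus.IH(2)[of "l + ecost e" "d + 1" C1] Minus.prems pw C1 by auto
  have v: "eval (Minus e f) \<sigma> < B"
    using eval_le[of D \<sigma> b "Minus e f"] Minus.prems D by simp
  obtain C3 where C3: "runs P B C2 1 C3" "fits B C3" "matches (l + ecost e + ecost f + 1) C3 \<sigma>"
    "reg C3 d = eval (Minus e f) \<sigma>" "\<forall>r<d. reg C3 r = reg C2 r" "mem C3 = mem C2"
    using set_temp_runs[OF C2(3,2) _ _ _ _ v, of "Sub d d (d + 1)" d] Minus.prems C1 C2
    by (auto simp: add.assoc)
  then show ?case
    using runs_trans[OF runs_trans[OF C1(1) C2(1)] C3(1)] C1 C2 Minus.prems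
    by (intro exI[of _ C3]) (simp add: add.assoc)
next
  case (Times e f)
  have pw: "D ^ esize e < B" "D ^ esize f < B"
    using Times.prems(7) power_less[of "esize e + esize f" "esize e"] power_less[of "esize e + esize f" "esize f"] by simp_all
  obtain C1 where C1: "runs P B C (ecost e) C1" "fits B C1" "matches (l + ecost e) C1 \<sigma>"
    "reg C1 d = eval e \<sigma>" "\<forall>r<d. reg C1 r = reg C r" "mem C1 = mem C"
    using Times.IH(1)[of l d C] Times.prems pw by auto
  obtain C2 where C2: "runs P B C1 (ecost f) C2" "fits B C2"
    "matches (l + ecost e + ecost f) C2 \<sigma>"
    "reg C2 (d + 1) = eval f \<sigma>" "\<forall>r<d + 1. reg C2 r = reg C1 r" "mem C2 = mem C1"
    using Times.IH(2)[of "l + ecost e" "d + 1" C1] Times.prems pw C1 by auto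
  have v: "eval (Times e f) \<sigma> < B"
    using eval_le[of D \<sigma> b "Times e f"] Times.prems D by simp
  obtain C3 where C3: "runs P B C2 1 C3" "fits B C3" "matches (l + ecost e + ecost f + 1) C3 \<sigma>"
    "reg C3 d = eval (Times e f) \<sigma>" "\<forall>r<d. reg C3 r = reg C2 r" "mem C3 = mem C2"
    using set_temp_runs[OF C2(3,2) _ _ _ _ v, of "Mul d d (d + 1)" d] Times.prems C1 C2
    by (auto simp: add.assoc)
  then show ?case
    using runs_trans[OF runs_trans[OF C1(1) C2(1)] C3(1)] C1 C2 Times.prems
    by (intro exI[of _ C3]) (simp add: add.assoc)
next
  case (Arr j e f)
  have pw: "D ^ esize e < B" "D ^ esize f < B"
    using Arr.prems(7) power_less[of "2 * esize e + 3 * esize f + 3" "esize e"] power_less[of "2 * esize e + 3 * esize f + 3" "esize f"] by simp_all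
  obtain C1 where C1: "runs P B C (ecost e) C1" "fits B C1" "matches (l + ecost e) C1 \<sigma>"
    "reg C1 d = eval e \<sigma>" "\<forall>r<d. reg C1 r = reg C r" "mem C1 = mem C"
    using Arr.IH(1)[of l d C] Arr.prems pw by auto
  obtain C2 where C2: "runs P B C1 (ecost f) C2" "fits B C2"
    "matches (l + ecost e + ecost f) C2 \<sigma>"
    "reg C2 (d + 1) = eval f \<sigma>" "\<forall>r<d + 1. reg C2 r = reg C1 r" "mem C2 = mem C1"
    using Arr.IH(2)[of "l + ecost e" "d + 1" C1] Arr.prems pw C1 by auto
  have "\<exists>C3. runs P B C2 8 C3 \<and> fits B C3 \<and> matches (l + ecost e + ecost f + 8) C3 \<sigma> \<and>
    reg C3 d = address D j (eval e \<sigma>) (eval f \<sigma>) \<and> (\<forall>r<d. reg C3 r = reg C2 r) \<and> mem C3 = mem C2"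
    using Arr.prems C1 C2 D eval_le[of D \<sigma> b e] eval_le[of D \<sigma> b f] esize_pos[of e] esize_pos[of f]
    by (intro addr_code_runs[where e = "esize e" and f = "esize f"]) (auto simp: add.assoc)
  then obtain C3 where C3: "runs P B C2 8 C3" "fits B C3"
    "matches (l + ecost e + ecost f + 8) C3 \<sigma>"
    "reg C3 d = address D j (eval e \<sigma>) (eval f \<sigma>)" "\<forall>r<d. reg C3 r = reg C2 r" "mem C3 = mem C2"
    by auto
  have D0: "var \<sigma> 0 = D" using Arr.prems by (simp add: small_def)
  have m: "mem C3 (address D j (eval e \<sigma>) (eval f \<sigma>)) = arr \<sigma> j (eval e \<sigma>) (eval f \<sigma>)"
    using C3(3) Arr.prems(6) D0 by (simp add: matches_def)
  have v: "eval (Arr j e f) \<sigma> < B"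
    using C3(2) m by (metis eval.simps(6) fits_def)
  obtain C4 where C4: "runs P B C3 1 C4" "fits B C4" "matches (l + ecost e + ecost f + 8 + 1) C4 \<sigma>"
    "reg C4 d = eval (Arr j e f) \<sigma>" "\<forall>r<d. reg C4 r = reg C3 r" "mem C4 = mem C3"
    using set_temp_runs[OF C3(3,2) _ _ _ _ v, of "Load d d" d] Arr.prems C3 m
    by (auto simp: add.assoc)
  have "runs P B C (ecost (Arr j e f)) C4"
    using runs_trans[OF runs_trans[OF runs_trans[OF C1(1) C2(1)] C3(1)] C4(1)] by (simp add: add_ac)
  moreover have "matches (l + ecost (Arr j e f)) C4 \<sigma>"
    using C4(3) by (simp add: add_ac)
  moreover have "\<forall>r<d. reg C4 r = reg C r" "mem C4 = mem C"
    using C1(5,6) C2(5,6) C3(5,6) C4(5,6) by simp_all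
  ultimately show ?case using C4(2,4) by blast
qed

end

lemma add_sucs:
  "l + 3 = Suc (Suc (Suc l))" "l + 4 = Suc (Suc (Suc (Suc l)))"
  "l + 5 = Suc (Suc (Suc (Suc (Suc l))))"
  by simp_all

lemma matches_set_var:
  "matches l C \<sigma> \<Longrightarrow> 0 < x \<Longrightarrow> x < 32 \<Longrightarrow>
   matches l' (C\<lparr>pc := l', reg := (reg C)(x := v)\<rparr>) (set_var x v \<sigma>)"
  by (simp add: matches_def)

lemma matches_set_arr:
  assumes "matches l C \<sigma>" "j < 16"
  shows "matches l' (C\<lparr>pc := l', mem := (mem C)(address (var \<sigma> 0) j p q := v)\<rparr>) (set_arr j p q v \<sigma>)"
  using assms by (auto simp: matches_def address_eq_iff) (simp add: address_def)

lemma runs_exec: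
  assumes "pc C = l" "l < length P" "P ! l = i" "i \<noteq> Emit" "fits B C" "exec i C = C'"
  shows "runs P B C 1 C'"
  using runs_step[of C P B] assms by simp

context machine
begin

lemma runs_jump:
  assumes "matches l C \<sigma>" "l < length P" "P ! l = Jump l'" "fits B C"
  shows "\<exists>C'. runs P B C 1 C' \<and> fits B C' \<and> matches l' C' \<sigma> \<and> reg C' = reg C"
  using runs_exec[of C l P "Jump l'" B "C\<lparr>pc := l'\<rparr>"] assms
  by (intro exI[of _ "C\<lparr>pc := l'\<rparr>"]) (simp add: matches_def)

lemma runs_jump_less:
  assumes "matches l C \<sigma>" "l < length P" "P ! l = JumpLess r r' l'" "fits B C"
  shows "\<exists>C'. runs P B C 1 C' \<and> fits B C' \<and>
    matches (if reg C r < reg C r' then l' else l + 1) C' \<sigma> \<and> reg C' = reg C \<and> mem C' = mem C"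
proof -
  let ?l = "if reg C r < reg C r' then l' else l + 1"
  have "pc C = l" using assms(1) by (simp add: matches_def)
  then have "runs P B C 1 (C\<lparr>pc := ?l\<rparr>)"
    using assms by (intro runs_exec[of C l P "JumpLess r r' l'"]) auto
  then show ?thesis using assms
    by (intro exI[of _ "C\<lparr>pc := ?l\<rparr>"]) (simp add: matches_def)
qed

lemma runs_set_var:
  assumes "matches l C \<sigma>" "fits B C" "l < length P" "P ! l = i" "i \<noteq> Emit"
    and "exec i C = C\<lparr>pc := pc C + 1, reg := (reg C)(x := v)\<rparr>" "v < B" "0 < x" "x < 32"
  shows "\<exists>C'. runs P B C 1 C' \<and> fits B C' \<and> matches (l + 1) C' (set_var x v \<sigma>) \<and>
    (\<forall>r. r \<noteq> x \<longrightarrow> reg C' r = reg C r) \<and> mem C' = mem C"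
proof -
  have pc: "pc C = l" using assms(1) by (simp add: matches_def)
  then have "runs P B C 1 (exec i C)"
    using assms by (intro runs_exec[of C l P i]) auto
  moreover have "matches (l + 1) (exec i C) (set_var x v \<sigma>)"
    using matches_set_var[OF assms(1,8,9)] pc assms(6) by simp
  ultimately show ?thesis using assms by (intro exI[of _ "exec i C"]) simp
qed

lemma small_less: "small D \<sigma> \<Longrightarrow> var \<sigma> x < B" "small D \<sigma> \<Longrightarrow> inp \<sigma> a < B"
  using B unfolding small_def by (meson le_less_trans)+

lemma ccode_runs:
  assumes "code_at P l (ccode c l)" "matches l C \<sigma>" "fits B C" "small D \<sigma>"
    and "wf_com b c" "D ^ csize c < B"
  shows "\<exists>C'. runs P B C (cost c \<sigma>) C' \<and> fits B C' \<and>
    matches (l + length (ccode c l)) C' (sem c \<sigma>)"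
  using assms
proof (induction c arbitrary: l C \<sigma>)
  case Skip
  then show ?case by (intro exI[of _ C]) simp
next
  case (Assign x e)
  obtain C1 where C1: "runs P B C (ecost e) C1" "fits B C1" "matches (l + ecost e) C1 \<sigma>"
    "reg C1 32 = eval e \<sigma>"
    using ecode_runs[of l e 32 C \<sigma>] Assign.prems by auto
  have "eval e \<sigma> < B" using C1(2,4) by (metis fits_def)
  then obtain C2 where C2: "runs P B C1 1 C2" "fits B C2"
    "matches (l + ecost e + 1) C2 (set_var x (eval e \<sigma>) \<sigma>)"
    using runs_set_var[OF C1(3,2), of "Move x 32" x "eval e \<sigma>"] Assign.prems C1(4) by auto
  show ?case using runs_trans[OF C1(1) C2(1)] C2(2,3)
    by (intro exI[of _ C2]) simp
next
  case (Inc x)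
  have "var \<sigma> 0 = D" using Inc by (simp add: small_def)
  have code: "l < length P" "P ! l = Const 32 1" "l + 1 < length P" "P ! (l + 1) = JumpLess x 0 (l + 3)"
    "l + 2 < length P" "P ! (l + 2) = Jump (l + 4)" "l + 3 < length P" "P ! (l + 3) = Add x x 32"
    using Inc.prems by (simp_all add: add_sucs)
  have x: "0 < x" "x < 32" using Inc.prems by auto
  obtain C1 where C1: "runs P B C 1 C1" "fits B C1" "matches (l + 1) C1 \<sigma>" "reg C1 32 = 1"
    using set_temp_runs[OF Inc.prems(2,3) code(1,2), of 32 1] B D by auto
  obtain C2 where C2: "runs P B C1 1 C2" "fits B C2" "reg C2 = reg C1"
    "matches (if reg C1 x < reg C1 0 then l + 3 else l + 1 + 1) C2 \<sigma>"
    using runs_jump_less[OF C1(3) code(3,4) C1(2)] by auto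
  have r: "reg C1 x = var \<sigma> x" "reg C1 0 = var \<sigma> 0" using C1(3) Inc.prems by (auto simp: matches_def)
  show ?case
  proof (cases "var \<sigma> x < var \<sigma> 0")
    case True
    then have "var \<sigma> x + 1 < B" using \<open>var \<sigma> 0 = D\<close> B by simp
    then obtain C3 where C3: "runs P B C2 1 C3" "fits B C3"
      "matches (l + 4) C3 (set_var x (var \<sigma> x + 1) \<sigma>)"
      using runs_set_var[OF _ C2(2) code(7,8) _ _ _ x, of \<sigma> "var \<sigma> x + 1"] C2 True r C1(4)
      by (auto simp: add_sucs)
    then show ?thesis using runs_trans[OF runs_trans[OF C1(1) C2(1)] C3(1)] True
      by (intro exI[of _ C3]) (simp add: add_sucs numeral_3_eq_3)
  next
    case False
    then obtain C3 where C3: "runs P B C2 1 C3" "fits B C3" "matches (l + 4) C3 \<sigma>"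
      using runs_jump[OF _ code(5,6) C2(2)] C2(4) r by auto
    then show ?thesis using runs_trans[OF runs_trans[OF C1(1) C2(1)] C3(1)] False
      by (intro exI[of _ C3]) (simp add: add_sucs numeral_3_eq_3)
  qed
next
  case (Write j e f g)
  let ?S = "2 * esize e + 3 * esize f + 3 + esize g"
  have pw: "D ^ esize e < B" "D ^ esize f < B" "D ^ (2 * esize e + 3 * esize f + 3) < B" "D ^ esize g < B"
    using Write.prems(6) power_less[of ?S "esize e"] power_less[of ?S "esize f"]
      power_less[of ?S "2 * esize e + 3 * esize f + 3"] power_less[of ?S "esize g"] by simp_all
  have wf: "wf_expr b e" "wf_expr b f" "wf_expr b g" "j < 16" using Write.prems by auto
  have code: "code_at P l (ecode e 32)" "code_at P (l + ecost e) (ecode f 33)"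
    "code_at P (l + ecost e + ecost f) (addr_code j 32)"
    "code_at P (l + ecost e + ecost f + 8) (ecode g 33)"
    "l + ecost e + ecost f + 8 + ecost g < length P"
    "P ! (l + ecost e + ecost f + 8 + ecost g) = Store 32 33"
    using Write.prems by (simp_all add: add.assoc)
  obtain C1 where C1: "runs P B C (ecost e) C1" "fits B C1" "matches (l + ecost e) C1 \<sigma>"
    "reg C1 32 = eval e \<sigma>"
    using ecode_runs[OF code(1) Write.prems(2,3) _ Write.prems(4) wf(1) pw(1)] by auto
  obtain C2 where C2: "runs P B C1 (ecost f) C2" "fits B C2" "matches (l + ecost e + ecost f) C2 \<sigma>"
    "reg C2 33 = eval f \<sigma>" "reg C2 32 = eval e \<sigma>"
    using ecode_runs[OF code(2) C1(3,2) _ Write.prems(4) wf(2) pw(2)] C1(4) by auto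
  have v: "eval e \<sigma> \<le> D ^ esize e" "eval f \<sigma> \<le> D ^ esize f"
    using eval_le[of D \<sigma> b e] eval_le[of D \<sigma> b f] wf Write.prems D by auto
  have D0: "var \<sigma> 0 = D" using Write by (simp add: small_def)
  obtain C3 where C3: "runs P B C2 8 C3" "fits B C3" "matches (l + ecost e + ecost f + 8) C3 \<sigma>"
    "reg C3 32 = address D j (eval e \<sigma>) (eval f \<sigma>)"
    using addr_code_runs[OF code(3) C2(3,2) _ Write.prems(4) C2(5) _ wf(4) v _ _ pw(3)]
      C2(4) esize_pos by auto
  obtain C4 where C4: "runs P B C3 (ecost g) C4" "fits B C4"
    "matches (l + ecost e + ecost f + 8 + ecost g) C4 \<sigma>"
    "reg C4 33 = eval g \<sigma>" "reg C4 32 = address D j (eval e \<sigma>) (eval f \<sigma>)"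
    using ecode_runs[OF code(4) C3(3,2) _ Write.prems(4) wf(3) pw(4)] C3(4) by auto
  define C5 where "C5 = C4\<lparr>pc := l + ecost e + ecost f + 8 + ecost g + 1,
      mem := (mem C4)(address (var \<sigma> 0) j (eval e \<sigma>) (eval f \<sigma>) := eval g \<sigma>)\<rparr>"
  have pc4: "pc C4 = l + ecost e + ecost f + 8 + ecost g" using C4(3) by (simp add: matches_def)
  have C5: "runs P B C4 1 C5"
    using pc4 C4 D0 unfolding C5_def by (intro runs_exec[OF pc4 code(5,6) _ C4(2)]) auto
  have "fits B C5" unfolding C5_def using C4(2,4) by (metis fits_def fits_set_mem)
  moreover have "matches (l + ecost e + ecost f + 8 + ecost g + 1) C5
      (set_arr j (eval e \<sigma>) (eval f \<sigma>) (eval g \<sigma>) \<sigma>)"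
    unfolding C5_def using matches_set_arr[OF C4(3) wf(4)] by blast
  ultimately show ?case
    using runs_trans[OF runs_trans[OF runs_trans[OF runs_trans[OF C1(1) C2(1)] C3(1)] C4(1)] C5]
    by (intro exI[of _ C5]) (simp add: add_ac)
next
  case (Read x e)
  have D0: "var \<sigma> 0 = D" using Read by (simp add: small_def)
  let ?l = "l + ecost e"
  have code: "code_at P l (ecode e 32)" "?l < length P" "P ! ?l = Const x 0"
    "?l + 1 < length P" "P ! (?l + 1) = JumpLess 32 0 (?l + 3)"
    "?l + 2 < length P" "P ! (?l + 2) = Jump (?l + 4)"
    "?l + 3 < length P" "P ! (?l + 3) = Load x 32"
    using Read.prems by (simp_all add: Let_def add_sucs)
  have x: "0 < x" "x < 32" using Read.prems by auto
  obtain C1 where C1: "runs P B C (ecost e) C1" "fits B C1" "matches ?l C1 \<sigma>"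
    "reg C1 32 = eval e \<sigma>"
    using ecode_runs[OF code(1) Read.prems(2,3) _ Read.prems(4)] Read.prems by auto
  have pos: "0 < B" using B by simp
  obtain C2 where C2: "runs P B C1 1 C2" "fits B C2" "matches (?l + 1) C2 (set_var x 0 \<sigma>)"
    "reg C2 32 = eval e \<sigma>"
    using runs_set_var[OF C1(3,2) code(2,3) _ _ pos x] C1(4) x by auto
  have r0: "reg C2 0 = D" using C2(3) D0 x by (simp add: matches_def)
  obtain C3 where C3: "runs P B C2 1 C3" "fits B C3" "reg C3 = reg C2" "mem C3 = mem C2"
    "matches (if eval e \<sigma> < D then ?l + 3 else ?l + 1 + 1) C3 (set_var x 0 \<sigma>)"
    using runs_jump_less[OF C2(3) code(4,5) C2(2)] C2(4) r0 by auto
  show ?case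
  proof (cases "eval e \<sigma> < D")
    case True
    have m: "mem C3 (eval e \<sigma>) = inp \<sigma> (eval e \<sigma>)"
      using C3(5) D0 x True by (simp add: matches_def)
    have "inp \<sigma> (eval e \<sigma>) < B" using small_less Read.prems by auto
    then obtain C4 where C4: "runs P B C3 1 C4" "fits B C4"
      "matches (?l + 3 + 1) C4 (set_var x (inp \<sigma> (eval e \<sigma>)) (set_var x 0 \<sigma>))"
      using runs_set_var[OF _ C3(2) code(8,9), of "set_var x 0 \<sigma>" x "inp \<sigma> (eval e \<sigma>)"] C3 True x C2(4) m
      by auto
    then show ?thesis
      using runs_trans[OF runs_trans[OF runs_trans[OF C1(1) C2(1)] C3(1)] C4(1)]
      by (intro exI[of _ C4]) (simp add: Let_def add_sucs numeral_3_eq_3)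
  next
    case False
    then have "inp \<sigma> (eval e \<sigma>) = 0" using C1(3) D0 by (simp add: matches_def)
    moreover obtain C4 where C4: "runs P B C3 1 C4" "fits B C4"
      "matches (?l + 4) C4 (set_var x 0 \<sigma>)"
      using runs_jump[OF _ code(6,7) C3(2)] C3(5) False by auto
    ultimately show ?thesis
      using runs_trans[OF runs_trans[OF runs_trans[OF C1(1) C2(1)] C3(1)] C4(1)]
      by (intro exI[of _ C4]) (simp add: Let_def add_sucs numeral_3_eq_3)
  qed
next
  case (Print x)
  let ?C = "C\<lparr>pc := l + 1, buffer := buffer C @ [reg C x]\<rparr>"
  have pc: "pc C = l" using Print by (simp add: matches_def)
  have "runs P B C 1 ?C"
    using Print.prems pc by (intro runs_exec[of C l P "Out x"]) auto
  then show ?case using Print.prems by (intro exI[of _ ?C]) (auto simp: matches_def)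
next
  case (Seq c d)
  have pw: "D ^ csize c < B" "D ^ csize d < B"
    using Seq.prems(6) power_less[of "csize c + csize d" "csize c"]
      power_less[of "csize c + csize d" "csize d"] by simp_all
  obtain C1 where C1: "runs P B C (cost c \<sigma>) C1" "fits B C1"
    "matches (l + length (ccode c l)) C1 (sem c \<sigma>)"
    using Seq.IH(1)[of l C \<sigma>] Seq.prems pw by (auto simp: Let_def)
  have "small D (sem c \<sigma>)" using small_sem Seq.prems D by auto
  then obtain C2 where C2: "runs P B C1 (cost d (sem c \<sigma>)) C2" "fits B C2"
    "matches (l + length (ccode c l) + length (ccode d (l + length (ccode c l)))) C2 (sem d (sem c \<sigma>))"
    using Seq.IH(2)[OF _ C1(3,2)] Seq.prems pw by (auto simp: Let_def)
  then show ?case using runs_trans[OF C1(1) C2(1)]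
    by (intro exI[of _ C2]) (simp add: Let_def add.assoc)
next
  case (IfLess e f c d)
  let ?S = "esize e + esize f + csize c + csize d"
  have pw: "D ^ esize e < B" "D ^ esize f < B" "D ^ csize c < B" "D ^ csize d < B"
    using IfLess.prems(6) power_less[of ?S "esize e"] power_less[of ?S "esize f"]
      power_less[of ?S "csize c"] power_less[of ?S "csize d"] by simp_all
  define l0 where "l0 = l + ecost e + ecost f"
  define d' where "d' = ccode d (l0 + 1)"
  define l2 where "l2 = l0 + 1 + length d' + 1"
  define c' where "c' = ccode c l2"
  have cc: "ccode (IfLess e f c d) l = ecode e 32 @ ecode f 33 @ [JumpLess 32 33 l2] @ d' @
      [Jump (l2 + length c')] @ c'"
    by (simp add: Let_def d'_def l2_def c'_def l0_def)
  have code: "code_at P l (ecode e 32)" "code_at P (l + ecost e) (ecode f 33)"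
    "l0 < length P" "P ! l0 = JumpLess 32 33 l2" "code_at P (l0 + 1) d'"
    "l0 + 1 + length d' < length P" "P ! (l0 + 1 + length d') = Jump (l2 + length c')"
    "code_at P l2 c'"
    using IfLess.prems(1) unfolding cc by (simp_all add: l0_def l2_def add.assoc)
  obtain C1 where C1: "runs P B C (ecost e) C1" "fits B C1" "matches (l + ecost e) C1 \<sigma>"
    "reg C1 32 = eval e \<sigma>"
    using ecode_runs[OF code(1) IfLess.prems(2,3) _ IfLess.prems(4)] IfLess.prems pw by auto
  obtain C2 where C2: "runs P B C1 (ecost f) C2" "fits B C2" "matches l0 C2 \<sigma>"
    "reg C2 33 = eval f \<sigma>" "reg C2 32 = eval e \<sigma>"
    using ecode_runs[OF code(2) C1(3,2) _ IfLess.prems(4)] IfLess.prems pw C1(4) by (auto simp: l0_def)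
  obtain C3 where C3: "runs P B C2 1 C3" "fits B C3"
    "matches (if eval e \<sigma> < eval f \<sigma> then l2 else l0 + 1) C3 \<sigma>"
    using runs_jump_less[OF C2(3) code(3,4) C2(2)] C2(4,5) by auto
  note r = runs_trans[OF runs_trans[OF C1(1) C2(1)] C3(1)]
  have len: "l + length (ccode (IfLess e f c d) l) = l2 + length c'"
    unfolding cc by (simp add: l0_def l2_def)
  show ?case
  proof (cases "eval e \<sigma> < eval f \<sigma>")
    case True
    obtain C4 where C4: "runs P B C3 (cost c \<sigma>) C4" "fits B C4" "matches (l2 + length c') C4 (sem c \<sigma>)"
      using IfLess.IH(1)[of l2 C3 \<sigma>] code(8) C3 IfLess.prems pw True by (auto simp: c'_def)
    then show ?thesis using runs_trans[OF r C4(1)] True unfolding len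
      by (intro exI[of _ C4]) (simp add: add.assoc)
  next
    case False
    obtain C4 where C4: "runs P B C3 (cost d \<sigma>) C4" "fits B C4"
      "matches (l0 + 1 + length d') C4 (sem d \<sigma>)"
      using IfLess.IH(2)[of "l0 + 1" C3 \<sigma>] code(5) C3 IfLess.prems pw False by (auto simp: d'_def)
    obtain C5 where C5: "runs P B C4 1 C5" "fits B C5" "matches (l2 + length c') C5 (sem d \<sigma>)"
      using runs_jump[OF C4(3) code(6,7) C4(2)] by auto
    show ?thesis using runs_trans[OF runs_trans[OF r C4(1)] C5(1)] False C5 unfolding len
      by (intro exI[of _ C5]) (simp add: add.assoc)
  qed
next
  case (For x y c)
  define c' where "c' = ccode c (l + 3)"
  define e where "e = l + length c' + 6"
  define f where "f = (\<lambda>\<sigma>. bump x (sem c \<sigma>))"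
  have cc: "ccode (For x y c) l = [Const x 0, JumpLess x y (l + 3), Jump e] @ c' @
         [Const 32 1, Add x x 32, Jump (l + 1)]"
    by (simp add: Let_def c'_def e_def)
  have code: "l < length P" "P ! l = Const x 0" "l + 1 < length P" "P ! (l + 1) = JumpLess x y (l + 3)"
    "l + 2 < length P" "P ! (l + 2) = Jump e" "code_at P (l + 3) c'"
    "l + 3 + length c' < length P" "P ! (l + 3 + length c') = Const 32 1"
    "l + 4 + length c' < length P" "P ! (l + 4 + length c') = Add x x 32"
    "l + 5 + length c' < length P" "P ! (l + 5 + length c') = Jump (l + 1)"
    using For.prems(1) unfolding cc by (simp_all add: add_sucs)
  have wf: "0 < x" "x < 32" "y < 32" "x \<noteq> y" "x \<notin> mods c" "y \<notin> mods c" "wf_com b c"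
    using For.prems by auto
  have pw: "D ^ csize c < B"
    using For.prems(6) power_less[of "2 + csize c" "csize c"] by simp
  \<comment> \<open>The induction is over the number \<open>r\<close> of remaining rounds, with the
    machine at the test of the loop; the summand 2 is the failing test with the exit jump.\<close>
  have loop: "\<exists>C'. runs P B C (2 + (\<Sum>k<r. 4 + cost c ((f ^^ k) \<sigma>))) C' \<and> fits B C' \<and>
      matches e C' ((f ^^ r) \<sigma>)"
    if "matches (l + 1) C \<sigma>" "fits B C" "small D \<sigma>" "var \<sigma> x + r = var \<sigma> y" for r C \<sigma>
    using that
  proof (induction r arbitrary: C \<sigma>)
    case 0
    have "reg C x = reg C y" using 0 wf by (simp add: matches_def)
    then obtain C1 where C1: "runs P B C 1 C1" "fits B C1" "matches (l + 2) C1 \<sigma>"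
      using runs_jump_less[OF 0(1) code(3,4) 0(2)] by auto
    obtain C2 where C2: "runs P B C1 1 C2" "fits B C2" "matches e C2 \<sigma>"
      using runs_jump[OF C1(3) code(5,6) C1(2)] by auto
    then show ?case using runs_trans[OF C1(1) C2(1)] by (intro exI[of _ C2]) (simp add: numeral_2_eq_2)
  next
    case (Suc r)
    have "reg C x < reg C y" using Suc.prems wf by (simp add: matches_def)
    then obtain C1 where C1: "runs P B C 1 C1" "fits B C1" "matches (l + 3) C1 \<sigma>"
      using runs_jump_less[OF Suc.prems(1) code(3,4) Suc.prems(2)] by auto
    obtain C2 where C2: "runs P B C1 (cost c \<sigma>) C2" "fits B C2"
      "matches (l + 3 + length c') C2 (sem c \<sigma>)"
      using For.IH[of "l + 3" C1 \<sigma>] code(7) C1 Suc.prems wf pw by (auto simp: c'_def)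
    have vx: "var (sem c \<sigma>) x = var \<sigma> x" "var (sem c \<sigma>) y = var \<sigma> y" using wf by (auto simp: var_sem)
    have lt: "var \<sigma> x + 1 \<le> D" using Suc.prems(3,4) unfolding small_def
      by (metis Suc_eq_plus1 add_Suc_right le_add1 le_trans add_Suc)
    obtain C3 where C3: "runs P B C2 1 C3" "fits B C3" "matches (l + 3 + length c' + 1) C3 (sem c \<sigma>)"
      "reg C3 32 = 1" "reg C3 x = var \<sigma> x"
      using set_temp_runs[OF C2(3,2) code(8,9), of 32 1] B D wf C2(3) vx by (auto simp: matches_def)
    have "var \<sigma> x + 1 < B" using lt B by simp
    then obtain C4 where C4: "runs P B C3 1 C4" "fits B C4"
      "matches (l + 4 + length c' + 1) C4 (f \<sigma>)"
      using runs_set_var[OF _ C3(2) code(10,11), of "sem c \<sigma>" x "var \<sigma> x + 1"] C3 wf vx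
      by (auto simp: f_def bump_def add_sucs)
    obtain C5 where C5: "runs P B C4 1 C5" "fits B C5" "matches (l + 1) C5 (f \<sigma>)"
      using runs_jump[OF _ code(12,13) C4(2), of "f \<sigma>"] C4(3) by (auto simp: add_sucs)
    have "small D (sem c \<sigma>)" using small_sem Suc.prems wf D by auto
    then have sm: "small D (f \<sigma>)" using lt vx wf by (auto simp: f_def small_def)
    have "var (f \<sigma>) x + r = var (f \<sigma>) y" using Suc.prems vx wf by (simp add: f_def)
    then obtain C6 where C6: "runs P B C5 (2 + (\<Sum>k<r. 4 + cost c ((f ^^ k) (f \<sigma>)))) C6" "fits B C6"
      "matches e C6 ((f ^^ r) (f \<sigma>))"
      using Suc.IH[OF C5(3,2) sm] by auto
    have "1 + cost c \<sigma> + 1 + 1 + 1 + (2 + (\<Sum>k<r. 4 + cost c ((f ^^ k) (f \<sigma>)))) =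
       2 + (\<Sum>k<Suc r. 4 + cost c ((f ^^ k) \<sigma>))"
      by (simp only: sum.lessThan_Suc_shift funpow_Suc_right o_apply funpow_0 id_apply)
    then show ?case
      using runs_trans[OF runs_trans[OF runs_trans[OF runs_trans[OF runs_trans[OF C1(1) C2(1)] C3(1)] C4(1)] C5(1)] C6(1)] C6(2,3)
      by (intro exI[of _ C6]) (simp only: funpow_Suc_right o_apply)
  qed
  have pos: "0 < B" using B by simp
  obtain C1 where C1: "runs P B C 1 C1" "fits B C1" "matches (l + 1) C1 (set_var x 0 \<sigma>)"
    using runs_set_var[OF For.prems(2,3) code(1,2) _ _ pos wf(1,2)] by auto
  have "small D (set_var x 0 \<sigma>)" using For.prems wf by (auto simp: small_def)
  then obtain C2 where C2: "runs P B C1 (2 + (\<Sum>k<var \<sigma> y. 4 + cost c ((f ^^ k) (set_var x 0 \<sigma>)))) C2"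
    "fits B C2" "matches e C2 ((f ^^ var \<sigma> y) (set_var x 0 \<sigma>))"
    using loop[OF C1(3,2), of "var \<sigma> y"] wf by auto
  have "l + length (ccode (For x y c) l) = e" unfolding cc by (simp add: e_def)
  then show ?case
    using runs_trans[OF C1(1) C2(1)] C2(2,3) by (intro exI[of _ C2]) (simp add: f_def numeral_3_eq_3)
qed

end

text \<open>The input has 6 + 4 * m + |s| words for m transitions, so the number put into register 0
  exceeds all its addresses. For the value of \<open>b\<close> chosen in the end, it also bounds all
  its entries.\<close>

definition prologue :: "nat \<Rightarrow> program" where
  "prologue b = [Const 32 0, Load 33 32, Const 32 1, Load 34 32, Const 32 2, Load 35 32,
     Const 32 3, Load 36 32, Const 37 4, Mul 34 34 37, Const 37 (6 + b),
     Add 0 33 34, Add 0 0 35, Add 0 0 36, Add 0 0 37]"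

definition enumerator :: "nat \<Rightarrow> com \<Rightarrow> nat \<Rightarrow> com \<Rightarrow> com \<Rightarrow> program" where
  "enumerator b pre go prt nxt = (let c1 = ccode pre 15; l1 = 15 + length c1;
     c2 = ccode prt (l1 + 3); l2 = l1 + 3 + length c2; c3 = ccode nxt (l2 + 1) in
     prologue b @ c1 @ [Const 32 0, JumpLess 32 go (l1 + 3), Jump (l2 + length c3 + 2)] @ c2 @
     [Emit] @ c3 @ [Jump l1])"

definition start_state :: "nat \<Rightarrow> nat list \<Rightarrow> state" where
  "start_state D w = \<lparr>var = (\<lambda>_. 0)(0 := D), arr = (\<lambda>_ _ _. 0),
     inp = (\<lambda>a. if a < length w then w ! a else 0), outp = []\<rparr>"

definition emit_times :: "program \<Rightarrow> config \<Rightarrow> nat set" where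
  "emit_times P C = {t. \<not> halted P ((step P ^^ t) C) \<and> P ! pc ((step P ^^ t) C) = Emit}"

lemma emit_times_runs:
  assumes "runs P B C t C'"
  shows "emit_times P C = (\<lambda>s. s + t) ` emit_times P C'"
proof -
  have *: "(step P ^^ (s + t)) C = (step P ^^ s) C'" for s
    using assms by (simp add: runs_def funpow_add)
  have "s \<ge> t" if "s \<in> emit_times P C" for s
    using that assms by (fastforce simp: emit_times_def runs_def not_le[symmetric])
  then have "s - t + t = s" if "s \<in> emit_times P C" for s
    using that by simp
  then show ?thesis
    using * by (auto simp: emit_times_def image_iff) (metis (mono_tags, lifting))
qed

lemma fits_runs:
  assumes "runs P B C t C'" "\<forall>s. fits B ((step P ^^ s) C')"
  shows "\<forall>s. fits B ((step P ^^ s) C)"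
proof
  fix s
  show "fits B ((step P ^^ s) C)"
  proof (cases "s < t")
    case False
    then have "(step P ^^ s) C = (step P ^^ (s - t)) ((step P ^^ t) C)"
      by (metis add.commute comp_apply funpow_add le_add_diff_inverse linorder_not_less)
    then show ?thesis using assms by (simp add: runs_def)
  qed (use assms in \<open>simp add: runs_def\<close>)
qed

lemma halted_funpow: "halted P C \<Longrightarrow> (step P ^^ t) C = C"
  by (induction t) (auto simp: step_def)

lemma successively_map_add:
  "successively (\<lambda>t t'. t \<le> t' \<and> t' \<le> t + d) (map (\<lambda>s. s + k) ts) \<longleftrightarrow>
   successively (\<lambda>t t'. t \<le> t' \<and> t' \<le> t + d) (ts :: nat list)"
  unfolding successively_map by (rule successively_cong) auto

context machine
begin

text \<open>Between two completed answers lie \<open>Emit\<close>, the command \<open>nxt\<close>,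
  the jump back, two instructions of the test and the printing. Before halting, the printing is
  replaced by the exit jump, so 5 extra instructions suffice in both cases. The induction is over
  the number of answers to come.\<close>

lemma enumerator_loop:
  fixes pre go prt nxt
  defines "P' \<equiv> enumerator b pre go prt nxt"
  defines "l1 \<equiv> 15 + length (ccode pre 15)"
  defines "next \<equiv> \<lambda>\<sigma>. sem nxt ((sem prt \<sigma>)\<lparr>outp := []\<rparr>)"
  assumes P: "P = P'" and wf: "wf_com b prt" "wf_com b nxt" "silent nxt" "0 < go" "go < 32"
    and sz: "D ^ csize prt < B" "D ^ csize nxt < B"
    and "matches l1 C \<sigma>" "fits B C" "small D \<sigma>" "outp \<sigma> = []"
    and "\<forall>k<n. 0 < var ((next ^^ k) \<sigma>) go" "var ((next ^^ n) \<sigma>) go = 0"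
    and "\<forall>k<n. cost nxt ((sem prt ((next ^^ k) \<sigma>))\<lparr>outp := []\<rparr>) + 5 +
           (if k + 1 < n then cost prt ((next ^^ (k + 1)) \<sigma>) else 0) \<le> d"
  shows "\<exists>ts T. sorted_wrt (<) ts \<and> set ts = emit_times P C \<and>
    map (\<lambda>t. buffer ((step P ^^ t) C)) ts = map (\<lambda>k. outp (sem prt ((next ^^ k) \<sigma>))) [0..<n] \<and>
    halted P ((step P ^^ T) C) \<and> buffer ((step P ^^ T) C) = [] \<and>
    (\<forall>t. fits B ((step P ^^ t) C)) \<and>
    hd (ts @ [T]) \<le> 3 + (if 0 < n then cost prt \<sigma> else 0) \<and>
    successively (\<lambda>t t'. t \<le> t' \<and> t' \<le> t + d) (ts @ [T])"
  using assms(12-)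
proof (induction n arbitrary: C \<sigma>)
  define c2 where "c2 = ccode prt (l1 + 3)"
  define l2 where "l2 = l1 + 3 + length c2"
  define c3 where "c3 = ccode nxt (l2 + 1)"
  define e where "e = l2 + length c3 + 2"
  have Peq: "P = prologue b @ ccode pre 15 @ [Const 32 0, JumpLess 32 go (l1 + 3), Jump e] @ c2 @
     [Emit] @ c3 @ [Jump l1]"
    unfolding P P'_def by (simp add: enumerator_def Let_def l1_def c2_def l2_def c3_def e_def)
  have "code_at P 0 P" by (simp add: code_at_def)
  then have "code_at P 0 (prologue b @ ccode pre 15 @ [Const 32 0, JumpLess 32 go (l1 + 3), Jump e] @ c2 @
     [Emit] @ c3 @ [Jump l1])" using Peq by simp
  moreover have len: "length (prologue b) = 15" by (simp add: prologue_def)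
  ultimately have code: "l1 < length P" "P ! l1 = Const 32 0" "l1 + 1 < length P"
    "P ! (l1 + 1) = JumpLess 32 go (l1 + 3)" "l1 + 2 < length P" "P ! (l1 + 2) = Jump e"
    "code_at P (l1 + 3) c2" "l2 < length P" "P ! l2 = Emit" "code_at P (l2 + 1) c3"
    "l2 + 1 + length c3 < length P" "P ! (l2 + 1 + length c3) = Jump l1"
    by (simp_all add: l1_def l2_def add_sucs add_ac)
  have e: "e = length P" unfolding Peq by (simp add: len e_def l2_def l1_def)
  have test: "\<exists>C2. runs P B C 2 C2 \<and> fits B C2 \<and>
      matches (if 0 < var \<sigma> go then l1 + 3 else l1 + 2) C2 \<sigma>"
    if C: "matches l1 C \<sigma>" "fits B C" for C \<sigma>
  proof -
    obtain C1 where C1: "runs P B C 1 C1" "fits B C1" "matches (l1 + 1) C1 \<sigma>" "reg C1 32 = 0"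
      using set_temp_runs[OF C code(1,2), of 32 0] B by auto
    then have "reg C1 go = var \<sigma> go" using wf by (simp add: matches_def)
    then obtain C2 where C2: "runs P B C1 1 C2" "fits B C2"
      "matches (if 0 < var \<sigma> go then l1 + 3 else l1 + 1 + 1) C2 \<sigma>"
      using runs_jump_less[OF C1(3) code(3,4) C1(2)] C1(4) by auto
    then show ?thesis using runs_trans[OF C1(1) C2(1)] by (intro exI[of _ C2]) (auto simp: numeral_2_eq_2)
  qed
  {
    case 0
    obtain C2 where C2: "runs P B C 2 C2" "fits B C2" "matches (l1 + 2) C2 \<sigma>"
      using test[OF 0(1,2)] 0(6) by auto
    obtain C3 where C3: "runs P B C2 1 C3" "fits B C3" "matches e C3 \<sigma>"
      using runs_jump[OF C2(3) code(5,6) C2(2)] by auto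
    have r: "runs P B C 3 C3" using runs_trans[OF C2(1) C3(1)] by simp
    have h: "halted P C3" using C3(3) e by (simp add: halted_def matches_def)
    have "emit_times P C = {}"
      unfolding emit_times_runs[OF r] using h by (auto simp: emit_times_def halted_funpow)
    moreover have "\<forall>t. fits B ((step P ^^ t) C)"
      using fits_runs[OF r] h C3(2) by (simp add: halted_funpow)
    moreover have "(step P ^^ 3) C = C3" using r by (simp add: runs_def)
    ultimately show ?case using h C3(3) 0(4)
      by (intro exI[of _ "[]"] exI[of _ 3]) (simp add: matches_def)
  next
    case (Suc n)
    have "0 < var \<sigma> go" using Suc.prems(5)[rule_format, of 0] by simp
    then obtain C2 where C2: "runs P B C 2 C2" "fits B C2" "matches (l1 + 3) C2 \<sigma>"
      using test[OF Suc.prems(1,2)] by auto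
    obtain C3 where C3: "runs P B C2 (cost prt \<sigma>) C3" "fits B C3" "matches l2 C3 (sem prt \<sigma>)"
      using ccode_runs[of "l1 + 3" prt C2 \<sigma>] code(7) C2 wf sz Suc.prems by (auto simp: c2_def l2_def)
    define \<tau> where "\<tau> = (sem prt \<sigma>)\<lparr>outp := []\<rparr>"
    have sm: "small D (sem prt \<sigma>)" using small_sem Suc.prems wf D by auto
    then have sm\<tau>: "small D \<tau>" by (simp add: \<tau>_def small_def)
    then have smn: "small D (next \<sigma>)" using small_sem wf D by (auto simp: next_def \<tau>_def)
    define C4 where "C4 = exec Emit C3"
    have pc3: "pc C3 = l2" using C3(3) by (simp add: matches_def)
    then have C4: "fits B C4" "matches (l2 + 1) C4 \<tau>" "step P C3 = C4"
      using C3(2,3) code(8,9) by (auto simp: C4_def matches_def \<tau>_def step_def halted_def)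
    obtain C5 where C5: "runs P B C4 (cost nxt \<tau>) C5" "fits B C5" "matches (l2 + 1 + length c3) C5 (next \<sigma>)"
      using ccode_runs[of "l2 + 1" nxt C4 \<tau>] code(10) C4 wf sz sm\<tau> by (auto simp: c3_def next_def \<tau>_def)
    obtain C6 where C6: "runs P B C5 1 C6" "fits B C6" "matches l1 C6 (next \<sigma>)"
      using runs_jump[OF C5(3) code(11,12) C5(2)] by auto
    have on: "outp (next \<sigma>) = []" using wf(3) by (simp add: next_def outp_sem)
    have shift: "(next ^^ Suc k) \<sigma> = (next ^^ k) (next \<sigma>)" for k
      by (simp add: funpow_swap1)
    obtain ts T where IH: "sorted_wrt (<) ts" "set ts = emit_times P C6"
      "map (\<lambda>t. buffer ((step P ^^ t) C6)) ts = map (\<lambda>k. outp (sem prt ((next ^^ k) (next \<sigma>)))) [0..<n]"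
      "halted P ((step P ^^ T) C6)" "buffer ((step P ^^ T) C6) = []"
      "\<forall>t. fits B ((step P ^^ t) C6)"
      "hd (ts @ [T]) \<le> 3 + (if 0 < n then cost prt (next \<sigma>) else 0)"
      "successively (\<lambda>t t'. t \<le> t' \<and> t' \<le> t + d) (ts @ [T])"
    proof -
      have "\<forall>k<n. 0 < var ((next ^^ k) (next \<sigma>)) go"
        using Suc.prems(5) by (auto simp: shift[symmetric] simp del: funpow.simps)
      moreover have "var ((next ^^ n) (next \<sigma>)) go = 0"
        using Suc.prems(6) by (simp only: shift)
      moreover have "\<forall>k<n. cost nxt ((sem prt ((next ^^ k) (next \<sigma>)))\<lparr>outp := []\<rparr>) + 5 +
           (if k + 1 < n then cost prt ((next ^^ (k + 1)) (next \<sigma>)) else 0) \<le> d"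
      proof (intro allI impI)
        fix k assume "k < n"
        then show "cost nxt ((sem prt ((next ^^ k) (next \<sigma>)))\<lparr>outp := []\<rparr>) + 5 +
           (if k + 1 < n then cost prt ((next ^^ (k + 1)) (next \<sigma>)) else 0) \<le> d"
          using Suc.prems(7)[rule_format, of "Suc k"] by (cases "Suc k < n") (simp_all add: shift[symmetric] del: funpow.simps)
      qed
      ultimately show thesis using Suc.IH[OF C6(3,2) smn on] that by blast
    qed
    define t0 where "t0 = 2 + cost prt \<sigma>"
    define t1 where "t1 = cost nxt \<tau> + 1"
    have r0: "runs P B C t0 C3" using runs_trans[OF C2(1) C3(1)] by (simp add: t0_def)
    have r1: "runs P B C4 t1 C6" using runs_trans[OF C5(1) C6(1)] by (simp add: t1_def)
    have to3: "(step P ^^ (s + t0)) C = (step P ^^ s) C3" for s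
      using r0 by (simp add: runs_def funpow_add)
    have to6: "(step P ^^ (s + t1)) C4 = (step P ^^ s) C6" for s
      using r1 by (simp add: runs_def funpow_add)
    have to: "(step P ^^ (s + (t0 + 1 + t1))) C = (step P ^^ s) C6" for s
    proof -
      have "(step P ^^ (s + (t0 + 1 + t1))) C = (step P ^^ (Suc (s + t1) + t0)) C" by (simp add: add_ac)
      also have "\<dots> = (step P ^^ Suc (s + t1)) C3" by (rule to3)
      also have "\<dots> = (step P ^^ (s + t1)) C4" using C4(3) by (simp only: funpow_Suc_right o_apply)
      finally show ?thesis using to6 by simp
    qed
    \<comment> \<open>Time 0 is the instruction \<open>Emit\<close> itself, the only step of this
      round that belongs to no fragment in the sense of \<open>runs\<close>.\<close>
    have em3: "emit_times P C3 = insert 0 (Suc ` emit_times P C4)"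
    proof -
      have *: "(step P ^^ Suc s) C3 = (step P ^^ s) C4" for s
        using C4(3) by (simp only: funpow_Suc_right o_apply)
      have "t \<in> emit_times P C3 \<longleftrightarrow> t \<in> insert 0 (Suc ` emit_times P C4)" for t
      proof (cases t)
        case 0
        then show ?thesis using pc3 code(8,9) by (simp add: emit_times_def halted_def)
      next
        case (Suc s)
        then show ?thesis using * by (auto simp: emit_times_def simp del: funpow.simps)
      qed
      then show ?thesis by blast
    qed
    have em: "emit_times P C = insert t0 ((\<lambda>s. s + (t0 + 1 + t1)) ` emit_times P C6)"
      unfolding emit_times_runs[OF r0] em3 emit_times_runs[OF r1]
      by (auto simp: image_image add_ac)
    have fit: "\<forall>t. fits B ((step P ^^ t) C)"
    proof (rule fits_runs[OF r0], rule allI)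
      fix s show "fits B ((step P ^^ s) C3)"
      proof (cases s)
        case (Suc s')
        then have "(step P ^^ s) C3 = (step P ^^ s') C4"
          using C4(3) by (simp only: funpow_Suc_right o_apply)
        then show ?thesis using fits_runs[OF r1 IH(6)] by simp
      qed (use C3(2) in simp)
    qed
    let ?ts = "t0 # map (\<lambda>s. s + (t0 + 1 + t1)) ts" and ?T = "T + (t0 + 1 + t1)"
    have d: "hd (ts @ [T]) + (1 + t1) \<le> d"
      using IH(7) Suc.prems(7)[rule_format, of 0] by (simp add: \<tau>_def t1_def split: if_splits)
    have eqm: "map (\<lambda>s. s + (t0 + 1 + t1)) ts @ [?T] = map (\<lambda>s. s + (t0 + 1 + t1)) (ts @ [T])" by simp
    have succ: "successively (\<lambda>t t'. t \<le> t' \<and> t' \<le> t + d) (?ts @ [?T])"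
    proof -
      have "successively (\<lambda>t t'. t \<le> t' \<and> t' \<le> t + d) (map (\<lambda>s. s + (t0 + 1 + t1)) (ts @ [T]))"
        using IH(8) by (simp only: successively_map_add)
      moreover have "hd (map (\<lambda>s. s + (t0 + 1 + t1)) (ts @ [T])) = hd (ts @ [T]) + (t0 + 1 + t1)"
        by (rule hd_map) simp
      ultimately show ?thesis
        unfolding append_Cons eqm using d
        by (auto simp: successively_Cons simp del: map_append)
    qed
    have buf0: "(step P ^^ t0) C = C3" using to3[of 0] by simp
    show ?case
    proof (intro exI[of _ ?ts] exI[of _ ?T] conjI)
      show "sorted_wrt (<) ?ts" using IH(1) by (auto simp: sorted_wrt_map)
      show "set ?ts = emit_times P C" using IH(2) em by auto
      show "map (\<lambda>t. buffer ((step P ^^ t) C)) ?ts = map (\<lambda>k. outp (sem prt ((next ^^ k) \<sigma>))) [0..<Suc n]"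
      proof -
        have "map (\<lambda>t. buffer ((step P ^^ t) C)) (map (\<lambda>s. s + (t0 + 1 + t1)) ts) =
           map (\<lambda>t. buffer ((step P ^^ t) C6)) ts" by (simp only: map_map o_def to)
        also have "\<dots> = map (\<lambda>k. outp (sem prt ((next ^^ Suc k) \<sigma>))) [0..<n]"
          by (simp only: IH(3) shift)
        finally have "map (\<lambda>t. buffer ((step P ^^ t) C)) ?ts =
          outp (sem prt \<sigma>) # map (\<lambda>k. outp (sem prt ((next ^^ Suc k) \<sigma>))) [0..<n]"
          using buf0 C3(3) by (simp add: matches_def del: funpow.simps)
        also have "\<dots> = map (\<lambda>k. outp (sem prt ((next ^^ k) \<sigma>))) [0..<Suc n]"
          by (simp only: upt_conv_Cons[OF zero_less_Suc] map_Suc_upt[symmetric] list.map funpow_0 map_map o_def)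
        finally show ?thesis .
      qed
      show "halted P ((step P ^^ ?T) C)" "buffer ((step P ^^ ?T) C) = []" using IH(4,5) to by auto
      show "hd (?ts @ [?T]) \<le> 3 + (if 0 < Suc n then cost prt \<sigma> else 0)" by (simp add: t0_def)
    qed (use fit succ in auto)
  }
qed

end

theorem enumerator_correct:
  fixes pre go prt nxt b and w :: "nat list"
  defines "next \<equiv> \<lambda>\<sigma>. sem nxt ((sem prt \<sigma>)\<lparr>outp := []\<rparr>)"
  defines "P \<equiv> enumerator b pre go prt nxt"
  defines "D \<equiv> w ! 0 + 4 * w ! 1 + w ! 2 + w ! 3 + (6 + b)"
  defines "\<sigma> \<equiv> sem pre (start_state D w)"
  assumes b: "10 \<le> b" and w: "4 \<le> length w" "length w \<le> D" "\<forall>v\<in>set w. v \<le> D"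
    and wf: "wf_com b pre" "wf_com b prt" "wf_com b nxt" "silent pre" "silent nxt" "0 < go" "go < 32"
    and go: "\<forall>k<n. 0 < var ((next ^^ k) \<sigma>) go" "var ((next ^^ n) \<sigma>) go = 0"
    and outs: "map (\<lambda>k. outp (sem prt ((next ^^ k) \<sigma>))) [0..<n] = map enc xs" "distinct xs" "set xs = X"
    and p: "18 + cost pre (start_state D w) + (if 0 < n then cost prt \<sigma> else 0) \<le> p"
    and d: "\<forall>k<n. cost nxt ((sem prt ((next ^^ k) \<sigma>))\<lparr>outp := []\<rparr>) + 5 +
           (if k + 1 < n then cost prt ((next ^^ (k + 1)) \<sigma>) else 0) \<le> d"
  shows "enumerates P w enc X p d"
    and "word_bounded P w (D ^ (csize pre + csize prt + csize nxt + 1) * D)"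
proof -
  define B where "B = D ^ (csize pre + csize prt + csize nxt + 1) * D"
  have D16: "16 \<le> D" using b by (simp add: D_def)
  have le: "D ^ k < B" if "k \<le> csize pre + csize prt + csize nxt" for k
  proof -
    have "D ^ k \<le> D ^ (csize pre + csize prt + csize nxt)" using that D16 by (intro power_increasing) auto
    also have "\<dots> < D ^ (csize pre + csize prt + csize nxt + 1 + 1)"
      using D16 by (intro power_strict_increasing) auto
    finally show ?thesis by (simp add: B_def mult_ac)
  qed
  have "D ^ 1 < D ^ (csize pre + csize prt + csize nxt + 1 + 1)"
    using D16 by (intro power_strict_increasing) auto
  then have DB: "D < B" by (simp add: B_def mult_ac)
  interpret machine P B D b
    using D16 DB by unfold_locales (auto simp: D_def)
  define l1 where "l1 = 15 + length (ccode pre 15)"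
  have len: "length (prologue b) = 15" by (simp add: prologue_def)
  have "code_at P 0 P" by (simp add: code_at_def)
  then have code: "code_at P 0 (prologue b)" "code_at P 15 (ccode pre 15)"
    unfolding P_def by (subst (asm) (2) enumerator_def, simp add: Let_def len)+
  have in_le: "w ! i \<le> D" if "i < length w" for i using w that by simp
  have memw: "mem (start w) a \<le> D" for a using in_le by (simp add: start_def)
  define C1 where "C1 = fold exec (prologue b) (start w)"
  have m: "mem (start w) 0 = w ! 0" "mem (start w) (Suc 0) = w ! 1" "mem (start w) 2 = w ! 2" "mem (start w) 3 = w ! 3"
    using w by (auto simp: start_def)
  have r: "reg (start w) = (\<lambda>_. 0)" "pc (start w) = 0" "buffer (start w) = []"
    by (auto simp: start_def)
  have fa: "fits_along B (prologue b) (start w)"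
  proof -
    have f: "fits B (start w)" using le_less_trans[OF memw DB] DB by (simp add: fits_def start_def)
    have "w ! 0 + 4 * w ! 1 + w ! 2 + w ! 3 + (6 + b) < B" using DB by (simp add: D_def)
    then show ?thesis using f r by (simp add: prologue_def m fits_def)
  qed
  have "list_all straight (prologue b)" by (simp add: prologue_def)
  moreover have "pc (start w) = 0" by (simp add: start_def)
  ultimately have r1: "runs P B (start w) 15 C1" "fits B C1" "pc C1 = 15"
    using runs_straight[OF _ _ fa, of P] code(1) len by (auto simp: C1_def)
  have "reg C1 0 = D" "\<forall>x<32. 0 < x \<longrightarrow> reg C1 x = 0" "mem C1 = mem (start w)" "buffer C1 = []"
    unfolding C1_def by (simp_all add: prologue_def m r D_def)
  \<comment> \<open>Array addresses are at least \<open>D\<close>, hence beyond the input, where the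
    memory is initially 0.\<close>
  then have m1: "matches 15 C1 (start_state D w)"
    using r1(3) w by (auto simp: matches_def start_state_def start_def address_def)
  have sm0: "small D (start_state D w)" using in_le by (auto simp: small_def start_state_def)
  have bD: "b \<le> D" by (simp add: D_def)
  obtain C2 where C2: "runs P B C1 (cost pre (start_state D w)) C2" "fits B C2" "matches l1 C2 \<sigma>"
    using ccode_runs[OF code(2) m1 r1(2) sm0 wf(1)] le[of "csize pre"] by (auto simp: l1_def \<sigma>_def)
  have sm: "small D \<sigma>" unfolding \<sigma>_def using small_sem[OF sm0 wf(1) bD] .
  have o: "outp \<sigma> = []" using wf(4) by (simp add: \<sigma>_def outp_sem start_state_def)
  define t0 where "t0 = 15 + cost pre (start_state D w)"
  have r0: "runs P B (start w) t0 C2" using runs_trans[OF r1(1) C2(1)] by (simp add: t0_def)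
  obtain ts T where L: "sorted_wrt (<) ts" "set ts = emit_times P C2"
    "map (\<lambda>t. buffer ((step P ^^ t) C2)) ts = map (\<lambda>k. outp (sem prt ((next ^^ k) \<sigma>))) [0..<n]"
    "halted P ((step P ^^ T) C2)" "buffer ((step P ^^ T) C2) = []"
    "\<forall>t. fits B ((step P ^^ t) C2)"
    "hd (ts @ [T]) \<le> 3 + (if 0 < n then cost prt \<sigma> else 0)"
    "successively (\<lambda>t t'. t \<le> t' \<and> t' \<le> t + d) (ts @ [T])"
    using enumerator_loop[of pre go prt nxt C2 \<sigma> n d, folded next_def l1_def, OF meta_eq_to_obj_eq[OF P_def] wf(2,3,5,6,7) _ _ C2(3,2) sm o go d]
      le[of "csize prt"] le[of "csize nxt"] by auto
  have to: "(step P ^^ (s + t0)) (start w) = (step P ^^ s) C2" for s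
    using r0 by (simp add: runs_def funpow_add)
  have fit: "\<forall>t. fits B ((step P ^^ t) (start w))" by (rule fits_runs[OF r0 L(6)])
  then show "word_bounded P w (D ^ (csize pre + csize prt + csize nxt + 1) * D)"
    by (simp add: word_bounded_def config_at_def fits_def B_def)
  \<comment> \<open>The preprocessing is taken to end when the first answer is completed, or at the
    halting time if there is none. The constant 18 consists of the 15 instructions of the prologue
    and at most 3 for the first test.\<close>
  let ?ts = "map (\<lambda>s. s + t0) ts" and ?p = "hd (ts @ [T]) + t0"
  have eq: "?ts @ [T + t0] = map (\<lambda>s. s + t0) (ts @ [T])" by simp
  have "successively (\<lambda>t t'. t \<le> t' \<and> t' \<le> t + d) (?ts @ [T + t0])"
    unfolding eq using L(8) by (simp only: successively_map_add)
  moreover have "hd (?ts @ [T + t0]) = ?p" unfolding eq by (rule hd_map) simp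
  ultimately have s: "successively (\<lambda>t t'. t \<le> t' \<and> t' \<le> t + d) (?p # ?ts @ [T + t0])"
    by (cases ts) auto
  have "map (\<lambda>t. buffer (config_at P w t)) ?ts = map (\<lambda>t. buffer ((step P ^^ t) C2)) ts"
    by (simp add: config_at_def to)
  then have bufs: "map (\<lambda>t. buffer (config_at P w t)) ?ts = map enc xs" using L(3) outs by simp
  have em: "set ?ts = {t. emits_at P w t}"
    using L(2) emit_times_runs[OF r0] by (auto simp: emit_times_def emits_at_def config_at_def)
  show "enumerates P w enc X p d"
    unfolding enumerates_def
  proof (intro exI conjI)
    show "sorted_wrt (<) ?ts" using L(1) by (simp add: sorted_wrt_map)
    show "?p \<le> p" using L(7) p by (simp add: t0_def split: if_splits)
    show "halted P (config_at P w (T + t0))" "buffer (config_at P w (T + t0)) = []"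
      using L(4,5) to by (auto simp: config_at_def)
  qed (use em bufs outs s in auto)
qed

section \<open>The enumeration algorithm\<close>

text \<open>The frame is built into the rule: whatever the body does not modify keeps its value from
  before the loop, so an invariant speaks only of what changes.\<close>

lemma for_frame_rule:
  assumes "x \<notin> mods c" "y \<notin> mods c" "x \<noteq> y"
    and I0: "I 0 (set_var x 0 \<sigma>)"
    and IS: "\<And>k \<tau>. I k \<tau> \<Longrightarrow> k < var \<sigma> y \<Longrightarrow> var \<tau> x = k \<Longrightarrow>
               (\<And>z. z \<notin> insert x (mods c) \<Longrightarrow> var \<tau> z = var \<sigma> z) \<Longrightarrow>
               (\<And>j. j \<notin> amods c \<Longrightarrow> arr \<tau> j = arr \<sigma> j) \<Longrightarrow> inp \<tau> = inp \<sigma> \<Longrightarrow>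
               I (Suc k) (bump x (sem c \<tau>))"
  shows "I (var \<sigma> y) (sem (For x y c) \<sigma>)"
proof -
  let ?F = "\<lambda>\<tau>. (\<forall>z. z \<notin> insert x (mods c) \<longrightarrow> var \<tau> z = var \<sigma> z) \<and>
    (\<forall>j. j \<notin> amods c \<longrightarrow> arr \<tau> j = arr \<sigma> j) \<and> inp \<tau> = inp \<sigma>"
  have "I (var \<sigma> y) (sem (For x y c) \<sigma>) \<and> ?F (sem (For x y c) \<sigma>)"
  proof (rule for_rule[where I = "\<lambda>k \<tau>. I k \<tau> \<and> ?F \<tau>"])
    fix k \<tau>
    assume "I k \<tau> \<and> ?F \<tau>" "k < var \<sigma> y" "var \<tau> x = k"
    then show "I (Suc k) (bump x (sem c \<tau>)) \<and> ?F (bump x (sem c \<tau>))"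
      using IS[of k \<tau>] by (auto simp: var_sem arr_sem)
  qed (use assms in auto)
  then show ?thesis ..
qed

text \<open>
  The variable \<open>xPb\<close> bounds the length of a worklist, \<open>xGo\<close> says whether there is an answer to
  be printed, and \<open>xI\<close> is the current level of the search. The arrays are:
  \<^item> \<open>aVF\<close>, \<open>aVB\<close>: the adjacency matrix of the transitions that read no symbol, and its transpose
  \<^item> \<open>aAL\<close>, \<open>aKN\<close>, \<open>aVR\<close>: the adjacency matrix of all transitions, and the kind and the
    argument of the label of one transition for each entry
  \<^item> \<open>aMV\<close> at \<open>(p, q * S + a)\<close>: the transitions from \<open>p\<close> to \<open>q\<close> that read symbol \<open>a < S\<close>
  \<^item> \<open>aMK\<close>, \<open>aQU\<close>, \<open>aPA\<close>: the marks, the worklist and the search tree of a graph search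
  \<^item> \<open>aCF\<close> at \<open>(q, y)\<close>: variable \<open>y\<close> is unopened (0), open (1) or closed (2) in state \<open>q\<close>
  \<^item> \<open>aBB\<close> at \<open>(t, q)\<close>: the rest of the string can be accepted from \<open>q\<close> by a run that reads
    symbol number \<open>t\<close> first
  \<^item> \<open>aRS\<close> at \<open>(j, q)\<close>: state \<open>q\<close> is still to be explored at level \<open>j\<close>
  \<^item> \<open>aRP\<close> at \<open>(j, 0)\<close>: a representative of the configuration chosen at level \<open>j\<close>
\<close>

abbreviation (input) "xN \<equiv> 1::nat"
abbreviation (input) "xM \<equiv> 2::nat"
abbreviation (input) "xV \<equiv> 3::nat"
abbreviation (input) "xL \<equiv> 4::nat"
abbreviation (input) "xIni \<equiv> 5::nat"
abbreviation (input) "xFin \<equiv> 6::nat"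
abbreviation (input) "xPb \<equiv> 7::nat"
abbreviation (input) "xGo \<equiv> 8::nat"
abbreviation (input) "xI \<equiv> 9::nat"
abbreviation (input) "xCnt \<equiv> 10::nat"
abbreviation (input) "xH \<equiv> 11::nat"
abbreviation (input) "xP \<equiv> 12::nat"
abbreviation (input) "xQ \<equiv> 13::nat"
abbreviation (input) "xT \<equiv> 14::nat"
abbreviation (input) "xK \<equiv> 15::nat"
abbreviation (input) "xE \<equiv> 16::nat"
abbreviation (input) "xF \<equiv> 17::nat"
abbreviation (input) "xA \<equiv> 18::nat"
abbreviation (input) "xB \<equiv> 19::nat"
abbreviation (input) "xR \<equiv> 20::nat"
abbreviation (input) "xY \<equiv> 21::nat"

abbreviation (input) "aVF \<equiv> 0::nat"
abbreviation (input) "aVB \<equiv> 1::nat"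
abbreviation (input) "aAL \<equiv> 2::nat"
abbreviation (input) "aKN \<equiv> 3::nat"
abbreviation (input) "aVR \<equiv> 4::nat"
abbreviation (input) "aMK \<equiv> 5::nat"
abbreviation (input) "aQU \<equiv> 6::nat"
abbreviation (input) "aPA \<equiv> 7::nat"
abbreviation (input) "aCF \<equiv> 8::nat"
abbreviation (input) "aBB \<equiv> 9::nat"
abbreviation (input) "aRS \<equiv> 10::nat"
abbreviation (input) "aRP \<equiv> 11::nat"
abbreviation (input) "aMV \<equiv> 12::nat"

section \<open>Graph search with a worklist\<close>

definition push :: "nat \<Rightarrow> com" where
  "push x = Write aMK (N 0) (V x) (N 1) ;; Write aQU (N 0) (V xCnt) (V x) ;; Inc xCnt"

definition clear :: com where
  "clear = For xQ xN (Write aMK (N 0) (V xQ) (N 0)) ;; Assign xCnt (N 0)"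

definition visit :: "nat \<Rightarrow> com" where
  "visit j = IfLess (N 0) (Arr j (V xP) (V xQ))
     (IfLess (Arr aMK (N 0) (V xQ)) (N 1) (Write aPA (N 0) (V xQ) (V xP) ;; push xQ) Skip) Skip"

text \<open>Since all loops are bounded, the worklist is traversed by a counter up to
  \<open>xPb\<close>, and rounds beyond its current end are idle. Entries pushed meanwhile are
  reached by the same loop.\<close>

definition closure :: "nat \<Rightarrow> com" where
  "closure j = For xH xPb (IfLess (V xH) (V xCnt)
     (Assign xP (Arr aQU (N 0) (V xH)) ;; For xQ xN (visit j)) Skip)"

lemma mods_push [simp]: "mods (push x) = {xCnt}" "amods (push x) = {aMK, aQU}" "silent (push x)"
  by (auto simp: push_def)

lemma mods_clear [simp]: "mods clear = {xQ, xCnt}" "amods clear = {aMK}" "silent clear"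
  by (auto simp: clear_def)

lemma mods_visit [simp]: "mods (visit j) = {xCnt}" "amods (visit j) = {aMK, aQU, aPA}" "silent (visit j)"
  by (auto simp: visit_def)

lemma mods_closure [simp]: "mods (closure j) = {xCnt, xH, xP, xQ}" "amods (closure j) = {aMK, aQU, aPA}"
  "silent (closure j)"
  by (auto simp: closure_def)

definition queue :: "state \<Rightarrow> nat list" where
  "queue \<sigma> = map (arr \<sigma> aQU 0) [0..<var \<sigma> xCnt]"

definition marked :: "nat \<Rightarrow> state \<Rightarrow> nat set" where
  "marked n \<sigma> = {q. q < n \<and> 0 < arr \<sigma> aMK 0 q}"

definition queue_ok :: "nat \<Rightarrow> state \<Rightarrow> bool" where
  "queue_ok n \<sigma> \<longleftrightarrow> distinct (queue \<sigma>) \<and> set (queue \<sigma>) = marked n \<sigma>"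

lemma queue_bump [simp]: "x \<noteq> xCnt \<Longrightarrow> queue (bump x \<sigma>) = queue \<sigma>"
  "marked n (bump x \<sigma>) = marked n \<sigma>"
  by (simp_all add: queue_def marked_def)

lemma clear_correct:
  assumes "var \<sigma> xN = n"
  shows "marked n (sem clear \<sigma>) = {}" "queue (sem clear \<sigma>) = []"
proof -
  have "\<forall>q<var \<sigma> xN. arr (sem (For xQ xN (Write aMK (N 0) (V xQ) (N 0))) \<sigma>) aMK 0 q = 0"
    by (rule for_frame_rule[where I = "\<lambda>k \<tau>. \<forall>q<k. arr \<tau> aMK 0 q = 0"]) (auto simp: less_Suc_eq)
  then show "marked n (sem clear \<sigma>) = {}" "queue (sem clear \<sigma>) = []"
    using assms by (auto simp: clear_def queue_def marked_def simp del: sem.simps(9))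
qed

lemma push_correct:
  assumes "var \<sigma> xCnt < var \<sigma> 0" "x \<noteq> xCnt" "var \<sigma> x < n"
  shows "queue (sem (push x) \<sigma>) = queue \<sigma> @ [var \<sigma> x]"
    "marked n (sem (push x) \<sigma>) = insert (var \<sigma> x) (marked n \<sigma>)"
  using assms by (auto simp: push_def queue_def marked_def)

lemma push_queue_ok:
  assumes "queue_ok n \<sigma>" "var \<sigma> xCnt < var \<sigma> 0" "x \<noteq> xCnt" "var \<sigma> x < n" "arr \<sigma> aMK 0 (var \<sigma> x) = 0"
  shows "queue_ok n (sem (push x) \<sigma>)"
  using assms push_correct[of \<sigma> x n] by (auto simp: queue_ok_def) (auto simp: marked_def)

lemma length_queue [simp]: "length (queue \<sigma>) = var \<sigma> xCnt"
  by (simp add: queue_def)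

lemma count_less:
  assumes "queue_ok n \<sigma>" "marked n \<sigma> \<subseteq> X" "finite X" "x \<in> X" "x \<notin> marked n \<sigma>"
  shows "var \<sigma> xCnt < card X"
proof -
  have "var \<sigma> xCnt = card (marked n \<sigma>)"
    using assms(1) by (metis distinct_card length_queue queue_ok_def)
  then show ?thesis using assms by (metis psubsetI psubset_card_mono)
qed

lemma count_le:
  assumes "queue_ok n \<sigma>" "marked n \<sigma> \<subseteq> X" "finite X"
  shows "var \<sigma> xCnt \<le> card X"
  using assms by (metis card_mono distinct_card length_queue queue_ok_def)

text \<open>Each entry after the initial ones has its parent at an earlier position, so that values
  can later be propagated along the search tree in the order of the list.\<close>

definition search_inv :: "nat \<Rightarrow> (nat \<Rightarrow> nat \<Rightarrow> bool) \<Rightarrow> nat list \<Rightarrow> state \<Rightarrow> bool" where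
  "search_inv n R q0 \<tau> \<longleftrightarrow> queue_ok n \<tau> \<and> (\<exists>zs. queue \<tau> = q0 @ zs) \<and>
     (\<forall>q\<in>set (queue \<tau>). \<exists>p\<in>set q0. R\<^sup>*\<^sup>* p q) \<and>
     (\<forall>h. length q0 \<le> h \<longrightarrow> h < length (queue \<tau>) \<longrightarrow>
        (\<exists>h'<h. arr \<tau> aPA 0 (queue \<tau> ! h) = queue \<tau> ! h' \<and> R (queue \<tau> ! h') (queue \<tau> ! h)))"

lemma search_inv_cong:
  "var \<sigma> xCnt = var \<tau> xCnt \<Longrightarrow> arr \<sigma> aQU = arr \<tau> aQU \<Longrightarrow> arr \<sigma> aMK = arr \<tau> aMK \<Longrightarrow>
   arr \<sigma> aPA = arr \<tau> aPA \<Longrightarrow> search_inv n R q0 \<sigma> = search_inv n R q0 \<tau>"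
  by (simp add: search_inv_def queue_ok_def queue_def marked_def)

lemma visit_correct:
  assumes inv: "search_inv n R q0 \<tau>" and j: "j \<notin> {aMK, aQU, aPA}"
    and R: "R (var \<tau> xP) (var \<tau> xQ) \<longleftrightarrow> 0 < arr \<tau> j (var \<tau> xP) (var \<tau> xQ)"
    and p: "h < var \<tau> xCnt" "queue \<tau> ! h = var \<tau> xP" and q: "var \<tau> xQ < n"
    and X: "finite X" "card X \<le> var \<tau> 0" "set q0 \<subseteq> X" "\<forall>p q. R p q \<longrightarrow> q \<in> X"
  shows "search_inv n R q0 (sem (visit j) \<tau>)"
    and "\<exists>zs. queue (sem (visit j) \<tau>) = queue \<tau> @ zs"
    and "R (var \<tau> xP) (var \<tau> xQ) \<Longrightarrow> var \<tau> xQ \<in> set (queue (sem (visit j) \<tau>))"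
proof -
  define \<rho> where "\<rho> = sem (visit j) \<tau>"
  have ok: "queue_ok n \<tau>" using inv by (simp add: search_inv_def)
  have "search_inv n R q0 \<rho> \<and> (\<exists>zs. queue \<rho> = queue \<tau> @ zs) \<and>
     (R (var \<tau> xP) (var \<tau> xQ) \<longrightarrow> var \<tau> xQ \<in> set (queue \<rho>))"
  proof (cases "R (var \<tau> xP) (var \<tau> xQ) \<and> arr \<tau> aMK 0 (var \<tau> xQ) = 0")
    case False
    then have "\<rho> = \<tau>" using R by (auto simp: \<rho>_def visit_def)
    then show ?thesis using False inv ok q by (auto simp: queue_ok_def marked_def)
  next
    case True
    define \<tau>' where "\<tau>' = sem (Write aPA (N 0) (V xQ) (V xP)) \<tau>"
    have \<rho>: "\<rho> = sem (push xQ) \<tau>'" using True R by (simp add: \<rho>_def visit_def \<tau>'_def)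
    have eq: "queue \<tau>' = queue \<tau>" "marked n \<tau>' = marked n \<tau>" "arr \<tau>' aMK = arr \<tau> aMK" "var \<tau>' = var \<tau>"
      by (simp_all add: \<tau>'_def queue_def marked_def)
    have nm: "var \<tau> xQ \<notin> marked n \<tau>" using True by (simp add: marked_def)
    \<comment> \<open>All marked states lie in \<open>X\<close>, so the worklist is shorter than
      \<open>card X\<close> before a new state is added, and \<open>Inc\<close> does not
      saturate.\<close>
    have "marked n \<tau> \<subseteq> X"
    proof
      fix z assume "z \<in> marked n \<tau>"
      then obtain p where "p \<in> set q0" "R\<^sup>*\<^sup>* p z"
        using inv ok unfolding search_inv_def queue_ok_def by blast
      then show "z \<in> X" using X by (metis rtranclp.cases subsetD)
    qed
    then have lt: "var \<tau> xCnt < var \<tau> 0" using count_less[OF ok _ X(1) _ nm] True X(2,4) by fastforce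
    have q\<rho>: "queue \<rho> = queue \<tau> @ [var \<tau> xQ]"
      using push_correct[of \<tau>' xQ n] lt q eq by (simp add: \<rho>)
    have ok\<rho>: "queue_ok n \<rho>"
      unfolding \<rho> using ok lt q eq True by (intro push_queue_ok) (auto simp: queue_ok_def)
    have pa: "arr \<rho> aPA 0 = (arr \<tau> aPA 0)(var \<tau> xQ := var \<tau> xP)"
      by (simp add: \<rho> arr_sem) (simp add: \<tau>'_def)
    have pin: "var \<tau> xP \<in> set (queue \<tau>)" using p by (metis length_queue nth_mem)
    have nq: "var \<tau> xQ \<notin> set (queue \<tau>)" using nm ok by (simp add: queue_ok_def)
    have "search_inv n R q0 \<rho>"
      unfolding search_inv_def
    proof (intro conjI ballI allI impI)
      show "queue_ok n \<rho>" by (rule ok\<rho>)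
      show "\<exists>zs. queue \<rho> = q0 @ zs" using inv q\<rho> by (auto simp: search_inv_def)
      fix z assume z: "z \<in> set (queue \<rho>)"
      show "\<exists>p\<in>set q0. R\<^sup>*\<^sup>* p z"
      proof (cases "z = var \<tau> xQ")
        case True
        obtain p where "p \<in> set q0" "R\<^sup>*\<^sup>* p (var \<tau> xP)" using inv pin by (auto simp: search_inv_def)
        then show ?thesis using \<open>R (var \<tau> xP) (var \<tau> xQ) \<and> _\<close> True
          by (metis rtranclp.rtrancl_into_rtrancl)
      next
        case False
        then show ?thesis using z inv q\<rho> by (auto simp: search_inv_def)
      qed
    next
      fix i assume i: "length q0 \<le> i" "i < length (queue \<rho>)"
      show "\<exists>h'<i. arr \<rho> aPA 0 (queue \<rho> ! i) = queue \<rho> ! h' \<and> R (queue \<rho> ! h') (queue \<rho> ! i)"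
      proof (cases "i < length (queue \<tau>)")
        case True
        then obtain h' where h': "h' < i" "arr \<tau> aPA 0 (queue \<tau> ! i) = queue \<tau> ! h'"
          "R (queue \<tau> ! h') (queue \<tau> ! i)"
          using inv i unfolding search_inv_def by blast
        have "queue \<tau> ! i \<noteq> var \<tau> xQ" using True nq by (metis nth_mem)
        then show ?thesis using h' True pa q\<rho> by (intro exI[of _ h']) (simp add: nth_append)
      next
        case False
        then have "i = length (queue \<tau>)" using i q\<rho> by simp
        then show ?thesis using p pa q\<rho> True by (intro exI[of _ h]) (simp add: nth_append)
      qed
    qed
    then show ?thesis using q\<rho> by auto
  qed
  then show "search_inv n R q0 (sem (visit j) \<tau>)"
    "\<exists>zs. queue (sem (visit j) \<tau>) = queue \<tau> @ zs"
    "R (var \<tau> xP) (var \<tau> xQ) \<Longrightarrow> var \<tau> xQ \<in> set (queue (sem (visit j) \<tau>))"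
    by (auto simp: \<rho>_def)
qed

text \<open>The set \<open>X\<close> contains everything the search can reach. As the worklist has
  at most \<open>card X\<close> entries, \<open>xPb\<close> rounds expand all of them, and then the
  marked states are closed under \<open>R\<close>.\<close>

lemma closure_correct:
  assumes n: "var \<sigma> xN = n" and ok: "queue_ok n \<sigma>" and j: "j \<notin> {aMK, aQU, aPA}"
    and R: "\<And>p q. p < n \<Longrightarrow> q < n \<Longrightarrow> R p q \<longleftrightarrow> 0 < arr \<sigma> j p q" "\<And>p q. R p q \<Longrightarrow> q < n"
    and X: "finite X" "card X \<le> var \<sigma> xPb" "var \<sigma> xPb \<le> var \<sigma> 0" "set (queue \<sigma>) \<subseteq> X"
      "\<And>p q. R p q \<Longrightarrow> q \<in> X"
  defines "\<sigma>' \<equiv> sem (closure j) \<sigma>"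
  shows "search_inv n R (queue \<sigma>) \<sigma>'"
    and "marked n \<sigma>' = {q. \<exists>p\<in>marked n \<sigma>. R\<^sup>*\<^sup>* p q}"
proof -
  define q0 where "q0 = queue \<sigma>"
  define expanded where "expanded = (\<lambda>k \<tau>. \<forall>i<k. i < var \<tau> xCnt \<longrightarrow> (\<forall>q. R (queue \<tau> ! i) q \<longrightarrow> q \<in> set (queue \<tau>)))"
  have marked_n: "set (queue \<tau>) \<subseteq> {..<n}" if "search_inv n R q0 \<tau>" for \<tau>
    using that by (auto simp: search_inv_def queue_ok_def marked_def)
  have "search_inv n R q0 \<sigma>' \<and> expanded (var \<sigma> xPb) \<sigma>'"
    unfolding \<sigma>'_def closure_def
  proof (rule for_frame_rule[where I = "\<lambda>k \<tau>. search_inv n R q0 \<tau> \<and> expanded k \<tau>"])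
    have "queue (set_var xH 0 \<sigma>) = queue \<sigma>" by (simp add: queue_def)
    then show "search_inv n R q0 (set_var xH 0 \<sigma>) \<and> expanded 0 (set_var xH 0 \<sigma>)"
      using ok by (auto simp: search_inv_def q0_def queue_ok_def marked_def expanded_def)
  next
    fix k \<tau>
    assume I: "search_inv n R q0 \<tau> \<and> expanded k \<tau>" and k: "k < var \<sigma> xPb" "var \<tau> xH = k"
      and fv: "\<And>z. z \<notin> insert xH (mods (IfLess (V xH) (V xCnt) (Assign xP (Arr aQU (N 0) (V xH)) ;; For xQ xN (visit j)) Skip)) \<Longrightarrow>
        var \<tau> z = var \<sigma> z"
      and fa: "\<And>i. i \<notin> amods (IfLess (V xH) (V xCnt) (Assign xP (Arr aQU (N 0) (V xH)) ;; For xQ xN (visit j)) Skip) \<Longrightarrow>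
        arr \<tau> i = arr \<sigma> i"
    let ?b = "IfLess (V xH) (V xCnt) (Assign xP (Arr aQU (N 0) (V xH)) ;; For xQ xN (visit j)) Skip"
    have same: "search_inv n R q0 (bump xH \<rho>) = search_inv n R q0 \<rho>" "expanded i (bump xH \<rho>) = expanded i \<rho>" for \<rho> i
      using search_inv_cong[of "bump xH \<rho>" \<rho>] by (auto simp: expanded_def)
    show "search_inv n R q0 (bump xH (sem ?b \<tau>)) \<and> expanded (Suc k) (bump xH (sem ?b \<tau>))"
    proof (cases "k < var \<tau> xCnt")
      case False
      then have "sem ?b \<tau> = \<tau>" using k by simp
      then show ?thesis using I False unfolding same by (auto simp: expanded_def less_Suc_eq)
    next
      case True
      define \<tau>1 where "\<tau>1 = sem (Assign xP (Arr aQU (N 0) (V xH))) \<tau>"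
      define p where "p = queue \<tau> ! k"
      have p: "var \<tau>1 xP = p" using True k by (simp add: \<tau>1_def p_def queue_def)
      have q1: "queue \<tau>1 = queue \<tau>" by (simp add: queue_def \<tau>1_def)
      have n1: "var \<tau>1 xN = n" "var \<tau>1 0 = var \<sigma> 0" "arr \<tau>1 j = arr \<sigma> j"
        using fv[of xN] fv[of 0] fa[of j] j n by (simp_all add: \<tau>1_def)
      have pn: "p < n" using marked_n[of \<tau>] I True
        by (metis length_queue lessThan_iff nth_mem p_def subsetD)
      have "search_inv n R q0 \<tau>1" using I search_inv_cong[of \<tau>1 \<tau>] by (simp add: \<tau>1_def)
      have "search_inv n R q0 (sem (For xQ xN (visit j)) \<tau>1) \<and>
          (\<exists>zs. queue (sem (For xQ xN (visit j)) \<tau>1) = queue \<tau> @ zs) \<and>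
          (\<forall>q<var \<tau>1 xN. R p q \<longrightarrow> q \<in> set (queue (sem (For xQ xN (visit j)) \<tau>1)))"
      proof (rule for_frame_rule[where I = "\<lambda>i \<rho>. search_inv n R q0 \<rho> \<and>
          (\<exists>zs. queue \<rho> = queue \<tau> @ zs) \<and> (\<forall>q<i. R p q \<longrightarrow> q \<in> set (queue \<rho>))"])
        have "search_inv n R q0 (set_var xQ 0 \<tau>1)"
          using \<open>search_inv n R q0 \<tau>1\<close> search_inv_cong[of "set_var xQ 0 \<tau>1" \<tau>1] by simp
        moreover have "queue (set_var xQ 0 \<tau>1) = queue \<tau>" using q1 by (simp add: queue_def)
        ultimately show "search_inv n R q0 (set_var xQ 0 \<tau>1) \<and> (\<exists>zs. queue (set_var xQ 0 \<tau>1) = queue \<tau> @ zs) \<and>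
          (\<forall>q<0. R p q \<longrightarrow> q \<in> set (queue (set_var xQ 0 \<tau>1)))" by simp
      next
        fix i \<rho>
        assume J: "search_inv n R q0 \<rho> \<and> (\<exists>zs. queue \<rho> = queue \<tau> @ zs) \<and> (\<forall>q<i. R p q \<longrightarrow> q \<in> set (queue \<rho>))"
          and i: "i < var \<tau>1 xN" "var \<rho> xQ = i"
          and gv: "\<And>z. z \<notin> insert xQ (mods (visit j)) \<Longrightarrow> var \<rho> z = var \<tau>1 z"
          and ga: "\<And>z. z \<notin> amods (visit j) \<Longrightarrow> arr \<rho> z = arr \<tau>1 z"
        obtain zs where zs: "queue \<rho> = queue \<tau> @ zs" using J by blast
        have \<rho>p: "var \<rho> xP = p" "var \<rho> 0 = var \<sigma> 0" "arr \<rho> j = arr \<sigma> j"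
          using gv[of xP] gv[of 0] ga[of j] n1 p j by simp_all
        have kc: "k < var \<rho> xCnt" "queue \<rho> ! k = var \<rho> xP"
        proof -
          have "length (queue \<rho>) = length (queue \<tau>) + length zs" unfolding zs by simp
          then show "k < var \<rho> xCnt" using True by simp
          show "queue \<rho> ! k = var \<rho> xP" using zs True \<rho>p by (simp add: p_def nth_append)
        qed
        have Rj: "R (var \<rho> xP) (var \<rho> xQ) \<longleftrightarrow> 0 < arr \<rho> j (var \<rho> xP) (var \<rho> xQ)"
          using R(1)[OF pn, of i] i n1 \<rho>p by simp
        have qn: "var \<rho> xQ < n" using i n1 by simp
        have X2: "card X \<le> var \<rho> 0" using X(2,3) \<rho>p by simp
        have X5: "\<forall>p q. R p q \<longrightarrow> q \<in> X" using X(5) by blast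
        have X3: "set q0 \<subseteq> X" using X(4) by (simp add: q0_def)
        note V = visit_correct[OF conjunct1[OF J] j Rj kc qn X(1) X2 X3 X5]
        obtain zs' where zs': "queue (sem (visit j) \<rho>) = queue \<rho> @ zs'" using V(2) by blast
        show "search_inv n R q0 (bump xQ (sem (visit j) \<rho>)) \<and>
          (\<exists>zs. queue (bump xQ (sem (visit j) \<rho>)) = queue \<tau> @ zs) \<and>
          (\<forall>q<Suc i. R p q \<longrightarrow> q \<in> set (queue (bump xQ (sem (visit j) \<rho>))))"
          using V(1,3) zs' zs J \<rho>p i search_inv_cong[of "bump xQ (sem (visit j) \<rho>)" "sem (visit j) \<rho>"]
          by (auto simp: less_Suc_eq)
      qed simp_all
      then obtain zs where W: "search_inv n R q0 (sem ?b \<tau>)" "queue (sem ?b \<tau>) = queue \<tau> @ zs"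
        "\<forall>q<n. R p q \<longrightarrow> q \<in> set (queue (sem ?b \<tau>))"
        using True k n1 by (auto simp: \<tau>1_def)
      have "expanded (Suc k) (sem ?b \<tau>)"
        unfolding expanded_def
      proof (intro allI impI)
        fix i q assume a: "i < Suc k" "i < var (sem ?b \<tau>) xCnt" "R (queue (sem ?b \<tau>) ! i) q"
        have "i < var \<tau> xCnt" using a True by simp
        then have eq: "queue (sem ?b \<tau>) ! i = queue \<tau> ! i" unfolding W(2) by (simp add: nth_append)
        show "q \<in> set (queue (sem ?b \<tau>))"
        proof (cases "i = k")
          case True
          then show ?thesis using a eq W(3) R(2) by (simp add: p_def)
        next
          case False
          then have "i < k" "R (queue \<tau> ! i) q" using a(1,3) unfolding eq by simp_all
          then have "q \<in> set (queue \<tau>)" using I \<open>i < var \<tau> xCnt\<close> unfolding expanded_def by blast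
          then show ?thesis unfolding W(2) by simp
        qed
      qed
      then show ?thesis using W(1) unfolding same by simp
    qed
  qed auto
  then have inv: "search_inv n R q0 \<sigma>'" and dn: "expanded (var \<sigma> xPb) \<sigma>'" by auto
  then show "search_inv n R (queue \<sigma>) \<sigma>'" by (simp add: q0_def)
  have ok': "queue_ok n \<sigma>'" using inv by (simp add: search_inv_def)
  have q0: "set q0 = marked n \<sigma>" using ok by (simp add: queue_ok_def q0_def)
  have m': "set (queue \<sigma>') = marked n \<sigma>'" using ok' by (simp add: queue_ok_def)
  have subX: "marked n \<sigma>' \<subseteq> X"
  proof
    fix z assume "z \<in> marked n \<sigma>'"
    then obtain p where "p \<in> set q0" "R\<^sup>*\<^sup>* p z" using inv m' unfolding search_inv_def by blast
    then show "z \<in> X" using X unfolding q0_def by (metis rtranclp.cases subsetD)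
  qed
  have le: "var \<sigma>' xCnt \<le> var \<sigma> xPb" using count_le[OF ok' subX X(1)] X(2) by simp
  have closed: "q \<in> marked n \<sigma>'" if p: "p \<in> marked n \<sigma>'" and pq: "R p q" for p q
  proof -
    obtain i where i: "i < var \<sigma>' xCnt" "queue \<sigma>' ! i = p" using p m' by (metis in_set_conv_nth length_queue)
    then show ?thesis using dn le pq m' unfolding expanded_def by (metis less_le_trans)
  qed
  have "q \<in> marked n \<sigma>'" if "R\<^sup>*\<^sup>* p q" "p \<in> marked n \<sigma>" for p q
    using that
  proof (induction rule: rtranclp_induct)
    case base
    then show ?case using inv q0 m' unfolding search_inv_def by (metis UnI1 set_append)
  next
    case (step y z)
    then show ?case using closed by blast
  qed
  then show "marked n \<sigma>' = {q. \<exists>p\<in>marked n \<sigma>. R\<^sup>*\<^sup>* p q}"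
    using inv q0 m' unfolding search_inv_def by blast
qed

lemma queue_ok_bump: "queue_ok n (bump xQ \<sigma>) = queue_ok n \<sigma>" "queue_ok n (bump xP \<sigma>) = queue_ok n \<sigma>"
  by (simp_all add: queue_ok_def)

section \<open>The program\<close>

definition sym_code :: "nat \<Rightarrow> nat \<Rightarrow> expr" where
  "sym_code S x = Plus (Times (V x) (N S)) (V xA)"

text \<open>Parallel transitions overwrite each other in \<open>aKN\<close> and \<open>aVR\<close>.
  Any of them will do, as the configuration of a state is computed along a single path. Symbols, in
  contrast, are kept apart in \<open>aMV\<close>.\<close>

definition load_step :: "nat \<Rightarrow> com" where
  "load_step S = (let ve = Write aVF (V xP) (V xQ) (N 1) ;; Write aVB (V xQ) (V xP) (N 1) in
     Write aAL (V xP) (V xQ) (N 1) ;; Write aKN (V xP) (V xQ) (V xE) ;;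
     Write aVR (V xP) (V xQ) (V xA) ;;
     IfLess (N 0) (V xE)
       (IfLess (V xE) (N 2) (Write aMV (V xP) (sym_code S xQ) (N 1)) ve) ve)"

definition load :: "nat \<Rightarrow> com" where
  "load S = For xK xM (Read xP (Plus (N 6) (Times (N 4) (V xK))) ;;
     Read xE (Plus (N 7) (Times (N 4) (V xK))) ;; Read xA (Plus (N 8) (Times (N 4) (V xK))) ;;
     Read xQ (Plus (N 9) (Times (N 4) (V xK))) ;; load_step S)"

definition sym_addr :: "nat \<Rightarrow> expr" where
  "sym_addr x = Plus (Plus (N 6) (Times (N 4) (V xM))) (V x)"

text \<open>Only states at which the symbol itself is read are recorded, before the closure under
  the other transitions: the configurations of interest are those immediately before a
  symbol.\<close>

definition ending_states :: "nat \<Rightarrow> com" where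
  "ending_states S = For xQ xN (For xP xN
     (IfLess (N 0) (Times (Arr aMK (N 0) (V xP)) (Arr aMV (V xQ) (sym_code S xP)))
       (Write aBB (V xT) (V xQ) (N 1)) Skip))"

definition mark_ending :: com where
  "mark_ending = For xQ xN (IfLess (N 0) (Arr aBB (V xT) (V xQ)) (push xQ) Skip)"

definition back_step :: "nat \<Rightarrow> com" where
  "back_step S = Assign xT (Minus (Minus (V xL) (N 1)) (V xK)) ;; Read xA (sym_addr xT) ;;
     ending_states S ;; clear ;; mark_ending ;; closure aVB"

definition backward :: "nat \<Rightarrow> com" where
  "backward S = clear ;; push xFin ;; closure aVB ;; For xK xL (back_step S)"

definition config_step :: com where
  "config_step = Assign xQ (Arr aQU (N 0) (V xH)) ;; Assign xP (Arr aPA (N 0) (V xQ)) ;;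
     For xY xV (Write aCF (V xQ) (V xY) (Arr aCF (V xP) (V xY))) ;;
     IfLess (Arr aKN (V xP) (V xQ)) (N 2) Skip
       (IfLess (Arr aKN (V xP) (V xQ)) (N 3)
          (Write aCF (V xQ) (Arr aVR (V xP) (V xQ)) (N 1))
          (Write aCF (V xQ) (Arr aVR (V xP) (V xQ)) (N 2)))"

text \<open>The root of the search tree is skipped: all its variables are unopened, which is the
  initial content 0 of the array.\<close>

definition configs :: com where
  "configs = clear ;; push xIni ;; closure aAL ;;
     For xH xPb (IfLess (N 0) (V xH) (IfLess (V xH) (V xCnt) config_step Skip) Skip)"

definition candidates :: com where
  "candidates = For xQ xN
     (IfLess (N 0) (Times (Arr aMK (N 0) (V xQ)) (Arr aBB (V xI) (V xQ)))
       (Write aRS (V xI) (V xQ) (N 1)) (Write aRS (V xI) (V xQ) (N 0)))"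

definition same_config :: com where
  "same_config = Assign xF (N 1) ;; For xY xV
     (IfLess (Arr aCF (V xQ) (V xY)) (Arr aCF (V xR) (V xY)) (Assign xF (N 0))
       (IfLess (Arr aCF (V xR) (V xY)) (Arr aCF (V xQ) (V xY)) (Assign xF (N 0)) Skip))"

definition successors :: "nat \<Rightarrow> com" where
  "successors S = For xP xN (IfLess (N 0) (Arr aMV (V xQ) (sym_code S xP))
     (IfLess (Arr aMK (N 0) (V xP)) (N 1) (push xP) Skip) Skip)"

text \<open>Each state is compared only with the representative in \<open>xR\<close>. With the scan
  of the successors this takes time of order n * (|V| + n) per level.\<close>

definition expand :: "nat \<Rightarrow> com" where
  "expand S = For xQ xN (IfLess (N 0) (Arr aRS (V xI) (V xQ))
     (same_config ;; IfLess (N 0) (V xF)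
        (Write aRS (V xI) (V xQ) (N 0) ;; successors S) Skip) Skip)"

definition choose_rep :: com where
  "choose_rep = Assign xR (N 0) ;;
     For xQ xN (IfLess (N 0) (Arr aRS (V xI) (V xQ)) (Assign xR (V xQ)) Skip)"

definition descend_step :: "nat \<Rightarrow> com" where
  "descend_step S = choose_rep ;; Write aRP (V xI) (N 0) (V xR) ;; clear ;; Read xA (sym_addr xI) ;;
     expand S ;; closure aVF ;; Inc xI ;; candidates"

text \<open>The search may resume on any level, so the number of rounds is fixed to
  \<open>xL\<close> and those after the last level are idle.\<close>

definition descend :: "nat \<Rightarrow> com" where
  "descend S = For xK xL (IfLess (V xI) (V xL) (descend_step S) Skip)"

definition ascend_step :: com where
  "ascend_step = Assign xI (Minus (V xI) (N 1)) ;;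
     For xQ xN (IfLess (N 0) (Arr aRS (V xI) (V xQ)) (Assign xGo (N 1)) Skip)"

text \<open>The flag stops the climb at the first level that still has unexplored states. If there
  is none, it stays 0 and thereby ends the enumeration.\<close>

definition ascend :: com where
  "ascend = Assign xGo (N 0) ;; For xK xL (IfLess (V xGo) (N 1) ascend_step Skip)"

definition next_answer :: "nat \<Rightarrow> com" where
  "next_answer S = ascend ;; IfLess (N 0) (V xGo) (descend S) Skip"

definition print_bounds :: com where
  "print_bounds = Assign xA (N 1) ;; Assign xB (N 1) ;; For xK xL
     (Assign xR (Arr aRP (V xK) (N 0)) ;;
      IfLess (Arr aCF (V xR) (V xY)) (N 1) (Inc xA) Skip ;;
      IfLess (Arr aCF (V xR) (V xY)) (N 2) (Inc xB) Skip)"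

definition print_answer :: com where
  "print_answer = For xY xV (print_bounds ;; Print xA ;; Print xB)"

definition header :: com where
  "header = Read xN (N 0) ;; Read xM (N 1) ;; Read xV (N 2) ;; Read xL (N 3) ;;
     Read xIni (N 4) ;; Read xFin (N 5)"

text \<open>For an empty string the time allowed here is constant, so not even the marks of the
  states can be cleared. The string is accepted exactly if it is empty and the initial and final
  state coincide; equality of their numbers is expressed by two tests.\<close>

definition no_transitions :: com where
  "no_transitions = IfLess (V xL) (N 1) (IfLess (V xIni) (V xFin) Skip
     (IfLess (V xFin) (V xIni) Skip (Assign xGo (N 1)))) Skip"

definition tables :: "nat \<Rightarrow> com" where
  "tables S = Assign xPb (V xM) ;; Inc xPb ;; IfLess (V xN) (V xPb) (Assign xPb (V xN)) Skip ;;
     load S ;; backward S"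

definition first_answer :: "nat \<Rightarrow> com" where
  "first_answer S = configs ;; clear ;; push xIni ;; closure aVF ;; Assign xI (N 0) ;; candidates ;;
     descend S ;; Assign xGo (N 1)"

definition preprocess :: "nat \<Rightarrow> com" where
  "preprocess S = header ;; IfLess (V xM) (N 1) no_transitions
     (tables S ;; IfLess (N 0) (Arr aMK (N 0) (V xIni)) (first_answer S) Skip)"

lemma mods_macros [simp]:
  "mods (load_step S) = {}" "amods (load_step S) = {aAL, aKN, aVR, aVF, aVB, aMV}"
  "mods (load S) = {xK, xP, xE, xA, xQ}" "amods (load S) = {aAL, aKN, aVR, aVF, aVB, aMV}"
  "mods (ending_states S) = {xQ, xP}" "amods (ending_states S) = {aBB}"
  "mods mark_ending = {xQ, xCnt}" "amods mark_ending = {aMK, aQU}"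
  "mods (back_step S) = {xT, xA, xQ, xP, xCnt, xH}" "amods (back_step S) = {aBB, aMK, aQU, aPA}"
  "mods (backward S) = {xK, xT, xA, xQ, xP, xCnt, xH}" "amods (backward S) = {aBB, aMK, aQU, aPA}"
  "mods config_step = {xQ, xP, xY}" "amods config_step = {aCF}"
  "mods configs = {xH, xQ, xP, xY, xCnt}" "amods configs = {aCF, aMK, aQU, aPA}"
  "mods candidates = {xQ}" "amods candidates = {aRS}"
  "mods same_config = {xF, xY}" "amods same_config = {}"
  "mods (successors S) = {xP, xCnt}" "amods (successors S) = {aMK, aQU}"
  "mods (expand S) = {xQ, xF, xY, xP, xCnt}" "amods (expand S) = {aRS, aMK, aQU}"
  "mods choose_rep = {xR, xQ}" "amods choose_rep = {}"
  "mods (descend_step S) = {xR, xQ, xCnt, xA, xF, xY, xP, xH, xI}"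
  "amods (descend_step S) = {aRP, aRS, aMK, aQU, aPA}"
  "mods (descend S) = {xK, xR, xQ, xCnt, xA, xF, xY, xP, xH, xI}"
  "amods (descend S) = {aRP, aRS, aMK, aQU, aPA}"
  "mods ascend_step = {xI, xQ, xGo}" "amods ascend_step = {}"
  "mods ascend = {xI, xQ, xGo, xK}" "amods ascend = {}"
  "mods (next_answer S) = {xGo, xK, xR, xQ, xCnt, xA, xF, xY, xP, xH, xI}"
  "amods (next_answer S) = {aRP, aRS, aMK, aQU, aPA}"
  "mods print_bounds = {xA, xB, xK, xR}" "amods print_bounds = {}"
  "mods print_answer = {xY, xA, xB, xK, xR}" "amods print_answer = {}"
  "mods header = {xN, xM, xV, xL, xIni, xFin}" "amods header = {}"
  by (auto simp: load_step_def load_def ending_states_def mark_ending_def back_step_def backward_def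
      config_step_def configs_def candidates_def same_config_def successors_def expand_def
      choose_rep_def descend_step_def descend_def ascend_step_def ascend_def next_answer_def
      print_bounds_def print_answer_def header_def Let_def)

lemma silent_macros [simp]:
  "silent (preprocess S)" "silent (next_answer S)" "silent print_bounds"
  by (auto simp: load_step_def load_def ending_states_def mark_ending_def back_step_def backward_def
      config_step_def configs_def candidates_def same_config_def successors_def expand_def
      choose_rep_def descend_step_def descend_def ascend_step_def ascend_def next_answer_def
      print_bounds_def header_def Let_def no_transitions_def tables_def first_answer_def preprocess_def)

section \<open>Transition tables and the backward pass\<close>

definition loaded :: "nat \<Rightarrow> (nat \<times> nat \<times> nat \<times> nat) set \<Rightarrow> state \<Rightarrow> bool" where
  "loaded S T \<sigma> \<longleftrightarrow>
     (\<forall>p q. 0 < arr \<sigma> aAL p q \<longleftrightarrow> (\<exists>e a. (p, e, a, q) \<in> T)) \<and>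
     (\<forall>p q. 0 < arr \<sigma> aAL p q \<longrightarrow> (p, arr \<sigma> aKN p q, arr \<sigma> aVR p q, q) \<in> T) \<and>
     (\<forall>p q. 0 < arr \<sigma> aVF p q \<longleftrightarrow> (\<exists>e a. e \<noteq> 1 \<and> (p, e, a, q) \<in> T)) \<and>
     (\<forall>p q. 0 < arr \<sigma> aVB q p \<longleftrightarrow> (\<exists>e a. e \<noteq> 1 \<and> (p, e, a, q) \<in> T)) \<and>
     (\<forall>p q a. a < S \<longrightarrow> (0 < arr \<sigma> aMV p (q * S + a) \<longleftrightarrow> (p, 1, a, q) \<in> T))"

lemma symbol_index_inj:
  fixes q q' a a' S :: nat
  assumes "q * S + a = q' * S + a'" "a < S" "a' < S"
  shows "q = q' \<and> a = a'"
proof -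
  have "(q * S + a) div S = q" "(q' * S + a') div S = q'" using assms(2,3) by auto
  then have "q = q'" using assms(1) by metis
  then show ?thesis using assms by simp
qed

lemma load_step_correct:
  assumes "loaded S T \<sigma>" "var \<sigma> xE = 1 \<Longrightarrow> var \<sigma> xA < S"
  shows "loaded S (insert (var \<sigma> xP, var \<sigma> xE, var \<sigma> xA, var \<sigma> xQ) T) (sem (load_step S) \<sigma>)"
proof -
  define p e a q where "p = var \<sigma> xP" and "e = var \<sigma> xE" and "a = var \<sigma> xA" and "q = var \<sigma> xQ"
  let ?\<sigma> = "sem (load_step S) \<sigma>"
  have AL: "arr ?\<sigma> aAL = (\<lambda>p' q'. if p' = p \<and> q' = q then 1 else arr \<sigma> aAL p' q')"
    and KN: "arr ?\<sigma> aKN = (\<lambda>p' q'. if p' = p \<and> q' = q then e else arr \<sigma> aKN p' q')"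
    and VR: "arr ?\<sigma> aVR = (\<lambda>p' q'. if p' = p \<and> q' = q then a else arr \<sigma> aVR p' q')"
    by (auto simp: load_step_def Let_def p_def e_def a_def q_def fun_eq_iff)
  have VF: "arr ?\<sigma> aVF = (\<lambda>p' q'. if e \<noteq> 1 \<and> p' = p \<and> q' = q then 1 else arr \<sigma> aVF p' q')"
    and VB: "arr ?\<sigma> aVB = (\<lambda>p' q'. if e \<noteq> 1 \<and> p' = q \<and> q' = p then 1 else arr \<sigma> aVB p' q')"
    and MV: "arr ?\<sigma> aMV = (\<lambda>p' x. if e = 1 \<and> p' = p \<and> x = q * S + a then 1 else arr \<sigma> aMV p' x)"
    by (auto simp: load_step_def Let_def p_def e_def a_def q_def fun_eq_iff sym_code_def)
  have aS: "e = 1 \<Longrightarrow> a < S" using assms(2) by (simp add: e_def a_def)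
  have L: "0 < arr \<sigma> aAL p' q' \<longleftrightarrow> (\<exists>e a. (p', e, a, q') \<in> T)"
    "0 < arr \<sigma> aAL p' q' \<longrightarrow> (p', arr \<sigma> aKN p' q', arr \<sigma> aVR p' q', q') \<in> T"
    "0 < arr \<sigma> aVF p' q' \<longleftrightarrow> (\<exists>e a. e \<noteq> 1 \<and> (p', e, a, q') \<in> T)"
    "0 < arr \<sigma> aVB q' p' \<longleftrightarrow> (\<exists>e a. e \<noteq> 1 \<and> (p', e, a, q') \<in> T)"
    "a' < S \<longrightarrow> (0 < arr \<sigma> aMV p' (q' * S + a') \<longleftrightarrow> (p', 1, a', q') \<in> T)" for p' q' a'
    using assms(1) unfolding loaded_def by blast+
  show ?thesis
    unfolding loaded_def p_def[symmetric] e_def[symmetric] a_def[symmetric] q_def[symmetric] AL KN VR VF VB MV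
  proof (intro conjI allI impI)
    fix p' q' a' assume "a' < S"
    then show "0 < (if e = 1 \<and> p' = p \<and> q' * S + a' = q * S + a then 1 else arr \<sigma> aMV p' (q' * S + a')) \<longleftrightarrow>
       (p', 1, a', q') \<in> insert (p, e, a, q) T"
      using L(5)[of a' p' q'] symbol_index_inj[of q' S a' q a] aS by auto
  qed (use L(1-4) in auto)
qed

lemma load_correct:
  assumes "loaded S {} \<sigma>" "\<And>k. k < var \<sigma> xM \<Longrightarrow> fst (snd (tr k)) = 1 \<Longrightarrow> fst (snd (snd (tr k))) < S"
    and "\<And>k. k < var \<sigma> xM \<Longrightarrow> tr k = (inp \<sigma> (6 + 4 * k), inp \<sigma> (7 + 4 * k), inp \<sigma> (8 + 4 * k), inp \<sigma> (9 + 4 * k))"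
  shows "loaded S (tr ` {..<var \<sigma> xM}) (sem (load S) \<sigma>)"
  unfolding load_def
proof (rule for_frame_rule[where I = "\<lambda>k \<tau>. loaded S (tr ` {..<k}) \<tau>"])
  fix k \<tau>
  assume I: "loaded S (tr ` {..<k}) \<tau>" and k: "k < var \<sigma> xM" "var \<tau> xK = k" "inp \<tau> = inp \<sigma>"
  define \<tau>1 where "\<tau>1 = sem (Read xP (Plus (N 6) (Times (N 4) (V xK))) ;;
     Read xE (Plus (N 7) (Times (N 4) (V xK))) ;; Read xA (Plus (N 8) (Times (N 4) (V xK))) ;;
     Read xQ (Plus (N 9) (Times (N 4) (V xK)))) \<tau>"
  have v: "(var \<tau>1 xP, var \<tau>1 xE, var \<tau>1 xA, var \<tau>1 xQ) = tr k"
    using assms(3)[OF k(1)] k(2,3) by (simp add: \<tau>1_def)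
  have "loaded S (tr ` {..<k}) \<tau>1" using I by (simp add: \<tau>1_def loaded_def)
  moreover have "var \<tau>1 xE = 1 \<Longrightarrow> var \<tau>1 xA < S" using assms(2)[OF k(1)] v[symmetric] by simp
  ultimately have "loaded S (insert (tr k) (tr ` {..<k})) (sem (load_step S) \<tau>1)"
    using load_step_correct[of S _ \<tau>1] v by simp
  then show "loaded S (tr ` {..<Suc k}) (bump xK (sem (Read xP (Plus (N 6) (Times (N 4) (V xK))) ;;
     Read xE (Plus (N 7) (Times (N 4) (V xK))) ;; Read xA (Plus (N 8) (Times (N 4) (V xK))) ;;
     Read xQ (Plus (N 9) (Times (N 4) (V xK))) ;; load_step S) \<tau>))"
    by (simp add: \<tau>1_def lessThan_Suc loaded_def)
qed (use assms(1) in \<open>auto simp: loaded_def\<close>)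

text \<open>The automaton as the machine sees it: a transition is a quadruple of source, kind,
  argument and target, where kind 1 reads a symbol, and \<open>w i\<close> is the number of the
  symbol at position \<open>i\<close>, counted from 0.\<close>

locale graph =
  fixes n m l nv pb S ini fin :: nat and w :: "nat \<Rightarrow> nat" and T :: "(nat \<times> nat \<times> nat \<times> nat) set"
  assumes ini: "ini < n" and fin: "fin < n"
    and T_bounds: "(p, e, a, q) \<in> T \<Longrightarrow> p < n \<and> q < n"
    and T_sym: "(p, 1, a, q) \<in> T \<Longrightarrow> a < S"
    and w_bound: "i < l \<Longrightarrow> w i < S"
    and T_finite: "finite T" and T_card: "card T \<le> m" and pb: "pb = min n (m + 1)"
begin

definition ve :: "nat \<Rightarrow> nat \<Rightarrow> bool" where "ve p q \<longleftrightarrow> (\<exists>e a. e \<noteq> 1 \<and> (p, e, a, q) \<in> T)"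
definition al :: "nat \<Rightarrow> nat \<Rightarrow> bool" where "al p q \<longleftrightarrow> (\<exists>e a. (p, e, a, q) \<in> T)"
definition mv :: "nat \<Rightarrow> nat \<Rightarrow> nat \<Rightarrow> bool" where "mv a p q \<longleftrightarrow> (p, 1, a, q) \<in> T"

text \<open>\<open>XF\<close> and \<open>XB\<close> contain all states that can occur in a forward
  or backward worklist: a seed, and one state for each transition at most. Their sizes are what
  \<open>pb\<close> bounds.\<close>

definition XF :: "nat set" where "XF = insert ini ((\<lambda>(p, e, a, q). q) ` T)"
definition XB :: "nat set" where "XB = insert fin ((\<lambda>(p, e, a, q). p) ` T)"

lemma XF: "finite XF" "card XF \<le> pb" "ini \<in> XF" "al p q \<Longrightarrow> q \<in> XF" "ve p q \<Longrightarrow> q \<in> XF" "mv a p q \<Longrightarrow> q \<in> XF"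
proof -
  have "card XF \<le> m + 1" unfolding XF_def using T_finite T_card card_image_le[OF T_finite, of "\<lambda>(p, e, a, q). q"]
    by (metis (no_types, lifting) Suc_eq_plus1 card_insert_le_m1 diff_Suc_1 finite_imageI le_trans zero_less_Suc)
  moreover have "XF \<subseteq> {..<n}" unfolding XF_def using ini T_bounds by auto
  then have "card XF \<le> n" using card_mono[of "{..<n}" XF] by simp
  ultimately show "card XF \<le> pb" by (simp add: pb)
qed (auto simp: XF_def T_finite al_def ve_def mv_def image_iff intro!: bexI[rotated])

lemma XB: "finite XB" "card XB \<le> pb" "fin \<in> XB" "ve p q \<Longrightarrow> p \<in> XB" "mv a p q \<Longrightarrow> p \<in> XB"
proof -
  have "card XB \<le> m + 1" unfolding XB_def using T_finite T_card card_image_le[OF T_finite, of "\<lambda>(p, e, a, q). p"]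
    by (metis (no_types, lifting) Suc_eq_plus1 card_insert_le_m1 diff_Suc_1 finite_imageI le_trans zero_less_Suc)
  moreover have "XB \<subseteq> {..<n}" unfolding XB_def using fin T_bounds by auto
  then have "card XB \<le> n" using card_mono[of "{..<n}" XB] by simp
  ultimately show "card XB \<le> pb" by (simp add: pb)
qed (auto simp: XB_def T_finite ve_def mv_def image_iff intro!: bexI[rotated])

lemma bounds: "ve p q \<Longrightarrow> p < n" "ve p q \<Longrightarrow> q < n" "mv a p q \<Longrightarrow> p < n" "mv a p q \<Longrightarrow> q < n"
  "al p q \<Longrightarrow> p < n" "al p q \<Longrightarrow> q < n"
  using T_bounds by (auto simp: ve_def mv_def al_def)

text \<open>The index counts the symbols still to be read, so the next one stands at position
  \<open>l - Suc k\<close>.\<close>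

primrec acc :: "nat \<Rightarrow> nat \<Rightarrow> bool" where
  "acc 0 q \<longleftrightarrow> ve\<^sup>*\<^sup>* q fin"
| "acc (Suc k) q \<longleftrightarrow> (\<exists>q' p'. ve\<^sup>*\<^sup>* q q' \<and> mv (w (l - Suc k)) q' p' \<and> acc k p')"

definition good :: "nat \<Rightarrow> nat \<Rightarrow> bool" where
  "good t q \<longleftrightarrow> (\<exists>p'. mv (w t) q p' \<and> acc (l - Suc t) p')"

definition basic :: "state \<Rightarrow> bool" where
  "basic \<sigma> \<longleftrightarrow> var \<sigma> xN = n \<and> var \<sigma> xM = m \<and> var \<sigma> xV = nv \<and> var \<sigma> xL = l \<and>
     var \<sigma> xIni = ini \<and> var \<sigma> xFin = fin \<and> var \<sigma> xPb = pb \<and> pb \<le> var \<sigma> 0 \<and> l < var \<sigma> 0 \<and>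
     (\<forall>i<l. inp \<sigma> (6 + 4 * m + i) = w i) \<and> loaded S T \<sigma>"

lemma basic_cong:
  assumes "\<And>x. x \<le> 7 \<Longrightarrow> var \<sigma> x = var \<tau> x" "\<And>j. j \<le> 4 \<Longrightarrow> arr \<sigma> j = arr \<tau> j"
    "arr \<sigma> aMV = arr \<tau> aMV" "inp \<sigma> = inp \<tau>"
  shows "basic \<sigma> = basic \<tau>"
  using assms by (simp add: basic_def loaded_def)

lemma mv_table: "basic \<sigma> \<Longrightarrow> a < S \<Longrightarrow> 0 < arr \<sigma> aMV p (q * S + a) \<longleftrightarrow> mv a p q"
  by (simp add: basic_def loaded_def mv_def)

lemma mark_ending_correct:
  assumes b: "basic \<sigma>" and "queue \<sigma> = []" "marked n \<sigma> = {}" and Q: "\<And>q. q < n \<Longrightarrow> 0 < arr \<sigma> aBB (var \<sigma> xT) q \<Longrightarrow> q \<in> XB"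
  shows "queue_ok n (sem mark_ending \<sigma>)"
    "marked n (sem mark_ending \<sigma>) = {q. q < n \<and> 0 < arr \<sigma> aBB (var \<sigma> xT) q}"
proof -
  have "queue_ok n (sem mark_ending \<sigma>) \<and>
    marked n (sem mark_ending \<sigma>) = {q. q < var \<sigma> xN \<and> 0 < arr \<sigma> aBB (var \<sigma> xT) q}"
    unfolding mark_ending_def
  proof (rule for_frame_rule[where I = "\<lambda>k \<tau>. queue_ok n \<tau> \<and> marked n \<tau> = {q. q < k \<and> 0 < arr \<sigma> aBB (var \<sigma> xT) q}"])
    show "queue_ok n (set_var xQ 0 \<sigma>) \<and> marked n (set_var xQ 0 \<sigma>) = {q. q < 0 \<and> 0 < arr \<sigma> aBB (var \<sigma> xT) q}"
      using assms(2,3) by (simp add: queue_ok_def marked_def queue_def)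
  next
    fix k and \<tau> :: state
    let ?b = "IfLess (N 0) (Arr aBB (V xT) (V xQ)) (push xQ) Skip"
    assume I: "queue_ok n \<tau> \<and> marked n \<tau> = {q. q < k \<and> 0 < arr \<sigma> aBB (var \<sigma> xT) q}"
      and k: "k < var \<sigma> xN" "var \<tau> xQ = k"
      and fv: "\<And>z. z \<notin> insert xQ (mods ?b) \<Longrightarrow> var \<tau> z = var \<sigma> z"
      and fa: "\<And>j. j \<notin> amods ?b \<Longrightarrow> arr \<tau> j = arr \<sigma> j"
    have kn: "k < n" using k b by (simp add: basic_def)
    have eq: "var \<tau> xT = var \<sigma> xT" "var \<tau> 0 = var \<sigma> 0" "arr \<tau> aBB = arr \<sigma> aBB"
      using fv[of xT] fv[of 0] fa[of aBB] by simp_all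
    have "queue_ok n (sem ?b \<tau>) \<and> marked n (sem ?b \<tau>) = {q. q < Suc k \<and> 0 < arr \<sigma> aBB (var \<sigma> xT) q}"
    proof (cases "0 < arr \<sigma> aBB (var \<sigma> xT) k")
      case True
      have nm: "k \<notin> marked n \<tau>" using I by simp
      have "marked n \<tau> \<subseteq> XB" using I Q kn by auto
      then have "var \<tau> xCnt < card XB" using count_less[of n \<tau> XB k] I nm Q[OF kn True] XB by simp
      then have "var \<tau> xCnt < var \<tau> 0" using XB(2) b eq by (simp add: basic_def)
      moreover have "arr \<tau> aMK 0 k = 0" using nm kn by (simp add: marked_def)
      ultimately have "queue_ok n (sem (push xQ) \<tau>)" "marked n (sem (push xQ) \<tau>) = insert k (marked n \<tau>)"
        using push_queue_ok[of n \<tau> xQ] push_correct[of \<tau> xQ n] I k kn by auto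
      moreover have "sem ?b \<tau> = sem (push xQ) \<tau>" using True k eq by simp
      moreover have "{q. q < Suc k \<and> 0 < arr \<sigma> aBB (var \<sigma> xT) q} =
          insert k {q. q < k \<and> 0 < arr \<sigma> aBB (var \<sigma> xT) q}"
        using True by (auto simp: less_Suc_eq)
      ultimately show ?thesis using I by simp
    next
      case False
      then have "sem ?b \<tau> = \<tau>" using k eq by simp
      moreover have "{q. q < Suc k \<and> 0 < arr \<sigma> aBB (var \<sigma> xT) q} = {q. q < k \<and> 0 < arr \<sigma> aBB (var \<sigma> xT) q}"
        using False by (auto simp: less_Suc_eq)
      ultimately show ?thesis using I by simp
    qed
    then show "queue_ok n (bump xQ (sem ?b \<tau>)) \<and>
      marked n (bump xQ (sem ?b \<tau>)) = {q. q < Suc k \<and> 0 < arr \<sigma> aBB (var \<sigma> xT) q}"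
      unfolding queue_ok_bump queue_bump(2) .
  qed simp_all
  then show "queue_ok n (sem mark_ending \<sigma>)"
    "marked n (sem mark_ending \<sigma>) = {q. q < n \<and> 0 < arr \<sigma> aBB (var \<sigma> xT) q}"
    using b by (auto simp: basic_def)
qed

lemma ending_states_correct:
  assumes b: "basic \<sigma>" and a: "var \<sigma> xA < S" and z: "\<And>q. arr \<sigma> aBB (var \<sigma> xT) q = 0"
  shows "q < n \<Longrightarrow> 0 < arr (sem (ending_states S) \<sigma>) aBB (var \<sigma> xT) q \<longleftrightarrow>
      (\<exists>p\<in>marked n \<sigma>. mv (var \<sigma> xA) q p)"
    and "t \<noteq> var \<sigma> xT \<Longrightarrow> arr (sem (ending_states S) \<sigma>) aBB t = arr \<sigma> aBB t"
proof -
  let ?t = "var \<sigma> xT" and ?a = "var \<sigma> xA"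
  let ?b = "IfLess (N 0) (Times (Arr aMK (N 0) (V xP)) (Arr aMV (V xQ) (sym_code S xP)))
       (Write aBB (V xT) (V xQ) (N 1)) Skip"
  have "(\<forall>q. 0 < arr (sem (ending_states S) \<sigma>) aBB ?t q \<longleftrightarrow> q < var \<sigma> xN \<and> (\<exists>p\<in>marked n \<sigma>. mv ?a q p)) \<and>
      (\<forall>t. t \<noteq> ?t \<longrightarrow> arr (sem (ending_states S) \<sigma>) aBB t = arr \<sigma> aBB t)"
    unfolding ending_states_def
  proof (rule for_frame_rule[where I = "\<lambda>k \<tau>. (\<forall>q. 0 < arr \<tau> aBB ?t q \<longleftrightarrow> q < k \<and> (\<exists>p\<in>marked n \<sigma>. mv ?a q p)) \<and>
      (\<forall>t. t \<noteq> ?t \<longrightarrow> arr \<tau> aBB t = arr \<sigma> aBB t)"])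
    fix k and \<tau> :: state
    assume I: "(\<forall>q. 0 < arr \<tau> aBB ?t q \<longleftrightarrow> q < k \<and> (\<exists>p\<in>marked n \<sigma>. mv ?a q p)) \<and>
      (\<forall>t. t \<noteq> ?t \<longrightarrow> arr \<tau> aBB t = arr \<sigma> aBB t)"
      and k: "k < var \<sigma> xN" "var \<tau> xQ = k"
      and fv: "\<And>z. z \<notin> insert xQ (mods (For xP xN ?b)) \<Longrightarrow> var \<tau> z = var \<sigma> z"
      and fa: "\<And>j. j \<notin> amods (For xP xN ?b) \<Longrightarrow> arr \<tau> j = arr \<sigma> j"
    have eq: "var \<tau> xT = ?t" "var \<tau> xA = ?a" "arr \<tau> aMK = arr \<sigma> aMK" "arr \<tau> aMV = arr \<sigma> aMV" "var \<tau> xN = var \<sigma> xN"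
      using fv[of xT] fv[of xA] fv[of xN] fa[of aMK] fa[of aMV] by simp_all
    have "(\<forall>q. 0 < arr (sem (For xP xN ?b) \<tau>) aBB ?t q \<longleftrightarrow>
          (q < k \<or> q = k) \<and> (\<exists>p\<in>marked n \<sigma>. (q < k \<or> p < var \<tau> xN) \<and> mv ?a q p)) \<and>
      (\<forall>t. t \<noteq> ?t \<longrightarrow> arr (sem (For xP xN ?b) \<tau>) aBB t = arr \<sigma> aBB t)"
    \<comment> \<open>Entries for states below \<open>k\<close> are complete, while for
      \<open>k\<close> itself only the targets below \<open>i\<close> have been considered.\<close>
    proof (rule for_frame_rule[where I = "\<lambda>i \<rho>. (\<forall>q. 0 < arr \<rho> aBB ?t q \<longleftrightarrow>
          (q < k \<or> q = k) \<and> (\<exists>p\<in>marked n \<sigma>. (q < k \<or> p < i) \<and> mv ?a q p)) \<and>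
        (\<forall>t. t \<noteq> ?t \<longrightarrow> arr \<rho> aBB t = arr \<sigma> aBB t)"])
      fix i and \<rho> :: state
      assume J: "(\<forall>q. 0 < arr \<rho> aBB ?t q \<longleftrightarrow>
          (q < k \<or> q = k) \<and> (\<exists>p\<in>marked n \<sigma>. (q < k \<or> p < i) \<and> mv ?a q p)) \<and>
        (\<forall>t. t \<noteq> ?t \<longrightarrow> arr \<rho> aBB t = arr \<sigma> aBB t)"
        and i: "i < var \<tau> xN" "var \<rho> xP = i"
        and gv: "\<And>z. z \<notin> insert xP (mods ?b) \<Longrightarrow> var \<rho> z = var \<tau> z"
        and ga: "\<And>j. j \<notin> amods ?b \<Longrightarrow> arr \<rho> j = arr \<tau> j"
      have eq': "var \<rho> xT = ?t" "var \<rho> xA = ?a" "arr \<rho> aMK = arr \<sigma> aMK" "arr \<rho> aMV = arr \<sigma> aMV" "var \<rho> xQ = k"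
        using gv[of xT] gv[of xA] gv[of xQ] ga[of aMK] ga[of aMV] eq k by simp_all
      have iN: "i < n" using i eq b by (simp add: basic_def)
      have "0 < arr \<sigma> aMK 0 i * arr \<sigma> aMV k (i * S + ?a) \<longleftrightarrow> i \<in> marked n \<sigma> \<and> mv ?a k i"
        using mv_table[OF b a] iN by (simp add: marked_def)
      then show "(\<forall>q. 0 < arr (bump xP (sem ?b \<rho>)) aBB ?t q \<longleftrightarrow>
          (q < k \<or> q = k) \<and> (\<exists>p\<in>marked n \<sigma>. (q < k \<or> p < Suc i) \<and> mv ?a q p)) \<and>
        (\<forall>t. t \<noteq> ?t \<longrightarrow> arr (bump xP (sem ?b \<rho>)) aBB t = arr \<sigma> aBB t)"
        using J eq' i by (auto simp: sym_code_def less_Suc_eq)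
    qed (use I in auto)
    moreover have "p < var \<tau> xN" if "p \<in> marked n \<sigma>" for p
      using that eq b by (simp add: marked_def basic_def)
    ultimately show "(\<forall>q. 0 < arr (bump xQ (sem (For xP xN ?b) \<tau>)) aBB ?t q \<longleftrightarrow>
        q < Suc k \<and> (\<exists>p\<in>marked n \<sigma>. mv ?a q p)) \<and>
      (\<forall>t. t \<noteq> ?t \<longrightarrow> arr (bump xQ (sem (For xP xN ?b) \<tau>)) aBB t = arr \<sigma> aBB t)"
      unfolding arr_bump less_Suc_eq by blast
  qed (use z in auto)
  then show "q < n \<Longrightarrow> 0 < arr (sem (ending_states S) \<sigma>) aBB ?t q \<longleftrightarrow> (\<exists>p\<in>marked n \<sigma>. mv ?a q p)"
    and "t \<noteq> ?t \<Longrightarrow> arr (sem (ending_states S) \<sigma>) aBB t = arr \<sigma> aBB t"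
    using b by (auto simp: basic_def)
qed

end

section \<open>Correctness of the algorithm\<close>

text \<open>The kinds are those of \<open>encode_label\<close>: below 2 no variable is affected, 2
  opens and 3 closes the variable \<open>a\<close>.\<close>

fun upd :: "nat \<Rightarrow> nat \<Rightarrow> (nat \<Rightarrow> nat) \<Rightarrow> nat \<Rightarrow> nat" where
  "upd e a c = (if e < 2 then c else if e < 3 then c(a := 1) else c(a := 2))"

declare upd.simps [simp del]

definition cfv :: "nat \<Rightarrow> (nat \<Rightarrow> nat \<Rightarrow> nat) \<Rightarrow> nat \<Rightarrow> nat list" where
  "cfv nv cf q = map (cf q) [0..<nv]"

lemma config_step_correct:
  assumes "var \<sigma> xV = nv" "q = arr \<sigma> aQU 0 (var \<sigma> xH)" "p = arr \<sigma> aPA 0 q" "p \<noteq> q"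
  shows "q' \<noteq> q \<Longrightarrow> arr (sem config_step \<sigma>) aCF q' = arr \<sigma> aCF q'"
    and "y < nv \<Longrightarrow> arr (sem config_step \<sigma>) aCF q y = upd (arr \<sigma> aKN p q) (arr \<sigma> aVR p q) (arr \<sigma> aCF p) y"
proof -
  define \<sigma>1 where "\<sigma>1 = sem (Assign xQ (Arr aQU (N 0) (V xH)) ;; Assign xP (Arr aPA (N 0) (V xQ))) \<sigma>"
  have v: "var \<sigma>1 xQ = q" "var \<sigma>1 xP = p" "var \<sigma>1 xV = nv" "arr \<sigma>1 = arr \<sigma>"
    using assms by (simp_all add: \<sigma>1_def)
  define \<sigma>2 where "\<sigma>2 = sem (For xY xV (Write aCF (V xQ) (V xY) (Arr aCF (V xP) (V xY)))) \<sigma>1"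
  have "(\<forall>q'. q' \<noteq> q \<longrightarrow> arr \<sigma>2 aCF q' = arr \<sigma> aCF q') \<and> (\<forall>y<var \<sigma>1 xV. arr \<sigma>2 aCF q y = arr \<sigma> aCF p y)"
    unfolding \<sigma>2_def
  proof (rule for_frame_rule[where I = "\<lambda>k \<tau>. (\<forall>q'. q' \<noteq> q \<longrightarrow> arr \<tau> aCF q' = arr \<sigma> aCF q') \<and>
      (\<forall>y<k. arr \<tau> aCF q y = arr \<sigma> aCF p y)"])
    fix k and \<tau> :: state
    let ?b = "Write aCF (V xQ) (V xY) (Arr aCF (V xP) (V xY))"
    assume "(\<forall>q'. q' \<noteq> q \<longrightarrow> arr \<tau> aCF q' = arr \<sigma> aCF q') \<and> (\<forall>y<k. arr \<tau> aCF q y = arr \<sigma> aCF p y)"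
      "var \<tau> xY = k" "\<And>z. z \<notin> insert xY (mods ?b) \<Longrightarrow> var \<tau> z = var \<sigma>1 z"
    moreover from this(3)[of xQ] this(3)[of xP] have "var \<tau> xQ = q" "var \<tau> xP = p" by (simp_all add: v)
    ultimately show "(\<forall>q'. q' \<noteq> q \<longrightarrow> arr (bump xY (sem ?b \<tau>)) aCF q' = arr \<sigma> aCF q') \<and>
      (\<forall>y<Suc k. arr (bump xY (sem ?b \<tau>)) aCF q y = arr \<sigma> aCF p y)"
      using assms(4) by (auto simp: less_Suc_eq)
  qed (use v in auto)
  moreover have "var \<sigma>2 xQ = q" "var \<sigma>2 xP = p" "arr \<sigma>2 aKN = arr \<sigma> aKN" "arr \<sigma>2 aVR = arr \<sigma> aVR"
    unfolding \<sigma>2_def by (subst var_sem arr_sem; simp add: v)+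
  ultimately have 2: "\<And>q'. q' \<noteq> q \<Longrightarrow> arr \<sigma>2 aCF q' = arr \<sigma> aCF q'"
    "\<And>y. y < nv \<Longrightarrow> arr \<sigma>2 aCF q y = arr \<sigma> aCF p y"
    "var \<sigma>2 xQ = q" "var \<sigma>2 xP = p" "arr \<sigma>2 aKN = arr \<sigma> aKN" "arr \<sigma>2 aVR = arr \<sigma> aVR"
    using v by auto
  have s: "sem config_step \<sigma> = sem (IfLess (Arr aKN (V xP) (V xQ)) (N 2) Skip
       (IfLess (Arr aKN (V xP) (V xQ)) (N 3)
          (Write aCF (V xQ) (Arr aVR (V xP) (V xQ)) (N 1))
          (Write aCF (V xQ) (Arr aVR (V xP) (V xQ)) (N 2)))) \<sigma>2"
    by (simp only: config_step_def sem.simps(7) \<sigma>1_def \<sigma>2_def)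
  show "q' \<noteq> q \<Longrightarrow> arr (sem config_step \<sigma>) aCF q' = arr \<sigma> aCF q'"
    "y < nv \<Longrightarrow> arr (sem config_step \<sigma>) aCF q y = upd (arr \<sigma> aKN p q) (arr \<sigma> aVR p q) (arr \<sigma> aCF p) y"
    unfolding s using 2 by (auto simp: upd.simps)
qed

lemma candidates_correct:
  assumes "var \<sigma> xN = n"
  shows "q < n \<Longrightarrow> 0 < arr (sem candidates \<sigma>) aRS (var \<sigma> xI) q \<longleftrightarrow>
      q \<in> marked n \<sigma> \<and> 0 < arr \<sigma> aBB (var \<sigma> xI) q"
    and "j \<noteq> var \<sigma> xI \<Longrightarrow> arr (sem candidates \<sigma>) aRS j = arr \<sigma> aRS j"
proof -
  let ?i = "var \<sigma> xI"
  let ?b = "IfLess (N 0) (Times (Arr aMK (N 0) (V xQ)) (Arr aBB (V xI) (V xQ)))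
       (Write aRS (V xI) (V xQ) (N 1)) (Write aRS (V xI) (V xQ) (N 0))"
  have "(\<forall>q<var \<sigma> xN. 0 < arr (sem candidates \<sigma>) aRS ?i q \<longleftrightarrow> q \<in> marked n \<sigma> \<and> 0 < arr \<sigma> aBB ?i q) \<and>
      (\<forall>j. j \<noteq> ?i \<longrightarrow> arr (sem candidates \<sigma>) aRS j = arr \<sigma> aRS j)"
    unfolding candidates_def
  proof (rule for_frame_rule[where I = "\<lambda>k \<tau>. (\<forall>q<k. 0 < arr \<tau> aRS ?i q \<longleftrightarrow> q \<in> marked n \<sigma> \<and> 0 < arr \<sigma> aBB ?i q) \<and>
      (\<forall>j. j \<noteq> ?i \<longrightarrow> arr \<tau> aRS j = arr \<sigma> aRS j)"])
    fix k and \<tau> :: state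
    assume I: "(\<forall>q<k. 0 < arr \<tau> aRS ?i q \<longleftrightarrow> q \<in> marked n \<sigma> \<and> 0 < arr \<sigma> aBB ?i q) \<and>
      (\<forall>j. j \<noteq> ?i \<longrightarrow> arr \<tau> aRS j = arr \<sigma> aRS j)" and k: "k < var \<sigma> xN" "var \<tau> xQ = k"
      and fv: "\<And>z. z \<notin> insert xQ (mods ?b) \<Longrightarrow> var \<tau> z = var \<sigma> z"
      and fa: "\<And>j. j \<notin> amods ?b \<Longrightarrow> arr \<tau> j = arr \<sigma> j"
    have eq: "var \<tau> xI = ?i" "arr \<tau> aMK = arr \<sigma> aMK" "arr \<tau> aBB = arr \<sigma> aBB"
      using fv[of xI] fa[of aMK] fa[of aBB] by simp_all
    have km: "k \<in> marked n \<sigma> \<longleftrightarrow> 0 < arr \<sigma> aMK 0 k" using k assms by (simp add: marked_def)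
    show "(\<forall>q<Suc k. 0 < arr (bump xQ (sem ?b \<tau>)) aRS ?i q \<longleftrightarrow> q \<in> marked n \<sigma> \<and> 0 < arr \<sigma> aBB ?i q) \<and>
      (\<forall>j. j \<noteq> ?i \<longrightarrow> arr (bump xQ (sem ?b \<tau>)) aRS j = arr \<sigma> aRS j)"
      using I k eq km by (auto simp: less_Suc_eq)
  qed auto
  then show "q < n \<Longrightarrow> 0 < arr (sem candidates \<sigma>) aRS ?i q \<longleftrightarrow>
      q \<in> marked n \<sigma> \<and> 0 < arr \<sigma> aBB ?i q"
    "j \<noteq> ?i \<Longrightarrow> arr (sem candidates \<sigma>) aRS j = arr \<sigma> aRS j"
    using assms by auto
qed

lemma same_config_correct:
  assumes "var \<sigma> xV = nv"
  shows "0 < var (sem same_config \<sigma>) xF \<longleftrightarrow>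
    cfv nv (arr \<sigma> aCF) (var \<sigma> xQ) = cfv nv (arr \<sigma> aCF) (var \<sigma> xR)"
proof -
  let ?b = "IfLess (Arr aCF (V xQ) (V xY)) (Arr aCF (V xR) (V xY)) (Assign xF (N 0))
       (IfLess (Arr aCF (V xR) (V xY)) (Arr aCF (V xQ) (V xY)) (Assign xF (N 0)) Skip)"
  let ?E = "\<lambda>k. \<forall>y<k. arr \<sigma> aCF (var \<sigma> xQ) y = arr \<sigma> aCF (var \<sigma> xR) y"
  define \<sigma>1 where "\<sigma>1 = sem (Assign xF (N 1)) \<sigma>"
  have "0 < var (sem (For xY xV ?b) \<sigma>1) xF \<longleftrightarrow> ?E (var \<sigma>1 xV)"
  proof (rule for_frame_rule[where I = "\<lambda>k \<tau>. 0 < var \<tau> xF \<longleftrightarrow> ?E k"])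
    fix k and \<tau> :: state
    assume I: "0 < var \<tau> xF \<longleftrightarrow> ?E k" and k: "var \<tau> xY = k"
      and fv: "\<And>z. z \<notin> insert xY (mods ?b) \<Longrightarrow> var \<tau> z = var \<sigma>1 z"
      and fa: "\<And>j. j \<notin> amods ?b \<Longrightarrow> arr \<tau> j = arr \<sigma>1 j"
    have eq: "var \<tau> xQ = var \<sigma> xQ" "var \<tau> xR = var \<sigma> xR" "arr \<tau> aCF = arr \<sigma> aCF"
      using fv[of xQ] fv[of xR] fa[of aCF] by (simp_all add: \<sigma>1_def)
    show "0 < var (bump xY (sem ?b \<tau>)) xF \<longleftrightarrow> ?E (Suc k)"
      using I k eq by (auto simp: less_Suc_eq)
  qed (auto simp: \<sigma>1_def)
  moreover have "sem same_config \<sigma> = sem (For xY xV ?b) \<sigma>1"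
    by (simp only: same_config_def sem.simps(7) \<sigma>1_def)
  moreover have "var \<sigma>1 xV = nv" using assms by (simp add: \<sigma>1_def)
  ultimately show ?thesis by (auto simp: cfv_def)
qed

lemma choose_rep_correct:
  assumes "var \<sigma> xN = n" "q < n" "0 < arr \<sigma> aRS (var \<sigma> xI) q"
  shows "var (sem choose_rep \<sigma>) xR < n" "0 < arr \<sigma> aRS (var \<sigma> xI) (var (sem choose_rep \<sigma>) xR)"
proof -
  let ?b = "IfLess (N 0) (Arr aRS (V xI) (V xQ)) (Assign xR (V xQ)) Skip"
  let ?P = "\<lambda>q. q < n \<and> 0 < arr \<sigma> aRS (var \<sigma> xI) q"
  define \<sigma>1 where "\<sigma>1 = sem (Assign xR (N 0)) \<sigma>"
  have "(\<exists>q<var \<sigma>1 xN. ?P q) \<longrightarrow> ?P (var (sem (For xQ xN ?b) \<sigma>1) xR)"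
  proof (rule for_frame_rule[where I = "\<lambda>k \<tau>. (\<exists>q<k. ?P q) \<longrightarrow> ?P (var \<tau> xR)"])
    fix k and \<tau> :: state
    assume I: "(\<exists>q<k. ?P q) \<longrightarrow> ?P (var \<tau> xR)" and k: "k < var \<sigma>1 xN" "var \<tau> xQ = k"
      and fv: "\<And>z. z \<notin> insert xQ (mods ?b) \<Longrightarrow> var \<tau> z = var \<sigma>1 z"
      and fa: "\<And>j. j \<notin> amods ?b \<Longrightarrow> arr \<tau> j = arr \<sigma>1 j"
    have eq: "var \<tau> xI = var \<sigma> xI" "arr \<tau> aRS = arr \<sigma> aRS"
      using fv[of xI] fa[of aRS] by (simp_all add: \<sigma>1_def)
    have "k < n" using k assms by (simp add: \<sigma>1_def)
    then show "(\<exists>q<Suc k. ?P q) \<longrightarrow> ?P (var (bump xQ (sem ?b \<tau>)) xR)"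
      using I k eq by (auto simp: less_Suc_eq)
  qed auto
  moreover have "sem choose_rep \<sigma> = sem (For xQ xN ?b) \<sigma>1"
    by (simp only: choose_rep_def sem.simps(7) \<sigma>1_def)
  moreover have "var \<sigma>1 xN = n" using assms by (simp add: \<sigma>1_def)
  ultimately show "var (sem choose_rep \<sigma>) xR < n" "0 < arr \<sigma> aRS (var \<sigma> xI) (var (sem choose_rep \<sigma>) xR)"
    using assms(2,3) by auto
qed

context graph
begin

lemma basic_sem:
  assumes "\<forall>x\<in>mods c. 7 < x" "\<forall>j\<in>amods c. 4 < j \<and> j \<noteq> aMV"
  shows "basic (sem c \<sigma>) = basic \<sigma>"
  using assms by (intro basic_cong var_sem arr_sem inp_sem) force+

lemma seed:
  assumes "basic \<sigma>" "var \<sigma> x < n" "x \<notin> {xQ, xCnt}"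
  shows "queue (sem (push x) (sem clear \<sigma>)) = [var \<sigma> x]"
    "marked n (sem (push x) (sem clear \<sigma>)) = {var \<sigma> x}"
    "queue_ok n (sem (push x) (sem clear \<sigma>))"
proof -
  have n: "var \<sigma> xN = n" using assms by (simp add: basic_def)
  note c = clear_correct[OF n]
  have v: "var (sem clear \<sigma>) x = var \<sigma> x" "var (sem clear \<sigma>) 0 = var \<sigma> 0" using assms(3) by (simp_all add: var_sem)
  have "var (sem clear \<sigma>) xCnt = 0" using c(2) length_queue[of "sem clear \<sigma>"] by simp
  then have "var (sem clear \<sigma>) xCnt < var (sem clear \<sigma>) 0" using assms v by (simp add: basic_def)
  then show *: "queue (sem (push x) (sem clear \<sigma>)) = [var \<sigma> x]"
    "marked n (sem (push x) (sem clear \<sigma>)) = {var \<sigma> x}"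
    using push_correct[of "sem clear \<sigma>" x n] c v assms by auto
  show "queue_ok n (sem (push x) (sem clear \<sigma>))" unfolding queue_ok_def * by simp
qed

lemma closure_aVB:
  assumes b: "basic \<sigma>" and ok: "queue_ok n \<sigma>" and s: "marked n \<sigma> \<subseteq> XB"
  shows "queue_ok n (sem (closure aVB) \<sigma>)"
    "marked n (sem (closure aVB) \<sigma>) = {q. \<exists>p\<in>marked n \<sigma>. ve\<^sup>*\<^sup>* q p}"
proof -
  have R: "ve\<inverse>\<inverse> p q \<longleftrightarrow> 0 < arr \<sigma> aVB p q" for p q
    using b by (simp add: basic_def loaded_def ve_def)
  have v: "var \<sigma> xN = n" "card XB \<le> var \<sigma> xPb" "var \<sigma> xPb \<le> var \<sigma> 0"
    using b XB by (auto simp: basic_def)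
  have sX: "set (queue \<sigma>) \<subseteq> XB" using ok s by (simp add: queue_ok_def)
  note C = closure_correct[where R = "ve\<inverse>\<inverse>" and j = aVB, OF v(1) ok _ R _ XB(1) v(2,3) sX]
  show "queue_ok n (sem (closure aVB) \<sigma>)"
    using C(1) XB bounds by (simp add: search_inv_def)
  show "marked n (sem (closure aVB) \<sigma>) = {q. \<exists>p\<in>marked n \<sigma>. ve\<^sup>*\<^sup>* q p}"
    using C(2) XB bounds by (simp add: rtranclp_conversep)
qed

lemma closure_aVF:
  assumes b: "basic \<sigma>" and ok: "queue_ok n \<sigma>" and s: "marked n \<sigma> \<subseteq> XF"
  shows "marked n (sem (closure aVF) \<sigma>) = {q. \<exists>p\<in>marked n \<sigma>. ve\<^sup>*\<^sup>* p q}"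
proof -
  have R: "ve p q \<longleftrightarrow> 0 < arr \<sigma> aVF p q" for p q
    using b by (simp add: basic_def loaded_def ve_def)
  have v: "var \<sigma> xN = n" "card XF \<le> var \<sigma> xPb" "var \<sigma> xPb \<le> var \<sigma> 0"
    using b XF by (auto simp: basic_def)
  have sX: "set (queue \<sigma>) \<subseteq> XF" using ok s by (simp add: queue_ok_def)
  note C = closure_correct[where R = ve and j = aVF, OF v(1) ok _ R _ XF(1) v(2,3) sX]
  show ?thesis using C(2) XF bounds by simp
qed

lemma closure_aAL:
  assumes b: "basic \<sigma>" and ok: "queue_ok n \<sigma>" and s: "marked n \<sigma> \<subseteq> XF"
  shows "search_inv n al (queue \<sigma>) (sem (closure aAL) \<sigma>)"
    "marked n (sem (closure aAL) \<sigma>) = {q. \<exists>p\<in>marked n \<sigma>. al\<^sup>*\<^sup>* p q}"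
proof -
  have R: "al p q \<longleftrightarrow> 0 < arr \<sigma> aAL p q" for p q
    using b by (simp add: basic_def loaded_def al_def)
  have v: "var \<sigma> xN = n" "card XF \<le> var \<sigma> xPb" "var \<sigma> xPb \<le> var \<sigma> 0"
    using b XF by (auto simp: basic_def)
  have sX: "set (queue \<sigma>) \<subseteq> XF" using ok s by (simp add: queue_ok_def)
  note C = closure_correct[where R = al and j = aAL, OF v(1) ok _ R _ XF(1) v(2,3) sX]
  show "search_inv n al (queue \<sigma>) (sem (closure aAL) \<sigma>)"
    "marked n (sem (closure aAL) \<sigma>) = {q. \<exists>p\<in>marked n \<sigma>. al\<^sup>*\<^sup>* p q}"
    using C XF bounds by simp_all
qed

lemma XB_bound: "q \<in> XB \<Longrightarrow> q < n"
  using fin T_bounds by (auto simp: XB_def)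

lemma good_XB: "good t q \<Longrightarrow> q \<in> XB"
  using XB by (auto simp: good_def)

lemma back_step_correct:
  assumes b: "basic \<tau>" and k: "k < l" "var \<tau> xK = k" and m: "marked n \<tau> = {q. acc k q}"
    and z: "\<And>q. arr \<tau> aBB (l - Suc k) q = 0"
  defines "\<rho> \<equiv> sem (back_step S) \<tau>"
  shows "basic \<rho>" "queue_ok n \<rho>" "marked n \<rho> = {q. acc (Suc k) q}"
    "q < n \<Longrightarrow> 0 < arr \<rho> aBB (l - Suc k) q \<longleftrightarrow> good (l - Suc k) q"
    "t \<noteq> l - Suc k \<Longrightarrow> arr \<rho> aBB t = arr \<tau> aBB t"
proof -
  let ?t = "l - Suc k"
  define \<tau>1 where "\<tau>1 = sem (Assign xT (Minus (Minus (V xL) (N 1)) (V xK)) ;; Read xA (sym_addr xT)) \<tau>"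
  define \<tau>2 where "\<tau>2 = sem (ending_states S) \<tau>1"
  define \<tau>3 where "\<tau>3 = sem clear \<tau>2"
  define \<tau>4 where "\<tau>4 = sem mark_ending \<tau>3"
  have \<rho>: "\<rho> = sem (closure aVB) \<tau>4"
    by (simp only: \<rho>_def back_step_def sem.simps(7) \<tau>1_def \<tau>2_def \<tau>3_def \<tau>4_def)
  have tl: "?t < l" using k by simp
  have "basic \<tau>1" unfolding \<tau>1_def by (subst basic_sem) (use b in auto)
  then have bs: "basic \<tau>1" "basic \<tau>2" "basic \<tau>3" "basic \<tau>4" "basic \<rho>"
    unfolding \<rho> \<tau>4_def \<tau>3_def \<tau>2_def by (simp_all add: basic_sem)
  have t1: "var \<tau>1 xT = ?t" "arr \<tau>1 = arr \<tau>" "marked n \<tau>1 = marked n \<tau>"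
    using b k by (simp_all add: \<tau>1_def basic_def marked_def)
  have "var \<tau>1 xA = inp \<tau> (6 + 4 * m + ?t)"
    using b k by (simp add: \<tau>1_def basic_def sym_addr_def)
  then have a: "var \<tau>1 xA = w ?t" using b tl by (simp add: basic_def)
  then have aS: "var \<tau>1 xA < S" using w_bound tl by simp
  have E: "\<And>q. q < n \<Longrightarrow> 0 < arr \<tau>2 aBB ?t q \<longleftrightarrow> good ?t q" "\<And>t. t \<noteq> ?t \<Longrightarrow> arr \<tau>2 aBB t = arr \<tau> aBB t"
    using ending_states_correct[OF bs(1) aS] z k t1 a m
    by (auto simp: \<tau>2_def good_def Suc_diff_Suc)
  have f3: "var \<tau>3 xT = ?t" "arr \<tau>3 aBB = arr \<tau>2 aBB" by (simp_all add: \<tau>3_def \<tau>2_def var_sem arr_sem t1)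
  have "var \<tau>2 xN = n" using bs by (simp add: basic_def)
  note c = clear_correct[OF this, folded \<tau>3_def]
  have Q: "q \<in> XB" if "q < n" "0 < arr \<tau>3 aBB (var \<tau>3 xT) q" for q
    using that f3 E(1) good_XB by auto
  have m4: "queue_ok n \<tau>4" "marked n \<tau>4 = {q. good ?t q}"
    using mark_ending_correct[OF bs(3) c(2,1) Q] f3 E(1) good_XB XB_bound by (auto simp: \<tau>4_def)
  have m5: "queue_ok n \<rho>" "marked n \<rho> = {q. \<exists>p\<in>marked n \<tau>4. ve\<^sup>*\<^sup>* q p}"
    using closure_aVB[OF bs(4) m4(1)] m4(2) good_XB by (auto simp: \<rho>)
  show "basic \<rho>" "queue_ok n \<rho>" by fact+
  have "Suc (l - Suc k) = l - k" using k by simp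
  then have "l - Suc ?t = k" using k by simp
  then show "marked n \<rho> = {q. acc (Suc k) q}"
    unfolding m5(2) m4(2) by (auto simp: good_def)
  have "arr \<rho> aBB = arr \<tau>2 aBB" by (simp add: \<rho> \<tau>4_def f3 arr_sem)
  then show "q < n \<Longrightarrow> 0 < arr \<rho> aBB ?t q \<longleftrightarrow> good ?t q" "t \<noteq> ?t \<Longrightarrow> arr \<rho> aBB t = arr \<tau> aBB t"
    using E by auto
qed

lemma backward_correct:
  assumes b: "basic \<sigma>" and z: "\<And>t q. arr \<sigma> aBB t q = 0"
  defines "\<sigma>' \<equiv> sem (backward S) \<sigma>"
  shows "basic \<sigma>'" "marked n \<sigma>' = {q. acc l q}"
    "t < l \<Longrightarrow> q < n \<Longrightarrow> 0 < arr \<sigma>' aBB t q \<longleftrightarrow> good t q"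
proof -
  define \<sigma>1 where "\<sigma>1 = sem (closure aVB) (sem (push xFin) (sem clear \<sigma>))"
  have \<sigma>': "\<sigma>' = sem (For xK xL (back_step S)) \<sigma>1"
    by (simp only: \<sigma>'_def backward_def sem.simps(7) \<sigma>1_def)
  have fv: "var \<sigma> xFin = fin" using b by (simp add: basic_def)
  then have s: "queue_ok n (sem (push xFin) (sem clear \<sigma>))" "marked n (sem (push xFin) (sem clear \<sigma>)) = {fin}"
    using seed[OF b, of xFin] fin by simp_all
  have bp: "basic (sem (push xFin) (sem clear \<sigma>))" using b by (simp add: basic_sem)
  have m1: "marked n \<sigma>1 = {q. acc 0 q}"
    using closure_aVB[OF bp s(1)] s(2) XB(3) by (simp add: \<sigma>1_def)
  have b1: "basic \<sigma>1" using bp by (simp add: \<sigma>1_def basic_sem)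
  have z1: "arr \<sigma>1 aBB t q = 0" for t q using z by (simp add: \<sigma>1_def arr_sem)
  have "basic \<sigma>' \<and> marked n \<sigma>' = {q. acc (var \<sigma>1 xL) q} \<and>
    (\<forall>t q. t < l - var \<sigma>1 xL \<longrightarrow> arr \<sigma>' aBB t q = 0) \<and>
    (\<forall>t q. l - var \<sigma>1 xL \<le> t \<longrightarrow> t < l \<longrightarrow> q < n \<longrightarrow> (0 < arr \<sigma>' aBB t q \<longleftrightarrow> good t q))"
    unfolding \<sigma>'
  \<comment> \<open>After \<open>k\<close> rounds the last \<open>k\<close> rows of
    \<open>aBB\<close> are final and the earlier ones are still zero.\<close>
  proof (rule for_frame_rule[where I = "\<lambda>k \<tau>. basic \<tau> \<and> marked n \<tau> = {q. acc k q} \<and>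
    (\<forall>t q. t < l - k \<longrightarrow> arr \<tau> aBB t q = 0) \<and>
    (\<forall>t q. l - k \<le> t \<longrightarrow> t < l \<longrightarrow> q < n \<longrightarrow> (0 < arr \<tau> aBB t q \<longleftrightarrow> good t q))"])
    have "basic (set_var xK 0 \<sigma>1)" using b1 basic_sem[of "Assign xK (N 0)" \<sigma>1] by simp
    moreover have "marked n (set_var xK 0 \<sigma>1) = {q. acc 0 q}" using m1 by (simp add: marked_def)
    ultimately show "basic (set_var xK 0 \<sigma>1) \<and> marked n (set_var xK 0 \<sigma>1) = {q. acc 0 q} \<and>
      (\<forall>t q. t < l - 0 \<longrightarrow> arr (set_var xK 0 \<sigma>1) aBB t q = 0) \<and>
      (\<forall>t q. l - 0 \<le> t \<longrightarrow> t < l \<longrightarrow> q < n \<longrightarrow> (0 < arr (set_var xK 0 \<sigma>1) aBB t q \<longleftrightarrow> good t q))"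
      using z1 by simp
  next
    fix k and \<tau> :: state
    assume I: "basic \<tau> \<and> marked n \<tau> = {q. acc k q} \<and>
      (\<forall>t q. t < l - k \<longrightarrow> arr \<tau> aBB t q = 0) \<and>
      (\<forall>t q. l - k \<le> t \<longrightarrow> t < l \<longrightarrow> q < n \<longrightarrow> (0 < arr \<tau> aBB t q \<longleftrightarrow> good t q))"
      and k: "k < var \<sigma>1 xL" "var \<tau> xK = k"
    have kl: "k < l" using k b1 by (simp add: basic_def)
    have z: "arr \<tau> aBB (l - Suc k) q = 0" for q using I kl by auto
    note B = back_step_correct[OF conjunct1[OF I] kl k(2) _ z]
    have m: "marked n \<tau> = {q. acc k q}" using I by blast
    let ?\<rho> = "sem (back_step S) \<tau>"
    have "basic (bump xK ?\<rho>)" using B(1)[OF m] basic_cong[of "bump xK ?\<rho>" ?\<rho>] by simp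
    moreover have "marked n (bump xK ?\<rho>) = {q. acc (Suc k) q}" using B(3)[OF m] by simp
    moreover have "arr ?\<rho> aBB t q = 0" if "t < l - Suc k" for t q
      using B(5)[OF m, of t] I that by simp
    moreover have "0 < arr ?\<rho> aBB t q \<longleftrightarrow> good t q" if "l - Suc k \<le> t" "t < l" "q < n" for t q
    proof (cases "t = l - Suc k")
      case True
      then show ?thesis using B(4)[OF m that(3)] by simp
    next
      case False
      then have "l - k \<le> t" using that by simp
      then show ?thesis using B(5)[OF m False] I that by simp
    qed
    ultimately show "basic (bump xK ?\<rho>) \<and> marked n (bump xK ?\<rho>) = {q. acc (Suc k) q} \<and>
      (\<forall>t q. t < l - Suc k \<longrightarrow> arr (bump xK ?\<rho>) aBB t q = 0) \<and>
      (\<forall>t q. l - Suc k \<le> t \<longrightarrow> t < l \<longrightarrow> q < n \<longrightarrow> (0 < arr (bump xK ?\<rho>) aBB t q \<longleftrightarrow> good t q))"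
      unfolding arr_bump by blast
  qed simp_all
  moreover have "var \<sigma>1 xL = l" using b1 by (simp add: basic_def)
  ultimately show "basic \<sigma>'" "marked n \<sigma>' = {q. acc l q}"
    "t < l \<Longrightarrow> q < n \<Longrightarrow> 0 < arr \<sigma>' aBB t q \<longleftrightarrow> good t q" by auto
qed

text \<open>A state can have several configurations in this relation. The table receives one of
  them, and uniqueness is shown later for states from which the final state can be reached.\<close>

inductive conf_reach :: "nat \<Rightarrow> (nat \<Rightarrow> nat) \<Rightarrow> bool" where
  start: "conf_reach ini (\<lambda>_. 0)"
| step: "conf_reach p c \<Longrightarrow> (p, e, a, q) \<in> T \<Longrightarrow> conf_reach q (upd e a c)"

text \<open>Rows are computed in the order of the worklist, so the row of a parent is final when it
  is copied.\<close>

lemma configs_correct: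
  assumes b: "basic \<sigma>" and z: "\<And>q y. arr \<sigma> aCF q y = 0"
  shows "al\<^sup>*\<^sup>* ini q \<Longrightarrow> \<exists>c. conf_reach q c \<and> (\<forall>y<nv. arr (sem configs \<sigma>) aCF q y = c y)"
proof -
  define \<sigma>0 where "\<sigma>0 = sem (push xIni) (sem clear \<sigma>)"
  define \<sigma>1 where "\<sigma>1 = sem (closure aAL) \<sigma>0"
  let ?b = "IfLess (N 0) (V xH) (IfLess (V xH) (V xCnt) config_step Skip) Skip"
  have s: "sem configs \<sigma> = sem (For xH xPb ?b) \<sigma>1"
    by (simp only: configs_def sem.simps(7) \<sigma>1_def \<sigma>0_def)
  have "var \<sigma> xIni = ini" using b by (simp add: basic_def)
  then have s0: "queue_ok n \<sigma>0" "marked n \<sigma>0 = {ini}" "queue \<sigma>0 = [ini]"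
    using seed[OF b, of xIni] ini by (simp_all add: \<sigma>0_def)
  have b0: "basic \<sigma>0" using b by (simp add: \<sigma>0_def basic_sem)
  then have b1: "basic \<sigma>1" by (simp add: \<sigma>1_def basic_sem)
  have C: "search_inv n al [ini] \<sigma>1" "marked n \<sigma>1 = {q. al\<^sup>*\<^sup>* ini q}"
    using closure_aAL[OF b0 s0(1)] s0 XF(3) by (simp_all add: \<sigma>1_def)
  have z1: "arr \<sigma>1 aCF q y = 0" for q y using z by (simp add: \<sigma>1_def \<sigma>0_def arr_sem)
  define L where "L = queue \<sigma>1"
  have L: "distinct L" "set L = {q. al\<^sup>*\<^sup>* ini q}" "L ! 0 = ini"
    and par: "\<And>h. 1 \<le> h \<Longrightarrow> h < length L \<Longrightarrow> \<exists>h'<h. arr \<sigma>1 aPA 0 (L ! h) = L ! h' \<and> al (L ! h') (L ! h)"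
    using C by (auto simp: search_inv_def queue_ok_def L_def)
  have lenL: "length L = var \<sigma>1 xCnt" by (simp add: L_def)
  have "set L \<subseteq> XF" using L(2) XF(3,4) by (auto elim: rtranclp.cases)
  \<comment> \<open>The loop has \<open>pb\<close> rounds, so every entry of the worklist gets its
    turn.\<close>
  then have lenX: "length L \<le> pb" using L(1) XF(1,2) by (metis card_mono distinct_card le_trans)
  let ?ok = "\<lambda>\<tau> q. \<exists>c. conf_reach q c \<and> (\<forall>y<nv. arr \<tau> aCF q y = c y)"
  have "\<forall>i<length L. i < max 1 (var \<sigma>1 xPb) \<longrightarrow> ?ok (sem (For xH xPb ?b) \<sigma>1) (L ! i)"
  \<comment> \<open>The maximum with 1 accounts for the root, whose row is correct before the first
    round.\<close>
  proof (rule for_frame_rule[where I = "\<lambda>k \<tau>. \<forall>i<length L. i < max 1 k \<longrightarrow> ?ok \<tau> (L ! i)"])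
    show "\<forall>i<length L. i < max 1 0 \<longrightarrow> ?ok (set_var xH 0 \<sigma>1) (L ! i)"
      using conf_reach.start L(3) z1 by force
  next
    fix k and \<tau> :: state
    assume I: "\<forall>i<length L. i < max 1 k \<longrightarrow> ?ok \<tau> (L ! i)" and k: "k < var \<sigma>1 xPb" "var \<tau> xH = k"
      and fv: "\<And>z. z \<notin> insert xH (mods ?b) \<Longrightarrow> var \<tau> z = var \<sigma>1 z"
      and fa: "\<And>j. j \<notin> amods ?b \<Longrightarrow> arr \<tau> j = arr \<sigma>1 j"
    have eq: "var \<tau> xCnt = length L" "var \<tau> xV = nv" "arr \<tau> aQU = arr \<sigma>1 aQU" "arr \<tau> aPA = arr \<sigma>1 aPA"
      "arr \<tau> aKN = arr \<sigma>1 aKN" "arr \<tau> aVR = arr \<sigma>1 aVR"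
      using fv[of xCnt] fv[of xV] fa b1 lenL by (simp_all add: basic_def)
    show "\<forall>i<length L. i < max 1 (Suc k) \<longrightarrow> ?ok (bump xH (sem ?b \<tau>)) (L ! i)"
    proof (cases "0 < k \<and> k < length L")
      case False
      then have "sem ?b \<tau> = \<tau>" using k eq by auto
      then show ?thesis using I False by (auto simp: less_Suc_eq)
    next
      case True
      then have s: "sem ?b \<tau> = sem config_step \<tau>" using k eq by simp
      define q where "q = L ! k"
      obtain h' where h': "h' < k" "arr \<sigma>1 aPA 0 q = L ! h'" "al (L ! h') q"
        using par[of k] True unfolding q_def by auto
      have q: "q = arr \<tau> aQU 0 (var \<tau> xH)" using k eq True lenL by (simp add: q_def L_def queue_def)
      have p: "L ! h' = arr \<tau> aPA 0 q" using eq h' by simp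
      have "L ! h' \<noteq> q" using h' True L(1) by (simp add: q_def nth_eq_iff_index_eq)
      note S = config_step_correct[OF eq(2) q p this]
      obtain c where c: "conf_reach (L ! h') c" "\<forall>y<nv. arr \<tau> aCF (L ! h') y = c y"
        using I h' True by (metis less_max_iff_disj less_trans)
      have "0 < arr \<sigma>1 aAL (L ! h') q" using h'(3) b1 by (simp add: basic_def loaded_def al_def)
      then have "(L ! h', arr \<tau> aKN (L ! h') q, arr \<tau> aVR (L ! h') q, q) \<in> T"
        using b1 eq by (simp add: basic_def loaded_def)
      then have cr: "conf_reach q (upd (arr \<tau> aKN (L ! h') q) (arr \<tau> aVR (L ! h') q) c)"
        by (rule conf_reach.step[OF c(1)])
      have new: "?ok (sem config_step \<tau>) q"
        using cr S(2) c(2)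
        by (intro exI[of _ "upd (arr \<tau> aKN (L ! h') q) (arr \<tau> aVR (L ! h') q) c"]) (auto simp: upd.simps)
      have old: "?ok (sem config_step \<tau>) (L ! i)" if "i < k" for i
      proof -
        have "L ! i \<noteq> q" using that True L(1) by (simp add: q_def nth_eq_iff_index_eq)
        then show ?thesis using S(1) I that True by simp
      qed
      show ?thesis unfolding s arr_bump using new old True by (auto simp: less_Suc_eq q_def)
    qed
  qed auto
  then have F: "i < length L \<Longrightarrow> ?ok (sem configs \<sigma>) (L ! i)" for i
    unfolding s using b1 lenX by (simp add: basic_def)
  assume "al\<^sup>*\<^sup>* ini q"
  then obtain i where "i < length L" "L ! i = q" using L(2) by (metis in_set_conv_nth mem_Collect_eq)
  then show "?ok (sem configs \<sigma>) q" using F by blast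
qed

end

section \<open>The levels of the depth-first search\<close>

definition rest :: "nat \<Rightarrow> nat \<Rightarrow> state \<Rightarrow> nat set" where
  "rest n j \<sigma> = {q. q < n \<and> 0 < arr \<sigma> aRS j q}"

context graph
begin

lemma successors_correct:
  assumes b: "basic \<sigma>" and a: "var \<sigma> xA < S" and ok: "queue_ok n \<sigma>" and sub: "marked n \<sigma> \<subseteq> XF"
  shows "queue_ok n (sem (successors S) \<sigma>)"
    "marked n (sem (successors S) \<sigma>) = marked n \<sigma> \<union> {p. mv (var \<sigma> xA) (var \<sigma> xQ) p}"
proof -
  let ?a = "var \<sigma> xA" and ?q = "var \<sigma> xQ"
  let ?b = "IfLess (N 0) (Arr aMV (V xQ) (sym_code S xP))
     (IfLess (Arr aMK (N 0) (V xP)) (N 1) (push xP) Skip) Skip"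
  have "queue_ok n (sem (successors S) \<sigma>) \<and>
    marked n (sem (successors S) \<sigma>) = marked n \<sigma> \<union> {p. p < var \<sigma> xN \<and> mv ?a ?q p}"
    unfolding successors_def
  proof (rule for_frame_rule[where I = "\<lambda>k \<tau>. queue_ok n \<tau> \<and> marked n \<tau> = marked n \<sigma> \<union> {p. p < k \<and> mv ?a ?q p}"])
    show "queue_ok n (set_var xP 0 \<sigma>) \<and>
      marked n (set_var xP 0 \<sigma>) = marked n \<sigma> \<union> {p. p < 0 \<and> mv ?a ?q p}"
      using ok by (simp add: queue_ok_def queue_def marked_def)
  next
    fix k and \<tau> :: state
    assume I: "queue_ok n \<tau> \<and> marked n \<tau> = marked n \<sigma> \<union> {p. p < k \<and> mv ?a ?q p}"
      and k: "k < var \<sigma> xN" "var \<tau> xP = k"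
      and fv: "\<And>z. z \<notin> insert xP (mods ?b) \<Longrightarrow> var \<tau> z = var \<sigma> z"
      and fa: "\<And>j. j \<notin> amods ?b \<Longrightarrow> arr \<tau> j = arr \<sigma> j"
    have kn: "k < n" using k b by (simp add: basic_def)
    have eq: "var \<tau> xA = ?a" "var \<tau> xQ = ?q" "var \<tau> 0 = var \<sigma> 0" "arr \<tau> aMV = arr \<sigma> aMV"
      using fv[of xA] fv[of xQ] fv[of 0] fa[of aMV] by simp_all
    have e: "0 < eval (Arr aMV (V xQ) (sym_code S xP)) \<tau> \<longleftrightarrow> mv ?a ?q k"
      using mv_table[OF b a] k eq by (simp add: sym_code_def)
    have subX: "marked n \<tau> \<subseteq> XF" using I sub XF(6) by auto
    have "queue_ok n (sem ?b \<tau>) \<and> marked n (sem ?b \<tau>) = marked n \<sigma> \<union> {p. p < Suc k \<and> mv ?a ?q p}"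
    proof (cases "mv ?a ?q k")
      case False
      then have "sem ?b \<tau> = \<tau>" using e by simp
      moreover have "{p. p < Suc k \<and> mv ?a ?q p} = {p. p < k \<and> mv ?a ?q p}"
        using False by (auto simp: less_Suc_eq)
      ultimately show ?thesis using I by simp
    next
      case True
      have S: "{p. p < Suc k \<and> mv ?a ?q p} = insert k {p. p < k \<and> mv ?a ?q p}"
        using True by (auto simp: less_Suc_eq)
      show ?thesis
      proof (cases "arr \<tau> aMK 0 k = 0")
        case un: True
        then have nm: "k \<notin> marked n \<tau>" by (simp add: marked_def)
        have "var \<tau> xCnt < card XF" using count_less[OF _ subX XF(1) XF(6)[OF True] nm] I by simp
        then have "var \<tau> xCnt < var \<tau> 0" using XF(2) b eq by (simp add: basic_def)
        then have "queue_ok n (sem (push xP) \<tau>)" "marked n (sem (push xP) \<tau>) = insert k (marked n \<tau>)"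
          using push_queue_ok[of n \<tau> xP] push_correct[of \<tau> xP n] I k kn un by auto
        moreover have "sem ?b \<tau> = sem (push xP) \<tau>" using True e un k by simp
        ultimately show ?thesis unfolding S using I by simp
      next
        case un: False
        then have "k \<in> marked n \<tau>" using kn by (simp add: marked_def)
        moreover have "sem ?b \<tau> = \<tau>" using un k by simp
        ultimately show ?thesis unfolding S using I by auto
      qed
    qed
    then show "queue_ok n (bump xP (sem ?b \<tau>)) \<and>
      marked n (bump xP (sem ?b \<tau>)) = marked n \<sigma> \<union> {p. p < Suc k \<and> mv ?a ?q p}"
      unfolding queue_ok_bump queue_bump(2) .
  qed simp_all
  moreover have "var \<sigma> xN = n" using b by (simp add: basic_def)
  ultimately show "queue_ok n (sem (successors S) \<sigma>)"
    "marked n (sem (successors S) \<sigma>) = marked n \<sigma> \<union> {p. mv ?a ?q p}"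
    using bounds by auto
qed

lemma expand_correct:
  fixes \<sigma> :: state
  assumes b: "basic \<sigma>" and a: "var \<sigma> xA < S" and q: "queue \<sigma> = []" "marked n \<sigma> = {}"
  defines "i \<equiv> var \<sigma> xI"
  defines "C \<equiv> {q \<in> rest n i \<sigma>. cfv nv (arr \<sigma> aCF) q = cfv nv (arr \<sigma> aCF) (var \<sigma> xR)}"
  shows "queue_ok n (sem (expand S) \<sigma>)"
    "marked n (sem (expand S) \<sigma>) = {p. \<exists>q\<in>C. mv (var \<sigma> xA) q p}"
    "rest n i (sem (expand S) \<sigma>) = rest n i \<sigma> - C"
    "j \<noteq> i \<Longrightarrow> arr (sem (expand S) \<sigma>) aRS j = arr \<sigma> aRS j"
proof -
  let ?a = "var \<sigma> xA"
  let ?c = "Write aRS (V xI) (V xQ) (N 0) ;; successors S"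
  let ?b = "IfLess (N 0) (Arr aRS (V xI) (V xQ)) (same_config ;; IfLess (N 0) (V xF) ?c Skip) Skip"
  let ?I = "\<lambda>k \<tau>. queue_ok n \<tau> \<and> marked n \<tau> = {p. \<exists>q\<in>C. q < k \<and> mv ?a q p} \<and>
    (\<forall>q<n. 0 < arr \<tau> aRS i q \<longleftrightarrow> q \<in> rest n i \<sigma> \<and> \<not> (q < k \<and> q \<in> C)) \<and>
    (\<forall>j. j \<noteq> i \<longrightarrow> arr \<tau> aRS j = arr \<sigma> aRS j)"
  have "?I (var \<sigma> xN) (sem (expand S) \<sigma>)"
    unfolding expand_def
  proof (rule for_frame_rule[where I = ?I])
    show "?I 0 (set_var xQ 0 \<sigma>)"
      using q by (simp add: queue_ok_def queue_def marked_def rest_def)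
  next
    fix k and \<tau> :: state
    assume I: "?I k \<tau>" and k: "k < var \<sigma> xN" "var \<tau> xQ = k"
      and fv: "\<And>z. z \<notin> insert xQ (mods ?b) \<Longrightarrow> var \<tau> z = var \<sigma> z"
      and fa: "\<And>j. j \<notin> amods ?b \<Longrightarrow> arr \<tau> j = arr \<sigma> j"
      and fi: "inp \<tau> = inp \<sigma>"
    have kn: "k < n" using k b by (simp add: basic_def)
    have eq: "var \<tau> xA = ?a" "var \<tau> xI = i" "var \<tau> xR = var \<sigma> xR" "arr \<tau> aCF = arr \<sigma> aCF"
      using fv[of xA] fv[of xI] fv[of xR] fa[of aCF] by (simp_all add: i_def)
    have "basic \<tau> = basic \<sigma>"
      by (intro basic_cong fv fa fi) auto
    then have b\<tau>: "basic \<tau>" using b by simp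
    have rk: "0 < arr \<tau> aRS i k \<longleftrightarrow> k \<in> rest n i \<sigma>" using I kn by simp
    have "?I (Suc k) (sem ?b \<tau>)"
    proof (cases "k \<in> C")
      case False
      have "arr (sem ?b \<tau>) = arr \<tau> \<and> var (sem ?b \<tau>) xCnt = var \<tau> xCnt"
      proof (cases "k \<in> rest n i \<sigma>")
        case True
        define \<tau>1 where "\<tau>1 = sem same_config \<tau>"
        have "var \<tau> xV = nv" using b\<tau> by (simp add: basic_def)
        then have "\<not> 0 < var \<tau>1 xF"
          using same_config_correct[of \<tau> nv] True False k eq by (simp add: \<tau>1_def C_def)
        then have "sem ?b \<tau> = \<tau>1" using True rk eq k by (simp add: \<tau>1_def)
        then show ?thesis by (auto simp: \<tau>1_def var_sem arr_sem fun_eq_iff)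
      next
        case False
        then have "sem ?b \<tau> = \<tau>" using rk eq k by simp
        then show ?thesis by simp
      qed
      then have s: "queue (sem ?b \<tau>) = queue \<tau>" "marked n (sem ?b \<tau>) = marked n \<tau>" "arr (sem ?b \<tau>) aRS = arr \<tau> aRS"
        by (simp_all add: queue_def marked_def)
      have "{p. \<exists>q\<in>C. q < Suc k \<and> mv ?a q p} = {p. \<exists>q\<in>C. q < k \<and> mv ?a q p}"
        using False by (auto simp: less_Suc_eq)
      moreover have "\<And>q. (q < Suc k \<and> q \<in> C) = (q < k \<and> q \<in> C)" using False by (auto simp: less_Suc_eq)
      ultimately show ?thesis using I unfolding queue_ok_def s by simp
    next
      case True
      then have kr: "k \<in> rest n i \<sigma>" by (simp add: C_def)
      define \<tau>1 where "\<tau>1 = sem same_config \<tau>"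
      define \<tau>2 where "\<tau>2 = sem (Write aRS (V xI) (V xQ) (N 0)) \<tau>1"
      have "var \<tau> xV = nv" using b\<tau> by (simp add: basic_def)
      then have "0 < var \<tau>1 xF"
        using same_config_correct[of \<tau> nv] True k eq by (simp add: \<tau>1_def C_def)
      then have s: "sem ?b \<tau> = sem (successors S) \<tau>2" using kr rk eq k by (simp add: \<tau>1_def \<tau>2_def)
      have v: "var \<tau>2 xA = ?a" "var \<tau>2 xQ = k" "var \<tau>1 xI = i" "arr \<tau>1 = arr \<tau>" "var \<tau>1 xQ = k"
        "var \<tau>2 xCnt = var \<tau> xCnt"
        using eq k by (auto simp: \<tau>2_def \<tau>1_def var_sem arr_sem fun_eq_iff)
      have q2: "queue \<tau>2 = queue \<tau>" "marked n \<tau>2 = marked n \<tau>" using v by (simp_all add: queue_def marked_def \<tau>2_def)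
      have b2: "basic \<tau>2" unfolding \<tau>2_def \<tau>1_def by (subst basic_sem; simp add: basic_sem b\<tau>)
      have "queue_ok n \<tau>2" using I q2 by (simp add: queue_ok_def)
      moreover have "marked n \<tau>2 \<subseteq> XF" unfolding q2 using I XF(6) by auto
      ultimately have S: "queue_ok n (sem ?b \<tau>)" "marked n (sem ?b \<tau>) = marked n \<tau> \<union> {p. mv ?a k p}"
        using successors_correct[OF b2, unfolded v, OF a] q2 s by simp_all
      have RS: "arr (sem ?b \<tau>) aRS = (arr \<tau> aRS)(i := (arr \<tau> aRS i)(k := 0))"
        unfolding s by (simp add: arr_sem) (simp add: \<tau>2_def v)
      have M: "marked n (sem ?b \<tau>) = {p. \<exists>q\<in>C. q < Suc k \<and> mv ?a q p}"
        unfolding S(2) using I True by (auto simp: less_Suc_eq)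
      show ?thesis
        unfolding RS using S(1) M I True kr by (auto simp: less_Suc_eq)
    qed
    then show "?I (Suc k) (bump xQ (sem ?b \<tau>))"
      unfolding queue_ok_bump queue_bump(2) arr_bump .
  qed simp_all
  moreover have "var \<sigma> xN = n" using b by (simp add: basic_def)
  moreover have "q < n" if "q \<in> C" for q using that by (simp add: C_def rest_def)
  ultimately show "queue_ok n (sem (expand S) \<sigma>)"
    "marked n (sem (expand S) \<sigma>) = {p. \<exists>q\<in>C. mv ?a q p}"
    "rest n i (sem (expand S) \<sigma>) = rest n i \<sigma> - C"
    "j \<noteq> i \<Longrightarrow> arr (sem (expand S) \<sigma>) aRS j = arr \<sigma> aRS j"
    by (auto simp: rest_def)
qed

text \<open>This is the part of the state that the search relies on and preserves; \<open>cf\<close>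
  is the fixed table of configurations.\<close>

definition ready :: "(nat \<Rightarrow> nat \<Rightarrow> nat) \<Rightarrow> state \<Rightarrow> bool" where
  "ready cf \<sigma> \<longleftrightarrow> basic \<sigma> \<and> arr \<sigma> aCF = cf \<and>
     (\<forall>t q. t < l \<longrightarrow> q < n \<longrightarrow> (0 < arr \<sigma> aBB t q \<longleftrightarrow> good t q))"

lemma ready_cong:
  assumes "\<And>x. x \<le> 7 \<Longrightarrow> var \<sigma> x = var \<tau> x" "\<And>j. j \<le> 4 \<Longrightarrow> arr \<sigma> j = arr \<tau> j"
    "arr \<sigma> aMV = arr \<tau> aMV" "arr \<sigma> aCF = arr \<tau> aCF" "arr \<sigma> aBB = arr \<tau> aBB" "inp \<sigma> = inp \<tau>"
  shows "ready cf \<sigma> = ready cf \<tau>"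
  using basic_cong[of \<sigma> \<tau>] assms by (simp add: ready_def)

lemma ready_sem:
  assumes "\<forall>x\<in>mods c. 7 < x" "\<forall>j\<in>amods c. 4 < j \<and> j \<noteq> aMV \<and> j \<noteq> aCF \<and> j \<noteq> aBB"
  shows "ready cf (sem c \<sigma>) = ready cf \<sigma>"
proof -
  have "arr (sem c \<sigma>) aCF = arr \<sigma> aCF" "arr (sem c \<sigma>) aBB = arr \<sigma> aBB"
    using assms by (auto intro!: arr_sem)
  moreover have "basic (sem c \<sigma>) = basic \<sigma>" using assms by (intro basic_sem) auto
  ultimately show ?thesis by (simp add: ready_def)
qed

lemma good_bound: "good t q \<Longrightarrow> q < n"
  using good_XB XB_bound by blast

text \<open>Taking the whole class \<open>C\<close> of the representative, rather than a single
  state, ensures that different branches of the search produce different words.\<close>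

lemma descend_step_correct:
  fixes \<sigma> :: state
  assumes r: "ready cf \<sigma>" and il: "var \<sigma> xI < l" and ne: "rest n (var \<sigma> xI) \<sigma> \<noteq> {}"
  defines "i \<equiv> var \<sigma> xI" and "\<rho> \<equiv> sem (descend_step S) \<sigma>"
  shows "\<exists>r C. r \<in> rest n i \<sigma> \<and> C = {q \<in> rest n i \<sigma>. cfv nv cf q = cfv nv cf r} \<and> ready cf \<rho> \<and>
    var \<rho> xI = i + 1 \<and> (\<forall>j. arr \<rho> aRP j 0 = (if j = i then r else arr \<sigma> aRP j 0)) \<and>
    rest n i \<rho> = rest n i \<sigma> - C \<and> (\<forall>j<i. rest n j \<rho> = rest n j \<sigma>) \<and>
    (i + 1 < l \<longrightarrow> rest n (i + 1) \<rho> = {q. good (i + 1) q \<and> (\<exists>q0\<in>C. \<exists>p. mv (w i) q0 p \<and> ve\<^sup>*\<^sup>* p q)})"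
proof -
  define \<sigma>1 where "\<sigma>1 = sem choose_rep \<sigma>"
  define \<sigma>2 where "\<sigma>2 = sem (Write aRP (V xI) (N 0) (V xR)) \<sigma>1"
  define \<sigma>3 where "\<sigma>3 = sem clear \<sigma>2"
  define \<sigma>4 where "\<sigma>4 = sem (Read xA (sym_addr xI)) \<sigma>3"
  define \<sigma>5 where "\<sigma>5 = sem (expand S) \<sigma>4"
  define \<sigma>6 where "\<sigma>6 = sem (closure aVF) \<sigma>5"
  define \<sigma>7 where "\<sigma>7 = sem (Inc xI) \<sigma>6"
  have \<rho>: "\<rho> = sem candidates \<sigma>7"
    by (simp only: \<rho>_def descend_step_def sem.simps(7) \<sigma>1_def \<sigma>2_def \<sigma>3_def \<sigma>4_def \<sigma>5_def \<sigma>6_def \<sigma>7_def)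
  have R: "ready cf \<sigma>1" unfolding \<sigma>1_def by (subst ready_sem) (use r in auto)
  then have "ready cf \<sigma>2" unfolding \<sigma>2_def by (subst ready_sem) auto
  then have R3: "ready cf \<sigma>3" unfolding \<sigma>3_def by (subst ready_sem) auto
  then have R4: "ready cf \<sigma>4" unfolding \<sigma>4_def by (subst ready_sem) auto
  then have R5: "ready cf \<sigma>5" unfolding \<sigma>5_def by (subst ready_sem) auto
  then have R6: "ready cf \<sigma>6" unfolding \<sigma>6_def by (subst ready_sem) auto
  then have R7: "ready cf \<sigma>7" unfolding \<sigma>7_def by (subst ready_sem) auto
  then have R8: "ready cf \<rho>" unfolding \<rho> by (subst ready_sem) auto
  have n: "var \<sigma> xN = n" "var \<sigma>2 xN = n" "var \<sigma>7 xN = n"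
    using r \<open>ready cf \<sigma>2\<close> R7 by (auto simp: ready_def basic_def)
  define rp where "rp = var \<sigma>1 xR"
  have rp: "rp \<in> rest n i \<sigma>"
    using choose_rep_correct[OF n(1)] ne by (auto simp: rp_def \<sigma>1_def rest_def i_def)
  have i: "var \<sigma>1 xI = i" "var \<sigma>2 xI = i" "var \<sigma>3 xI = i" "var \<sigma>4 xI = i" "var \<sigma>5 xI = i" "var \<sigma>6 xI = i"
    by (simp_all add: \<sigma>6_def \<sigma>5_def \<sigma>4_def \<sigma>3_def \<sigma>2_def \<sigma>1_def var_sem i_def)
  have xR: "var \<sigma>4 xR = rp" by (simp add: \<sigma>4_def \<sigma>3_def \<sigma>2_def var_sem rp_def)
  have a: "var \<sigma>4 xA = w i"
    using R3 il by (simp add: \<sigma>4_def sym_addr_def i ready_def basic_def i_def)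
  have RS4: "arr \<sigma>4 aRS = arr \<sigma> aRS" by (simp add: \<sigma>4_def \<sigma>3_def \<sigma>2_def \<sigma>1_def arr_sem)
  have CF: "arr \<sigma>4 aCF = cf" using R4 by (simp add: ready_def)
  have "queue \<sigma>4 = queue \<sigma>3" "marked n \<sigma>4 = marked n \<sigma>3" by (simp_all add: \<sigma>4_def queue_def marked_def)
  then have q4: "queue \<sigma>4 = []" "marked n \<sigma>4 = {}" using clear_correct[OF n(2)] by (simp_all add: \<sigma>3_def)
  define C where "C = {q \<in> rest n i \<sigma>. cfv nv cf q = cfv nv cf rp}"
  have C4: "{q \<in> rest n (var \<sigma>4 xI) \<sigma>4. cfv nv (arr \<sigma>4 aCF) q = cfv nv (arr \<sigma>4 aCF) (var \<sigma>4 xR)} = C"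
    by (simp add: i CF xR C_def rest_def RS4)
  have "var \<sigma>4 xA < S" using a w_bound il by (simp add: i_def)
  have b4: "basic \<sigma>4" "basic \<sigma>5" using R4 R5 by (simp_all add: ready_def)
  note E = expand_correct[OF b4(1) \<open>var \<sigma>4 xA < S\<close> q4, unfolded C4, unfolded i a, folded \<sigma>5_def]
  have "marked n \<sigma>5 \<subseteq> XF" using E(2) XF(6) by auto
  then have M6: "marked n \<sigma>6 = {q. \<exists>q0\<in>C. \<exists>p. mv (w i) q0 p \<and> ve\<^sup>*\<^sup>* p q}"
    using closure_aVF[OF b4(2) E(1)] E(2) by (auto simp: \<sigma>6_def)
  have "i < var \<sigma>6 0" using R6 il by (simp add: ready_def basic_def i_def)
  then have s7: "var \<sigma>7 xI = i + 1" "arr \<sigma>7 = arr \<sigma>6" by (simp_all add: \<sigma>7_def i)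
  have "rest n i \<sigma>4 = rest n i \<sigma>" by (simp add: rest_def RS4)
  then have ri: "rest n i \<sigma>5 = rest n i \<sigma> - C" using E(3) by simp
  have RS6: "arr \<sigma>6 aRS = arr \<sigma>5 aRS" by (simp add: \<sigma>6_def arr_sem)
  have cand: "q < n \<Longrightarrow> 0 < arr \<rho> aRS (i + 1) q \<longleftrightarrow> q \<in> marked n \<sigma>6 \<and> 0 < arr \<sigma>6 aBB (i + 1) q"
    "j \<noteq> i + 1 \<Longrightarrow> arr \<rho> aRS j = arr \<sigma>5 aRS j" for q j
    using candidates_correct[OF n(3), folded \<rho>, unfolded s7, of q] candidates_correct(2)[OF n(3), folded \<rho>, unfolded s7, of j]
    by (simp_all add: marked_def s7 RS6)
  have "var \<rho> xI = i + 1" unfolding \<rho> by (simp add: var_sem s7)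
  moreover have "arr \<rho> aRP j 0 = (if j = i then rp else arr \<sigma> aRP j 0)" for j
  proof -
    have "arr \<rho> aRP = arr \<sigma>2 aRP"
      by (simp add: \<rho> \<sigma>7_def \<sigma>6_def \<sigma>5_def \<sigma>4_def \<sigma>3_def arr_sem)
    then show ?thesis using i by (simp add: \<sigma>2_def rp_def) (simp add: \<sigma>1_def arr_sem)
  qed
  moreover have "rest n i \<rho> = rest n i \<sigma> - C" using ri cand(2)[of i] by (simp add: rest_def)
  moreover have "rest n j \<rho> = rest n j \<sigma>" if "j < i" for j
    using that cand(2)[of j] E(4)[of j] RS4 by (simp add: rest_def)
  moreover have "rest n (i + 1) \<rho> = {q. good (i + 1) q \<and> (\<exists>q0\<in>C. \<exists>p. mv (w i) q0 p \<and> ve\<^sup>*\<^sup>* p q)}" if "i + 1 < l"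
  proof -
    have g: "q < n \<Longrightarrow> 0 < arr \<sigma>6 aBB (i + 1) q \<longleftrightarrow> good (i + 1) q" for q
      using R6 that by (simp add: ready_def)
    have "q \<in> rest n (i + 1) \<rho> \<longleftrightarrow> q < n \<and> q \<in> marked n \<sigma>6 \<and> good (i + 1) q" for q
      using cand(1)[of q] g[of q] by (auto simp: rest_def)
    then show ?thesis unfolding M6 using good_bound by blast
  qed
  ultimately show ?thesis using rp C_def R8 by blast
qed

text \<open>
  The list \<open>us\<close> consists of the configurations immediately before the symbols are read, on a run
  from \<open>p\<close> that accepts the string from position \<open>t\<close> on.
\<close>

primrec trc :: "(nat \<Rightarrow> nat \<Rightarrow> nat) \<Rightarrow> nat \<Rightarrow> nat \<Rightarrow> nat list list \<Rightarrow> bool" where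
  "trc cf t p [] \<longleftrightarrow> t = l \<and> ve\<^sup>*\<^sup>* p fin"
| "trc cf t p (u # us) \<longleftrightarrow> t < l \<and>
     (\<exists>q p'. ve\<^sup>*\<^sup>* p q \<and> cfv nv cf q = u \<and> mv (w t) q p' \<and> trc cf (Suc t) p' us)"

text \<open>Unlike in \<open>trc\<close>, the next symbol is read at \<open>q\<close> itself. The
  entries of \<open>aBB\<close> and \<open>aRS\<close> are states of this kind.\<close>

definition trq :: "(nat \<Rightarrow> nat \<Rightarrow> nat) \<Rightarrow> nat \<Rightarrow> nat \<Rightarrow> nat list list \<Rightarrow> bool" where
  "trq cf t q us \<longleftrightarrow> t < l \<and> (\<exists>us' p'. us = cfv nv cf q # us' \<and> mv (w t) q p' \<and> trc cf (Suc t) p' us')"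

lemma trc_trq: "t < l \<Longrightarrow> trc cf t p us \<longleftrightarrow> (\<exists>q. ve\<^sup>*\<^sup>* p q \<and> trq cf t q us)"
  by (cases us) (auto simp: trq_def)

lemma length_trc: "trc cf t p us \<Longrightarrow> length us = l - t"
proof (induction us arbitrary: t p)
  case (Cons u us)
  then obtain p' where "t < l" "trc cf (Suc t) p' us" by auto
  then show ?case using Cons.IH[of "Suc t" p'] by simp
qed simp

text \<open>Acceptance does not refer to configurations: any table \<open>cf\<close> labels an
  accepting run, so \<open>cf\<close> is arbitrary.\<close>

lemma acc_trc: "t \<le> l \<Longrightarrow> acc (l - t) p \<longleftrightarrow> (\<exists>us. trc cf t p us)"
proof (induction "l - t" arbitrary: t p)
  case 0
  then have "t = l" by simp
  then have "trc cf t p us \<longleftrightarrow> us = [] \<and> ve\<^sup>*\<^sup>* p fin" for us by (cases us) auto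
  then show ?case using \<open>t = l\<close> by simp
next
  case (Suc k)
  then have t: "t < l" "k = l - Suc t" by auto
  then have "l - Suc k = t" by simp
  then have "acc (l - t) p \<longleftrightarrow> (\<exists>q' p'. ve\<^sup>*\<^sup>* p q' \<and> mv (w t) q' p' \<and> acc k p')"
    unfolding Suc.hyps(2)[symmetric] by simp
  also have "\<dots> \<longleftrightarrow> (\<exists>q' p' us. ve\<^sup>*\<^sup>* p q' \<and> mv (w t) q' p' \<and> trc cf (Suc t) p' us)"
    using Suc.hyps(1)[OF t(2)] t by auto
  also have "\<dots> \<longleftrightarrow> (\<exists>us. trc cf t p us)"
    unfolding trc_trq[OF t(1)] trq_def using t(1) by blast
  finally show ?case .
qed

lemma good_trq: "t < l \<Longrightarrow> good t q \<longleftrightarrow> (\<exists>us. trq cf t q us)"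
  using acc_trc[of "Suc t" _ cf] by (auto simp: good_def trq_def)

text \<open>
  The remaining answers are stored as a stack: at level \<open>j\<close> of the current branch, the states
  in \<open>rest n j \<sigma>\<close> still have to be explored.
\<close>

definition prefix_word :: "(nat \<Rightarrow> nat \<Rightarrow> nat) \<Rightarrow> state \<Rightarrow> nat \<Rightarrow> nat list list" where
  "prefix_word cf \<sigma> i = map (\<lambda>j. cfv nv cf (arr \<sigma> aRP j 0)) [0..<i]"

definition pending :: "(nat \<Rightarrow> nat \<Rightarrow> nat) \<Rightarrow> state \<Rightarrow> nat \<Rightarrow> nat list list set" where
  "pending cf \<sigma> j = {prefix_word cf \<sigma> j @ us | us. \<exists>q\<in>rest n j \<sigma>. trq cf j q us}"

text \<open>On level \<open>l\<close> nothing is left to be chosen, and the branch itself is the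
  only word.\<close>

definition current :: "(nat \<Rightarrow> nat \<Rightarrow> nat) \<Rightarrow> state \<Rightarrow> nat \<Rightarrow> nat list list set" where
  "current cf \<sigma> i = (if i < l then pending cf \<sigma> i else {prefix_word cf \<sigma> l})"

text \<open>\<open>X\<close> consists of the words not yet printed, including the one under
  construction. On the levels passed, unexplored states differ in configuration from the
  representative, which separates the branches. All unexplored states are \<open>good\<close>, which
  excludes dead ends.\<close>

definition search_state :: "(nat \<Rightarrow> nat \<Rightarrow> nat) \<Rightarrow> state \<Rightarrow> nat list list set \<Rightarrow> bool" where
  "search_state cf \<sigma> X \<longleftrightarrow> ready cf \<sigma> \<and> var \<sigma> xI \<le> l \<and>
     (\<forall>j<var \<sigma> xI. (\<forall>q\<in>rest n j \<sigma>. good j q \<and> cfv nv cf q \<noteq> cfv nv cf (arr \<sigma> aRP j 0))) \<and>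
     (var \<sigma> xI < l \<longrightarrow> rest n (var \<sigma> xI) \<sigma> \<noteq> {} \<and> (\<forall>q\<in>rest n (var \<sigma> xI) \<sigma>. good (var \<sigma> xI) q)) \<and>
     X = current cf \<sigma> (var \<sigma> xI) \<union> (\<Union>j<var \<sigma> xI. pending cf \<sigma> j)"

lemma search_state_cong:
  assumes "\<And>x. x \<le> 7 \<Longrightarrow> var \<sigma> x = var \<tau> x" "var \<sigma> xI = var \<tau> xI" "arr \<sigma> = arr \<tau>" "inp \<sigma> = inp \<tau>"
  shows "search_state cf \<sigma> X = search_state cf \<tau> X"
  using ready_cong[of \<sigma> \<tau> cf] assms
  by (simp add: search_state_def rest_def current_def pending_def prefix_word_def)

lemma search_state_descend_step:
  assumes s: "search_state cf \<sigma> X" and il: "var \<sigma> xI < l"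
  shows "search_state cf (sem (descend_step S) \<sigma>) X \<and> var (sem (descend_step S) \<sigma>) xI = var \<sigma> xI + 1"
proof -
  define i where "i = var \<sigma> xI"
  define \<rho> where "\<rho> = sem (descend_step S) \<sigma>"
  have "ready cf \<sigma>" "rest n (var \<sigma> xI) \<sigma> \<noteq> {}" using s il by (auto simp: search_state_def)
  from descend_step_correct[OF this(1) il this(2), folded i_def \<rho>_def]
  obtain r C where rC: "r \<in> rest n i \<sigma>" "C = {q \<in> rest n i \<sigma>. cfv nv cf q = cfv nv cf r}" "ready cf \<rho>"
    "var \<rho> xI = i + 1" "\<And>j. arr \<rho> aRP j 0 = (if j = i then r else arr \<sigma> aRP j 0)"
    "rest n i \<rho> = rest n i \<sigma> - C" "\<And>j. j < i \<Longrightarrow> rest n j \<rho> = rest n j \<sigma>"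
    "i + 1 < l \<Longrightarrow> rest n (i + 1) \<rho> = {q. good (i + 1) q \<and> (\<exists>q0\<in>C. \<exists>p. mv (w i) q0 p \<and> ve\<^sup>*\<^sup>* p q)}"
    by blast
  have il: "i < l" using il by (simp add: i_def)
  have g: "\<forall>q\<in>rest n i \<sigma>. good i q" using s il by (simp add: search_state_def i_def)
  have W: "prefix_word cf \<rho> j = prefix_word cf \<sigma> j" if "j \<le> i" for j
    using that rC(5) by (simp add: prefix_word_def)
  have Wi: "prefix_word cf \<rho> (i + 1) = prefix_word cf \<sigma> i @ [cfv nv cf r]"
    using W[of i] rC(5) by (simp add: prefix_word_def)
  have F: "pending cf \<rho> j = pending cf \<sigma> j" if "j < i" for j
    using that W rC(7) by (simp add: pending_def)
  have rC': "r \<in> C" using rC(1,2) by simp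
  define Y where "Y = {prefix_word cf \<rho> (i + 1) @ us | us. \<exists>q\<in>C. \<exists>p'. mv (w i) q p' \<and> trc cf (Suc i) p' us}"
  \<comment> \<open>The words pending on level \<open>i\<close> split into those that start with the
    configuration of \<open>r\<close>, which move to the next level, and the others, which
    stay.\<close>
  have Y: "pending cf \<sigma> i = pending cf \<rho> i \<union> Y"
  proof -
    have "pending cf \<sigma> i = pending cf \<rho> i \<union> {prefix_word cf \<sigma> i @ us | us. \<exists>q\<in>C. trq cf i q us}"
      unfolding pending_def W[OF order_refl] rC(6) using rC(2) by auto
    moreover have "{prefix_word cf \<sigma> i @ us | us. \<exists>q\<in>C. trq cf i q us} = Y"
      unfolding Y_def Wi trq_def using il rC(2) by auto
    ultimately show ?thesis by simp
  qed
  have cur: "current cf \<rho> (i + 1) = Y"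
  proof (cases "i + 1 < l")
    case True
    have "q \<in> rest n (i + 1) \<rho> \<and> trq cf (i + 1) q us \<longleftrightarrow>
        (\<exists>q0\<in>C. \<exists>p. mv (w i) q0 p \<and> ve\<^sup>*\<^sup>* p q) \<and> trq cf (i + 1) q us" for q us
      using rC(8)[OF True] good_trq[OF True, of q cf] by auto
    then show ?thesis
      unfolding current_def Y_def pending_def using True trc_trq[of "Suc i" cf] by (auto, blast, blast)
  next
    \<comment> \<open>The next level is \<open>l\<close>. Only the empty rest remains, and it is
      accepted because \<open>r\<close> is good.\<close>
    case False
    then have e: "Suc i = l" using il by simp
    have "trc cf l p us \<longleftrightarrow> us = [] \<and> ve\<^sup>*\<^sup>* p fin" for p us by (cases us) auto
    moreover have "good i r" using g rC(1) by simp
    then have "\<exists>p'. mv (w i) r p' \<and> ve\<^sup>*\<^sup>* p' fin" using e by (simp add: good_def)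
    then have "\<exists>q\<in>C. \<exists>p'. mv (w i) q p' \<and> ve\<^sup>*\<^sup>* p' fin" using rC' by blast
    ultimately show ?thesis using e by (auto simp: current_def Y_def)
  qed
  have X: "X = current cf \<rho> (i + 1) \<union> (\<Union>j<i + 1. pending cf \<rho> j)"
  proof -
    have "X = pending cf \<sigma> i \<union> (\<Union>j<i. pending cf \<sigma> j)" using s il by (simp add: search_state_def current_def i_def)
    moreover have "(\<Union>j<i + 1. pending cf \<rho> j) = pending cf \<rho> i \<union> (\<Union>j<i. pending cf \<sigma> j)"
      using F by (auto simp: lessThan_Suc)
    ultimately show ?thesis using Y cur by auto
  qed
  have c1: "good j q \<and> cfv nv cf q \<noteq> cfv nv cf (arr \<rho> aRP j 0)" if "j < i + 1" "q \<in> rest n j \<rho>" for j q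
  proof (cases "j = i")
    case True
    then show ?thesis using that rC(2,5,6) g by auto
  next
    case False
    then have "j < i" using that by simp
    then show ?thesis using that rC(5,7) s by (auto simp: search_state_def i_def)
  qed
  \<comment> \<open>A good representative has a run to the end of the string. The state at which
    this run reads its next symbol is a candidate on the new level.\<close>
  have c2: "rest n (i + 1) \<rho> \<noteq> {}" if il1: "i + 1 < l"
  proof -
    have "good i r" using g rC(1) by simp
    then obtain p' where p': "mv (w i) r p'" "acc (l - Suc i) p'" by (auto simp: good_def)
    then obtain us where "trc cf (Suc i) p' us" using acc_trc[of "Suc i" p' cf] il by auto
    then obtain q where q: "ve\<^sup>*\<^sup>* p' q" "trq cf (Suc i) q us" using trc_trq[of "Suc i" cf p' us] il1 by auto
    then have "good (Suc i) q" using good_trq[of "Suc i" q cf] il1 by auto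
    then show ?thesis using rC(8)[OF il1] rC' p' q by auto
  qed
  have "search_state cf \<rho> X"
    unfolding search_state_def rC(4) using rC(3) il c1 c2 rC(8) X by auto
  then show ?thesis using rC(4) by (simp add: \<rho>_def i_def)
qed

lemma descend_correct:
  assumes s: "search_state cf \<sigma> X"
  shows "search_state cf (sem (descend S) \<sigma>) X" "var (sem (descend S) \<sigma>) xI = l"
proof -
  let ?b = "IfLess (V xI) (V xL) (descend_step S) Skip"
  have L: "var \<sigma> xL = l" using s by (simp add: search_state_def ready_def basic_def)
  have "search_state cf (sem (descend S) \<sigma>) X \<and> var \<sigma> xL \<le> var (sem (descend S) \<sigma>) xI"
    unfolding descend_def
  \<comment> \<open>The level is at least the number of rounds, whatever the starting level, so
    \<open>l\<close> rounds reach level \<open>l\<close>.\<close>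
  proof (rule for_frame_rule[where I = "\<lambda>k \<tau>. search_state cf \<tau> X \<and> k \<le> var \<tau> xI"])
    show "search_state cf (set_var xK 0 \<sigma>) X \<and> 0 \<le> var (set_var xK 0 \<sigma>) xI"
      using s search_state_cong[of "set_var xK 0 \<sigma>" \<sigma>] by simp
  next
    fix k and \<tau> :: state
    assume I: "search_state cf \<tau> X \<and> k \<le> var \<tau> xI" and k: "k < var \<sigma> xL"
    have "var \<tau> xL = l" using I by (simp add: search_state_def ready_def basic_def)
    then have "search_state cf (sem ?b \<tau>) X \<and> Suc k \<le> var (sem ?b \<tau>) xI"
      using I search_state_descend_step[of cf \<tau> X] k L by simp
    then show "search_state cf (bump xK (sem ?b \<tau>)) X \<and> Suc k \<le> var (bump xK (sem ?b \<tau>)) xI"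
      using search_state_cong[of "bump xK (sem ?b \<tau>)" "sem ?b \<tau>"] by simp
  qed auto
  then show "search_state cf (sem (descend S) \<sigma>) X" "var (sem (descend S) \<sigma>) xI = l"
    using L by (auto simp: search_state_def)
qed

lemma ascend_step_correct:
  assumes n: "var \<sigma> xN = n" and go: "var \<sigma> xGo = 0"
  shows "var (sem ascend_step \<sigma>) xI = var \<sigma> xI - 1"
    "0 < var (sem ascend_step \<sigma>) xGo \<longleftrightarrow> rest n (var \<sigma> xI - 1) \<sigma> \<noteq> {}"
proof -
  let ?b = "IfLess (N 0) (Arr aRS (V xI) (V xQ)) (Assign xGo (N 1)) Skip"
  let ?i = "var \<sigma> xI - 1"
  define \<sigma>1 where "\<sigma>1 = sem (Assign xI (Minus (V xI) (N 1))) \<sigma>"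
  have s: "sem ascend_step \<sigma> = sem (For xQ xN ?b) \<sigma>1"
    by (simp only: ascend_step_def sem.simps(7) \<sigma>1_def)
  show "var (sem ascend_step \<sigma>) xI = ?i" unfolding s by (subst var_sem) (auto simp: \<sigma>1_def)
  have "0 < var (sem (For xQ xN ?b) \<sigma>1) xGo \<longleftrightarrow> (\<exists>q<var \<sigma>1 xN. 0 < arr \<sigma> aRS ?i q)"
  proof (rule for_frame_rule[where I = "\<lambda>k \<tau>. 0 < var \<tau> xGo \<longleftrightarrow> (\<exists>q<k. 0 < arr \<sigma> aRS ?i q)"])
    fix k and \<tau> :: state
    assume I: "0 < var \<tau> xGo \<longleftrightarrow> (\<exists>q<k. 0 < arr \<sigma> aRS ?i q)" and k: "var \<tau> xQ = k"
      and fv: "\<And>z. z \<notin> insert xQ (mods ?b) \<Longrightarrow> var \<tau> z = var \<sigma>1 z"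
      and fa: "\<And>j. j \<notin> amods ?b \<Longrightarrow> arr \<tau> j = arr \<sigma>1 j"
    have "var \<tau> xI = ?i" "arr \<tau> aRS = arr \<sigma> aRS" using fv[of xI] fa[of aRS] by (simp_all add: \<sigma>1_def)
    then show "0 < var (bump xQ (sem ?b \<tau>)) xGo \<longleftrightarrow> (\<exists>q<Suc k. 0 < arr \<sigma> aRS ?i q)"
      using I k by (auto simp: less_Suc_eq)
  qed (use go in \<open>auto simp: \<sigma>1_def\<close>)
  moreover have "var \<sigma>1 xN = n" using n by (simp add: \<sigma>1_def)
  ultimately show "0 < var (sem ascend_step \<sigma>) xGo \<longleftrightarrow> rest n ?i \<sigma> \<noteq> {}"
    unfolding s by (auto simp: rest_def)
qed

lemma pending_mem: "us \<in> pending cf \<sigma> j \<Longrightarrow> \<exists>q\<in>rest n j \<sigma>. us ! j = cfv nv cf q"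
  by (auto simp: pending_def trq_def prefix_word_def nth_append)

lemma ascend_correct:
  assumes s: "search_state cf \<sigma> X" and i: "var \<sigma> xI = l"
  defines "Y \<equiv> X - {prefix_word cf \<sigma> l}" and "\<rho> \<equiv> sem ascend \<sigma>"
  shows "var \<rho> xGo = 0 \<Longrightarrow> Y = {}" "0 < var \<rho> xGo \<Longrightarrow> search_state cf \<rho> Y"
proof -
  have good: "\<forall>j<l. \<forall>q\<in>rest n j \<sigma>. good j q \<and> cfv nv cf q \<noteq> cfv nv cf (arr \<sigma> aRP j 0)"
    using s i by (simp add: search_state_def)
  \<comment> \<open>A word pending on level \<open>j\<close> differs from the current word at
    position \<open>j\<close>. Hence removing the current word leaves exactly the pending
    ones.\<close>
  have "prefix_word cf \<sigma> l \<notin> pending cf \<sigma> j" if "j < l" for j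
  proof
    assume "prefix_word cf \<sigma> l \<in> pending cf \<sigma> j"
    then obtain q where "q \<in> rest n j \<sigma>" "prefix_word cf \<sigma> l ! j = cfv nv cf q" using pending_mem by blast
    then show False using good that by (force simp: prefix_word_def)
  qed
  then have Y: "Y = (\<Union>j<l. pending cf \<sigma> j)"
    using s i by (auto simp: search_state_def Y_def current_def)
  let ?b = "IfLess (V xGo) (N 1) ascend_step Skip"
  define \<sigma>1 where "\<sigma>1 = sem (Assign xGo (N 0)) \<sigma>"
  have \<rho>: "\<rho> = sem (For xK xL ?b) \<sigma>1" by (simp only: \<rho>_def ascend_def sem.simps(7) \<sigma>1_def)
  have r1: "ready cf \<sigma>1" unfolding \<sigma>1_def by (subst ready_sem) (use s in \<open>auto simp: search_state_def\<close>)
  have L: "var \<sigma>1 xL = l" using r1 by (simp add: ready_def basic_def)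
  \<comment> \<open>While the flag is 0, all levels passed so far were empty. Once it is set, the
    current level is the deepest one with unexplored states.\<close>
  let ?I = "\<lambda>k \<tau>. ready cf \<tau> \<and> (if var \<tau> xGo = 0 then var \<tau> xI = l - k \<and> Y = (\<Union>j<l - k. pending cf \<sigma> j)
    else var \<tau> xI < l \<and> rest n (var \<tau> xI) \<sigma> \<noteq> {} \<and> Y = (\<Union>j<Suc (var \<tau> xI). pending cf \<sigma> j))"
  have "?I (var \<sigma>1 xL) \<rho>"
    unfolding \<rho>
  proof (rule for_frame_rule[where I = ?I])
    have "ready cf (set_var xK 0 \<sigma>1)" using ready_sem[of "Assign xK (N 0)" cf \<sigma>1] r1 by simp
    then show "?I 0 (set_var xK 0 \<sigma>1)" using i Y by (simp add: \<sigma>1_def)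
  next
    fix k and \<tau> :: state
    assume I: "?I k \<tau>" and k: "k < var \<sigma>1 xL"
      and fa: "\<And>j. j \<notin> amods ?b \<Longrightarrow> arr \<tau> j = arr \<sigma>1 j"
    have rs: "rest n j \<tau> = rest n j \<sigma>" for j using fa[of aRS] by (simp add: rest_def \<sigma>1_def)
    have "ready cf (sem ?b \<tau>)" by (subst ready_sem) (use I in auto)
    then have rb: "ready cf (bump xK (sem ?b \<tau>))"
      using ready_cong[of "bump xK (sem ?b \<tau>)" "sem ?b \<tau>"] by simp
    show "?I (Suc k) (bump xK (sem ?b \<tau>))"
    proof (cases "var \<tau> xGo = 0")
      case False
      then have "sem ?b \<tau> = \<tau>" by simp
      then show ?thesis using rb I False by simp
    next
      case True
      then have sb: "sem ?b \<tau> = sem ascend_step \<tau>" by simp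
      have n: "var \<tau> xN = n" using I by (simp add: ready_def basic_def)
      have t: "var \<tau> xI = l - k" "Y = (\<Union>j<l - k. pending cf \<sigma> j)" using I True by simp_all
      note A = ascend_step_correct[OF n True, unfolded t rs]
      have e: "l - k = Suc (l - Suc k)" "l - k - 1 = l - Suc k" using k L by auto
      have Y': "Y = pending cf \<sigma> (l - Suc k) \<union> (\<Union>j<l - Suc k. pending cf \<sigma> j)"
        unfolding t(2) e(1) by (auto simp: lessThan_Suc)
      show ?thesis
      proof (cases "rest n (l - Suc k) \<sigma> = {}")
        case True
        then have "pending cf \<sigma> (l - Suc k) = {}" by (simp add: pending_def)
        then show ?thesis using rb A Y' True unfolding sb e by simp
      next
        case False
        moreover have "l - Suc k < l" using k L by simp
        ultimately show ?thesis using rb A Y' unfolding sb e by (auto simp: lessThan_Suc)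
      qed
    qed
  qed simp_all
  then have I: "?I l \<rho>" using L by simp
  have ar: "arr \<rho> = arr \<sigma>" by (simp add: \<rho>_def arr_sem fun_eq_iff)
  show "var \<rho> xGo = 0 \<Longrightarrow> Y = {}" using I by simp
  assume "0 < var \<rho> xGo"
  then have J: "ready cf \<rho>" "var \<rho> xI < l" "rest n (var \<rho> xI) \<sigma> \<noteq> {}" "Y = (\<Union>j<Suc (var \<rho> xI). pending cf \<sigma> j)"
    using I by simp_all
  have eqs: "rest n j \<rho> = rest n j \<sigma>" "pending cf \<rho> j = pending cf \<sigma> j" for j
    by (simp_all add: rest_def pending_def prefix_word_def ar)
  show "search_state cf \<rho> Y"
    unfolding search_state_def eqs ar using J good by (auto simp: current_def eqs lessThan_Suc)
qed

lemma next_answer_correct: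
  assumes s: "search_state cf \<sigma> X" and i: "var \<sigma> xI = l"
  defines "Y \<equiv> X - {prefix_word cf \<sigma> l}" and "\<rho> \<equiv> sem (next_answer S) \<sigma>"
  shows "var \<rho> xGo = 0 \<Longrightarrow> Y = {}"
    and "0 < var \<rho> xGo \<Longrightarrow> search_state cf \<rho> Y \<and> var \<rho> xI = l"
proof -
  define \<tau> where "\<tau> = sem ascend \<sigma>"
  note A = ascend_correct[OF s i, folded Y_def \<tau>_def]
  have \<rho>: "\<rho> = (if 0 < var \<tau> xGo then sem (descend S) \<tau> else \<tau>)"
    by (simp add: \<rho>_def next_answer_def \<tau>_def)
  have "var \<rho> xGo = var \<tau> xGo" by (simp add: \<rho> var_sem)
  then show "var \<rho> xGo = 0 \<Longrightarrow> Y = {}" "0 < var \<rho> xGo \<Longrightarrow> search_state cf \<rho> Y \<and> var \<rho> xI = l"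
    using A descend_correct[of cf \<tau> Y] by (auto simp: \<rho>)
qed

text \<open>Each entry is the configuration before a symbol. The values below 1 thus count the
  symbols before the opening, those below 2 the symbols before the closing, and positions in spans
  start at 1.\<close>

definition print_word :: "nat list list \<Rightarrow> nat list" where
  "print_word us = concat (map (\<lambda>y. [1 + length (filter (\<lambda>u. u ! y < 1) us),
     1 + length (filter (\<lambda>u. u ! y < 2) us)]) [0..<nv])"

lemma print_bounds_correct:
  assumes r: "ready cf \<sigma>" and y: "var \<sigma> xY = y" "y < nv"
  shows "var (sem print_bounds \<sigma>) xA = 1 + length (filter (\<lambda>u. u ! y < 1) (prefix_word cf \<sigma> l))"
    "var (sem print_bounds \<sigma>) xB = 1 + length (filter (\<lambda>u. u ! y < 2) (prefix_word cf \<sigma> l))"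
proof -
  let ?b = "Assign xR (Arr aRP (V xK) (N 0)) ;;
      IfLess (Arr aCF (V xR) (V xY)) (N 1) (Inc xA) Skip ;;
      IfLess (Arr aCF (V xR) (V xY)) (N 2) (Inc xB) Skip"
  let ?c = "\<lambda>d k. 1 + length (filter (\<lambda>u. u ! y < d) (prefix_word cf \<sigma> k))"
  define \<sigma>1 where "\<sigma>1 = sem (Assign xA (N 1) ;; Assign xB (N 1)) \<sigma>"
  have L: "var \<sigma>1 xL = l" "l < var \<sigma>1 0" using r by (simp_all add: \<sigma>1_def ready_def basic_def)
  have "var (sem (For xK xL ?b) \<sigma>1) xA = ?c 1 (var \<sigma>1 xL) \<and> var (sem (For xK xL ?b) \<sigma>1) xB = ?c 2 (var \<sigma>1 xL)"
  proof (rule for_frame_rule[where I = "\<lambda>k \<tau>. var \<tau> xA = ?c 1 k \<and> var \<tau> xB = ?c 2 k"])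
    fix k and \<tau> :: state
    assume I: "var \<tau> xA = ?c 1 k \<and> var \<tau> xB = ?c 2 k" and k: "k < var \<sigma>1 xL" "var \<tau> xK = k"
      and fv: "\<And>z. z \<notin> insert xK (mods ?b) \<Longrightarrow> var \<tau> z = var \<sigma>1 z"
      and fa: "\<And>j. j \<notin> amods ?b \<Longrightarrow> arr \<tau> j = arr \<sigma>1 j"
    have eq: "var \<tau> xY = y" "var \<tau> 0 = var \<sigma>1 0" "arr \<tau> aRP = arr \<sigma> aRP" "arr \<tau> aCF = cf"
      using fv[of xY] fv[of 0] fa[of aRP] fa[of aCF] y r by (simp_all add: \<sigma>1_def ready_def)
    have pw: "prefix_word cf \<sigma> (Suc k) = prefix_word cf \<sigma> k @ [cfv nv cf (arr \<sigma> aRP k 0)]"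
      by (simp add: prefix_word_def)
    have cv: "cfv nv cf (arr \<sigma> aRP k 0) ! y = cf (arr \<sigma> aRP k 0) y" using y by (simp add: cfv_def)
    have le: "length (filter P (prefix_word cf \<sigma> k)) \<le> k" for P
      using length_filter_le[of P "prefix_word cf \<sigma> k"] by (simp add: prefix_word_def)
    \<comment> \<open>The counters are at most \<open>k + 1\<close>, hence at most \<open>l\<close>
      and below \<open>D\<close>, so \<open>Inc\<close> does not saturate.\<close>
    have "var \<tau> xA < var \<tau> 0" "var \<tau> xB < var \<tau> 0"
      using I k(1) L eq(2) le[of "\<lambda>u. u ! y < 1"] le[of "\<lambda>u. u ! y < 2"] by linarith+
    then show "var (bump xK (sem ?b \<tau>)) xA = ?c 1 (Suc k) \<and> var (bump xK (sem ?b \<tau>)) xB = ?c 2 (Suc k)"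
      using I eq k unfolding pw by (simp add: cv)
  qed (auto simp: \<sigma>1_def prefix_word_def)
  moreover have "sem print_bounds \<sigma> = sem (For xK xL ?b) \<sigma>1"
    by (simp only: print_bounds_def sem.simps(7) \<sigma>1_def)
  ultimately show "var (sem print_bounds \<sigma>) xA = ?c 1 l" "var (sem print_bounds \<sigma>) xB = ?c 2 l"
    using L by auto
qed

lemma print_answer_correct:
  assumes r: "ready cf \<sigma>"
  shows "outp (sem print_answer \<sigma>) = outp \<sigma> @ print_word (prefix_word cf \<sigma> l)"
proof -
  let ?b = "print_bounds ;; Print xA ;; Print xB"
  let ?f = "\<lambda>y. [1 + length (filter (\<lambda>u. u ! y < 1) (prefix_word cf \<sigma> l)),
     1 + length (filter (\<lambda>u. u ! y < 2) (prefix_word cf \<sigma> l))]"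
  have "outp (sem print_answer \<sigma>) = outp \<sigma> @ concat (map ?f [0..<var \<sigma> xV])"
    unfolding print_answer_def
  proof (rule for_frame_rule[where I = "\<lambda>k \<tau>. outp \<tau> = outp \<sigma> @ concat (map ?f [0..<k])"])
    fix k and \<tau> :: state
    assume I: "outp \<tau> = outp \<sigma> @ concat (map ?f [0..<k])" and k: "k < var \<sigma> xV" "var \<tau> xY = k"
      and fv: "\<And>z. z \<notin> insert xY (mods ?b) \<Longrightarrow> var \<tau> z = var \<sigma> z"
      and fa: "\<And>j. j \<notin> amods ?b \<Longrightarrow> arr \<tau> j = arr \<sigma> j" and fi: "inp \<tau> = inp \<sigma>"
    have "ready cf \<tau> = ready cf \<sigma>" by (intro ready_cong fv fa fi) auto
    then have "ready cf \<tau>" using r by simp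
    moreover have "prefix_word cf \<tau> l = prefix_word cf \<sigma> l" using fa[of aRP] by (simp add: prefix_word_def)
    moreover have "k < nv" using k r by (simp add: ready_def basic_def)
    ultimately have "var (sem print_bounds \<tau>) xA = ?f k ! 0" "var (sem print_bounds \<tau>) xB = ?f k ! 1"
      using print_bounds_correct[of cf \<tau> k] k by simp_all
    then show "outp (bump xY (sem ?b \<tau>)) = outp \<sigma> @ concat (map ?f [0..<Suc k])"
      using I by (simp add: outp_sem)
  qed auto
  then show ?thesis using r by (simp add: print_word_def ready_def basic_def)
qed

lemma first_answer_correct:
  assumes b: "basic \<sigma>" and B: "\<And>t q. t < l \<Longrightarrow> q < n \<Longrightarrow> 0 < arr \<sigma> aBB t q \<longleftrightarrow> good t q"
    and z: "\<And>q y. arr \<sigma> aCF q y = 0" and acc: "acc l ini"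
  defines "\<sigma>' \<equiv> sem (first_answer S) \<sigma>"
  shows "\<exists>cf. search_state cf \<sigma>' {us. trc cf 0 ini us} \<and> var \<sigma>' xI = l \<and> 0 < var \<sigma>' xGo \<and>
    (\<forall>q. al\<^sup>*\<^sup>* ini q \<longrightarrow> (\<exists>c. conf_reach q c \<and> (\<forall>y<nv. cf q y = c y)))"
proof -
  define \<sigma>1 where "\<sigma>1 = sem configs \<sigma>"
  define \<sigma>2 where "\<sigma>2 = sem (push xIni) (sem clear \<sigma>1)"
  define \<sigma>3 where "\<sigma>3 = sem (closure aVF) \<sigma>2"
  define \<sigma>4 where "\<sigma>4 = sem (Assign xI (N 0)) \<sigma>3"
  define \<sigma>5 where "\<sigma>5 = sem candidates \<sigma>4"
  define \<sigma>6 where "\<sigma>6 = sem (descend S) \<sigma>5"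
  have \<sigma>': "\<sigma>' = set_var xGo 1 \<sigma>6"
    by (simp add: \<sigma>'_def first_answer_def \<sigma>1_def \<sigma>2_def \<sigma>3_def \<sigma>4_def \<sigma>5_def \<sigma>6_def)
  define cf where "cf = arr \<sigma>1 aCF"
  have b1: "basic \<sigma>1" unfolding \<sigma>1_def by (subst basic_sem) (use b in auto)
  have B1: "arr \<sigma>1 aBB = arr \<sigma> aBB" by (simp add: \<sigma>1_def arr_sem)
  have r1: "ready cf \<sigma>1" using b1 B by (simp add: ready_def cf_def B1)
  have r2: "ready cf \<sigma>2" unfolding \<sigma>2_def by (subst ready_sem; simp add: ready_sem r1)
  have r3: "ready cf \<sigma>3" unfolding \<sigma>3_def by (subst ready_sem) (use r2 in auto)
  have r4: "ready cf \<sigma>4" unfolding \<sigma>4_def by (subst ready_sem) (use r3 in auto)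
  have r5: "ready cf \<sigma>5" unfolding \<sigma>5_def by (subst ready_sem) (use r4 in auto)
  have v1: "var \<sigma>1 xIni = ini" using b1 by (simp add: basic_def)
  have s2: "queue_ok n \<sigma>2" "marked n \<sigma>2 = {ini}"
    using seed[OF b1, of xIni] v1 ini by (simp_all add: \<sigma>2_def)
  have "basic \<sigma>2" using r2 by (simp add: ready_def)
  then have m3: "marked n \<sigma>3 = {q. ve\<^sup>*\<^sup>* ini q}" using closure_aVF[OF _ s2(1)] s2(2) XF(3) by (simp add: \<sigma>3_def)
  have m4: "marked n \<sigma>4 = {q. ve\<^sup>*\<^sup>* ini q}" "var \<sigma>4 xI = 0" using m3 by (simp_all add: \<sigma>4_def marked_def)
  have n4: "var \<sigma>4 xN = n" using r4 by (simp add: ready_def basic_def)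
  have rest0: "rest n 0 \<sigma>5 = {q. ve\<^sup>*\<^sup>* ini q \<and> good 0 q}" if "0 < l"
  proof -
    have "q \<in> rest n 0 \<sigma>5 \<longleftrightarrow> q < n \<and> q \<in> marked n \<sigma>4 \<and> 0 < arr \<sigma>4 aBB 0 q" for q
      using candidates_correct(1)[OF n4, of q] m4(2) by (auto simp: \<sigma>5_def rest_def)
    moreover have "q < n \<Longrightarrow> 0 < arr \<sigma>4 aBB 0 q \<longleftrightarrow> good 0 q" for q
      using r4 that by (simp add: ready_def)
    ultimately show ?thesis unfolding m4(1) using good_bound by blast
  qed
  have i5: "var \<sigma>5 xI = 0" using m4(2) by (simp add: \<sigma>5_def var_sem)
  obtain us where us: "trc cf 0 ini us" using acc acc_trc[of 0 ini cf] by auto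
  have "search_state cf \<sigma>5 {us. trc cf 0 ini us}"
  proof (cases "0 < l")
    case True
    have "pending cf \<sigma>5 0 = {us. trc cf 0 ini us}"
      unfolding pending_def rest0[OF True] using good_trq[OF True, of _ cf] trc_trq[OF True, of cf ini]
      by (auto simp: prefix_word_def)
    moreover have "rest n 0 \<sigma>5 \<noteq> {}"
      unfolding rest0[OF True] using us good_trq[OF True, of _ cf] trc_trq[OF True, of cf ini us] by auto
    ultimately show ?thesis using r5 True rest0[OF True] by (simp add: search_state_def i5 current_def)
  next
    case False
    have "acc 0 ini" using acc False by (metis gr0I)
    then have "ve\<^sup>*\<^sup>* ini fin" by simp
    then have t0: "trc cf 0 ini []" unfolding trc.simps using False by auto
    have "us = []" if "trc cf 0 ini us" for us using length_trc[OF that] False by simp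
    then have "{us. trc cf 0 ini us} = {[]}" using t0 by blast
    moreover have "prefix_word cf \<sigma>5 l = []" using False by (simp add: prefix_word_def)
    ultimately show ?thesis unfolding search_state_def i5 current_def using r5 False by simp
  qed
  then have D: "search_state cf \<sigma>6 {us. trc cf 0 ini us}" "var \<sigma>6 xI = l"
    using descend_correct by (simp_all add: \<sigma>6_def)
  then have "search_state cf \<sigma>' {us. trc cf 0 ini us}" "var \<sigma>' xI = l" "0 < var \<sigma>' xGo"
    using search_state_cong[of \<sigma>' \<sigma>6] by (simp_all add: \<sigma>')
  moreover have "\<forall>q. al\<^sup>*\<^sup>* ini q \<longrightarrow> (\<exists>c. conf_reach q c \<and> (\<forall>y<nv. cf q y = c y))"
    using configs_correct[OF b z] by (simp add: cf_def \<sigma>1_def)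
  ultimately show ?thesis by blast
qed

lemma header_correct:
  assumes "inp \<sigma> 0 = n" "inp \<sigma> 1 = m" "inp \<sigma> 2 = nv" "inp \<sigma> 3 = l" "inp \<sigma> 4 = ini" "inp \<sigma> 5 = fin"
  shows "var (sem header \<sigma>) xN = n" "var (sem header \<sigma>) xM = m" "var (sem header \<sigma>) xV = nv"
    "var (sem header \<sigma>) xL = l" "var (sem header \<sigma>) xIni = ini" "var (sem header \<sigma>) xFin = fin"
  using assms by (simp_all add: header_def)

lemma tables_correct:
  assumes z: "arr \<sigma> = (\<lambda>_ _ _. 0)" and D: "m < var \<sigma> 0" "l < var \<sigma> 0"
    and v: "var \<sigma> xN = n" "var \<sigma> xM = m" "var \<sigma> xV = nv" "var \<sigma> xL = l" "var \<sigma> xIni = ini" "var \<sigma> xFin = fin"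
    and T: "T = tr ` {..<m}"
      "\<And>k. k < m \<Longrightarrow> tr k = (inp \<sigma> (6 + 4 * k), inp \<sigma> (7 + 4 * k), inp \<sigma> (8 + 4 * k), inp \<sigma> (9 + 4 * k))"
    and w: "\<And>i. i < l \<Longrightarrow> inp \<sigma> (6 + 4 * m + i) = w i"
  defines "\<sigma>' \<equiv> sem (tables S) \<sigma>"
  shows "basic \<sigma>'" "marked n \<sigma>' = {q. acc l q}" "arr \<sigma>' aCF q y = 0"
    "t < l \<Longrightarrow> q < n \<Longrightarrow> 0 < arr \<sigma>' aBB t q \<longleftrightarrow> good t q"
    "var \<sigma>' xGo = var \<sigma> xGo"
proof -
  define \<sigma>1 where "\<sigma>1 = sem (Assign xPb (V xM) ;; Inc xPb ;; IfLess (V xN) (V xPb) (Assign xPb (V xN)) Skip) \<sigma>"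
  define \<sigma>2 where "\<sigma>2 = sem (load S) \<sigma>1"
  have \<sigma>': "\<sigma>' = sem (backward S) \<sigma>2" by (simp add: \<sigma>'_def tables_def \<sigma>1_def \<sigma>2_def)
  have v1: "var \<sigma>1 xPb = pb" "arr \<sigma>1 = arr \<sigma>" "inp \<sigma>1 = inp \<sigma>" "x \<noteq> xPb \<Longrightarrow> var \<sigma>1 x = var \<sigma> x" for x
    using v D by (auto simp: \<sigma>1_def pb)
  have "loaded S {} \<sigma>1" using z by (simp add: loaded_def v1)
  moreover have "fst (snd (snd (tr k))) < S" if "k < m" "fst (snd (tr k)) = 1" for k
  proof -
    obtain p e a q where e: "tr k = (p, e, a, q)" by (cases "tr k") auto
    then have "(p, 1, a, q) \<in> T" using that T(1) by (metis fst_conv imageI lessThan_iff snd_conv)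
    then show ?thesis using T_sym e by simp
  qed
  ultimately have L: "loaded S T \<sigma>2"
    using load_correct[of S \<sigma>1 tr] T v1 v by (simp add: \<sigma>2_def)
  have v2: "var \<sigma>2 x = var \<sigma>1 x" if "x \<le> 8" for x
    unfolding \<sigma>2_def by (rule var_sem) (use that in auto)
  have "pb \<le> var \<sigma> 0" using pb D(1) by simp
  moreover have "inp \<sigma>2 = inp \<sigma>" by (simp add: \<sigma>2_def v1)
  ultimately have b2: "basic \<sigma>2"
    using L w v D(2) v1(1,4) v2 by (simp add: basic_def)
  have z2: "arr \<sigma>2 aBB t q = 0" "arr \<sigma>2 aCF t q = 0" for t q
    using z by (simp_all add: \<sigma>2_def arr_sem v1)
  note B = backward_correct[OF b2 z2(1), folded \<sigma>']
  show "basic \<sigma>'" "marked n \<sigma>' = {q. acc l q}" "t < l \<Longrightarrow> q < n \<Longrightarrow> 0 < arr \<sigma>' aBB t q \<longleftrightarrow> good t q"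
    using B by auto
  show "arr \<sigma>' aCF q y = 0" "var \<sigma>' xGo = var \<sigma> xGo" using z2(2) v1(4)[of xGo] v2[of xGo]
    by (simp_all add: \<sigma>' arr_sem var_sem)
qed

lemma preprocess_correct:
  assumes z: "arr \<sigma> = (\<lambda>_ _ _. 0)" and D: "m < var \<sigma> 0" "l < var \<sigma> 0" and go: "var \<sigma> xGo = 0" and m: "1 \<le> m"
    and h: "inp \<sigma> 0 = n" "inp \<sigma> 1 = m" "inp \<sigma> 2 = nv" "inp \<sigma> 3 = l" "inp \<sigma> 4 = ini" "inp \<sigma> 5 = fin"
    and T: "T = tr ` {..<m}"
      "\<And>k. k < m \<Longrightarrow> tr k = (inp \<sigma> (6 + 4 * k), inp \<sigma> (7 + 4 * k), inp \<sigma> (8 + 4 * k), inp \<sigma> (9 + 4 * k))"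
    and w: "\<And>i. i < l \<Longrightarrow> inp \<sigma> (6 + 4 * m + i) = w i"
  defines "\<sigma>' \<equiv> sem (preprocess S) \<sigma>"
  shows "if acc l ini then \<exists>cf. search_state cf \<sigma>' {us. trc cf 0 ini us} \<and> var \<sigma>' xI = l \<and> 0 < var \<sigma>' xGo \<and>
      (\<forall>q. al\<^sup>*\<^sup>* ini q \<longrightarrow> (\<exists>c. conf_reach q c \<and> (\<forall>y<nv. cf q y = c y)))
    else var \<sigma>' xGo = 0"
proof -
  define \<sigma>1 where "\<sigma>1 = sem header \<sigma>"
  define \<sigma>2 where "\<sigma>2 = sem (tables S) \<sigma>1"
  note H = header_correct[OF h, folded \<sigma>1_def]
  have s1: "arr \<sigma>1 = (\<lambda>_ _ _. 0)" "var \<sigma>1 0 = var \<sigma> 0" "inp \<sigma>1 = inp \<sigma>" "var \<sigma>1 xGo = 0"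
    using z go by (simp_all add: \<sigma>1_def header_def)
  have "basic \<sigma>2 \<and> marked n \<sigma>2 = {q. acc l q} \<and> (\<forall>q y. arr \<sigma>2 aCF q y = 0) \<and>
      (\<forall>t q. t < l \<longrightarrow> q < n \<longrightarrow> (0 < arr \<sigma>2 aBB t q \<longleftrightarrow> good t q)) \<and> var \<sigma>2 xGo = 0"
    using tables_correct[of \<sigma>1 tr, folded \<sigma>2_def] s1 D H T w by simp
  then have t: "basic \<sigma>2" "marked n \<sigma>2 = {q. acc l q}" "\<And>q y. arr \<sigma>2 aCF q y = 0"
    "\<And>t q. t < l \<Longrightarrow> q < n \<Longrightarrow> 0 < arr \<sigma>2 aBB t q \<longleftrightarrow> good t q" "var \<sigma>2 xGo = 0" by auto
  have "var \<sigma>2 xIni = ini" using t(1) by (simp add: basic_def)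
  then have test: "0 < eval (Arr aMK (N 0) (V xIni)) \<sigma>2 \<longleftrightarrow> acc l ini"
    using t(2) ini by (auto simp: marked_def)
  have \<sigma>': "\<sigma>' = (if acc l ini then sem (first_answer S) \<sigma>2 else \<sigma>2)"
    unfolding \<sigma>'_def preprocess_def using H m test by (simp flip: \<sigma>1_def \<sigma>2_def)
  show ?thesis
    using first_answer_correct[OF t(1,4,3)] t(5) by (auto simp: \<sigma>')
qed

definition next_state :: "state \<Rightarrow> state" where
  "next_state \<sigma> = sem (next_answer S) ((sem print_answer \<sigma>)\<lparr>outp := []\<rparr>)"

text \<open>Each round prints and removes one word, whence an induction on the number of words left.
  The flag drops to 0 exactly when none remains.\<close>

lemma enumeration:
  assumes "finite X" "search_state cf \<sigma> X" "var \<sigma> xI = l" "0 < var \<sigma> xGo" "outp \<sigma> = []"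
  shows "\<exists>us. distinct us \<and> set us = X \<and> us \<noteq> [] \<and> (\<forall>k<length us. 0 < var ((next_state ^^ k) \<sigma>) xGo) \<and>
    var ((next_state ^^ length us) \<sigma>) xGo = 0 \<and> (\<forall>k<length us. ready cf ((next_state ^^ k) \<sigma>)) \<and>
    map (\<lambda>k. outp (sem print_answer ((next_state ^^ k) \<sigma>))) [0..<length us] = map print_word us"
  using assms
proof (induction "card X" arbitrary: X \<sigma>)
  case 0
  then have "X = {}" by simp
  moreover have "prefix_word cf \<sigma> l \<in> X" using 0 by (simp add: search_state_def current_def)
  ultimately show ?case by simp
next
  case (Suc c)
  define u where "u = prefix_word cf \<sigma> l"
  have u: "u \<in> X" using Suc.prems by (simp add: search_state_def current_def u_def)
  have r: "ready cf \<sigma>" using Suc.prems by (simp add: search_state_def)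
  define \<tau> where "\<tau> = (sem print_answer \<sigma>)\<lparr>outp := []\<rparr>"
  have out: "outp (sem print_answer \<sigma>) = print_word u"
    using print_answer_correct[OF r] Suc.prems by (simp add: u_def)
  have a\<tau>: "arr \<tau> = arr \<sigma>" by (simp add: \<tau>_def arr_sem fun_eq_iff)
  have "search_state cf \<tau> X = search_state cf \<sigma> X"
    using a\<tau> by (intro search_state_cong) (simp_all add: \<tau>_def var_sem)
  then have s\<tau>: "search_state cf \<tau> X" "var \<tau> xI = l" "prefix_word cf \<tau> l = u"
    using Suc.prems a\<tau> by (simp_all add: \<tau>_def var_sem u_def prefix_word_def)
  have nx: "next_state \<sigma> = sem (next_answer S) \<tau>" by (simp add: next_state_def \<tau>_def)
  note A = next_answer_correct[OF s\<tau>(1,2), folded nx, unfolded s\<tau>(3)]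
  have shift: "(next_state ^^ Suc k) \<sigma> = (next_state ^^ k) (next_state \<sigma>)" for k
    by (simp add: funpow_swap1)
  show ?case
  proof (cases "var (next_state \<sigma>) xGo = 0")
    case True
    then have "X = {u}" using A(1) u by auto
    then show ?thesis using True out Suc.prems(4) r by (intro exI[of _ "[u]"]) simp
  next
    case False
    then have N: "search_state cf (next_state \<sigma>) (X - {u})" "var (next_state \<sigma>) xI = l"
      using A(2) by auto
    have "c = card (X - {u})" using Suc.hyps(2) u Suc.prems(1) by simp
    moreover have "outp (next_state \<sigma>) = []" by (simp add: nx outp_sem \<tau>_def)
    ultimately obtain us where us: "distinct us" "set us = X - {u}" "us \<noteq> []"
      "\<forall>k<length us. 0 < var ((next_state ^^ k) (next_state \<sigma>)) xGo"
      "var ((next_state ^^ length us) (next_state \<sigma>)) xGo = 0"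
      "\<forall>k<length us. ready cf ((next_state ^^ k) (next_state \<sigma>))"
      "map (\<lambda>k. outp (sem print_answer ((next_state ^^ k) (next_state \<sigma>)))) [0..<length us] = map print_word us"
      using Suc.hyps(1)[of "X - {u}" "next_state \<sigma>"] N False Suc.prems(1) by auto
    have all: "(\<forall>k<Suc i. Q ((next_state ^^ k) \<sigma>)) \<longleftrightarrow> Q \<sigma> \<and> (\<forall>k<i. Q ((next_state ^^ k) (next_state \<sigma>)))" for i Q
      unfolding shift[symmetric] by (auto simp: less_Suc_eq_0_disj simp del: funpow.simps(2))
    have "map (\<lambda>k. outp (sem print_answer ((next_state ^^ k) \<sigma>))) [0..<Suc (length us)] =
        print_word u # map (\<lambda>k. outp (sem print_answer ((next_state ^^ Suc k) \<sigma>))) [0..<length us]"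
      using out by (simp only: upt_conv_Cons[OF zero_less_Suc] map_Suc_upt[symmetric] list.map funpow_0 map_map o_def)
    also have "\<dots> = map print_word (u # us)" by (simp only: shift us(7) list.map)
    finally have out_all: "map (\<lambda>k. outp (sem print_answer ((next_state ^^ k) \<sigma>))) [0..<Suc (length us)] =
        map print_word (u # us)" .
    show ?thesis
    proof (intro exI[of _ "u # us"] conjI)
      show "distinct (u # us)" "set (u # us) = X" using us u by auto
      show "\<forall>k<length (u # us). 0 < var ((next_state ^^ k) \<sigma>) xGo"
        unfolding length_Cons using all[of "length us" "\<lambda>\<sigma>. 0 < var \<sigma> xGo"] us(4) Suc.prems(4) by blast
      show "\<forall>k<length (u # us). ready cf ((next_state ^^ k) \<sigma>)"
        unfolding length_Cons using all[of "length us" "ready cf"] us(6) r by blast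
      show "var ((next_state ^^ length (u # us)) \<sigma>) xGo = 0"
        unfolding length_Cons shift by (rule us(5))
    qed (use out_all in \<open>simp_all only: length_Cons list.distinct not_False_eq_True\<close>)
  qed
qed

lemma finite_trc: "finite {us. trc cf t p us}"
proof (rule finite_subset)
  show "{us. trc cf t p us} \<subseteq> {us. set us \<subseteq> cfv nv cf ` {..<n} \<and> length us = l - t}"
  proof safe
    fix us u assume "trc cf t p us" "u \<in> set us"
    then show "u \<in> cfv nv cf ` {..<n}"
    proof (induction us arbitrary: t p)
      case (Cons v us)
      then obtain q p' where "cfv nv cf q = v" "mv (w t) q p'" "trc cf (Suc t) p' us" by auto
      then show ?case using Cons bounds(3) by auto
    qed simp
  qed (rule length_trc)
  show "finite {us. set us \<subseteq> cfv nv cf ` {..<n} \<and> length us = l - t}"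
    by (rule finite_lists_length_eq) simp
qed

end

section \<open>Bounds on the costs\<close>

lemma scost_push: "scost (push x) \<rho> = 27"
  by (simp add: push_def)

lemma scost_clear: "scost clear \<rho> = 16 * \<rho> xN + 5"
  by (simp add: clear_def)

lemma scost_closure: "scost (closure j) \<rho> \<le> 200 * (\<rho> xN * \<rho> xPb) + 200 * \<rho> xPb + 200"
  by (simp add: closure_def visit_def scost_push algebra_simps)

lemma scost_candidates: "scost candidates \<rho> \<le> 200 * \<rho> xN + 200"
  by (simp add: candidates_def)

lemma scost_load: "scost (load S) \<rho> \<le> 300 * \<rho> xM + 300"
  by (simp add: load_def load_step_def sym_code_def Let_def)

text \<open>The first summand pays for the closure from the final state, which is computed even for
  the empty string; each symbol then takes time of order n^2.\<close>

lemma scost_backward: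
  assumes "\<rho> xPb \<le> \<rho> xN" "1 \<le> \<rho> xN"
  shows "scost (backward S) \<rho> \<le> 2000 * (\<rho> xN * \<rho> xPb + \<rho> xN) + 2000 * (\<rho> xN * \<rho> xN * \<rho> xL)"
proof -
  let ?n = "\<rho> xN" and ?p = "\<rho> xPb" and ?l = "\<rho> xL"
  have "?n * ?p \<le> ?n * ?n" "?n \<le> ?n * ?n" using assms by auto
  then have f: "?n * ?p \<le> ?n * ?n" "?p \<le> ?n * ?n" "?n \<le> ?n * ?n" "1 \<le> ?n * ?n"
    using assms by linarith+
  have "scost (back_step S) \<rho> + 4 \<le> 2000 * (?n * ?n)"
    by (simp add: back_step_def sym_addr_def ending_states_def mark_ending_def sym_code_def
        scost_clear scost_push algebra_simps del: One_nat_def) (use f scost_closure[of aVB \<rho>] in linarith)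
  then have "?l * (4 + scost (back_step S) \<rho>) \<le> ?l * (2000 * (?n * ?n))"
    by (intro mult_le_mono2) simp
  then have "?l * (4 + scost (back_step S) \<rho>) \<le> 2000 * (?n * ?n * ?l)" by (simp add: mult_ac)
  moreover have "?p \<le> ?n * ?p" using assms by simp
  \<comment> \<open>Products are generalised to variables, which makes the remaining goal
    linear.\<close>
  moreover have arith: "16 * a + 5 + (27 + (C + (3 + M))) \<le> 2000 * (y + a) + 2000 * x"
    if "C \<le> 200 * y + 200 * p + 200" "p \<le> y" "M \<le> 2000 * x" "1 \<le> a" for a C M y p x :: nat
    using that by simp
  ultimately show ?thesis
    unfolding backward_def scost.simps scost_clear scost_push
    using scost_closure[of aVB \<rho>] assms(2) by (intro arith)
qed

text \<open>Comparing the configurations on a level takes time of order n * |V|, which n^2 absorbs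
  because |V| is at most n.\<close>

lemma scost_descend:
  assumes "\<rho> xPb \<le> \<rho> xN" "1 \<le> \<rho> xN" "\<rho> xV \<le> \<rho> xN"
  shows "scost (descend S) \<rho> \<le> 3000 * (\<rho> xN * \<rho> xN * \<rho> xL) + 3"
proof -
  let ?n = "\<rho> xN" and ?p = "\<rho> xPb" and ?l = "\<rho> xL" and ?v = "\<rho> xV"
  have "?n * ?p \<le> ?n * ?n" "?n \<le> ?n * ?n" "?n * ?v \<le> ?n * ?n" using assms by auto
  then have f: "?n * ?p \<le> ?n * ?n" "?p \<le> ?n * ?n" "?n \<le> ?n * ?n" "1 \<le> ?n * ?n" "?n * ?v \<le> ?n * ?n"
    using assms by linarith+
  have "scost (IfLess (V xI) (V xL) (descend_step S) Skip) \<rho> + 4 \<le> 3000 * (?n * ?n)"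
    by (simp add: descend_step_def choose_rep_def sym_addr_def expand_def same_config_def successors_def
        sym_code_def scost_clear scost_push algebra_simps del: One_nat_def)
      (use f scost_closure[of aVF \<rho>] scost_candidates[of \<rho>] in linarith)
  then have "?l * (4 + scost (IfLess (V xI) (V xL) (descend_step S) Skip) \<rho>) \<le> ?l * (3000 * (?n * ?n))"
    by (intro mult_le_mono2) simp
  then have "?l * (4 + scost (IfLess (V xI) (V xL) (descend_step S) Skip) \<rho>) \<le> 3000 * (?n * ?n * ?l)"
    by (simp add: mult_ac)
  then show ?thesis unfolding descend_def scost.simps(9) by linarith
qed

lemma scost_next_answer:
  assumes "\<rho> xPb \<le> \<rho> xN" "1 \<le> \<rho> xN" "\<rho> xV \<le> \<rho> xN"
  shows "scost (next_answer S) \<rho> \<le> 4000 * (\<rho> xN * \<rho> xN * \<rho> xL) + 100"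
proof -
  let ?n = "\<rho> xN" and ?l = "\<rho> xL"
  have f: "?n \<le> ?n * ?n" "1 \<le> ?n * ?n" using assms by auto
  have "scost (IfLess (V xGo) (N 1) ascend_step Skip) \<rho> + 4 \<le> 500 * (?n * ?n)"
    by (simp add: ascend_step_def del: One_nat_def) (use f in linarith)
  then have "?l * (4 + scost (IfLess (V xGo) (N 1) ascend_step Skip) \<rho>) \<le> ?l * (500 * (?n * ?n))"
    by (intro mult_le_mono2) simp
  then have "?l * (4 + scost (IfLess (V xGo) (N 1) ascend_step Skip) \<rho>) \<le> 500 * (?n * ?n * ?l)"
    by (simp add: mult_ac)
  moreover have "scost (next_answer S) \<rho> =
      ?l * (4 + scost (IfLess (V xGo) (N 1) ascend_step Skip) \<rho>) + scost (descend S) \<rho> + 9"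
    by (simp add: next_answer_def ascend_def)
  ultimately show ?thesis using scost_descend[OF assms, of S] by linarith
qed

lemma scost_print_answer: "scost print_answer \<rho> \<le> 200 * (\<rho> xV * \<rho> xL + \<rho> xV + 1)"
  by (simp add: print_answer_def print_bounds_def algebra_simps)

text \<open>The configurations are computed in time of order |V| * pb, which the cost n * pb of the
  closures absorbs.\<close>

lemma scost_first_answer:
  assumes "\<rho> xPb \<le> \<rho> xN" "1 \<le> \<rho> xN" "\<rho> xV \<le> \<rho> xN"
  shows "scost (first_answer S) \<rho> \<le> 2000 * (\<rho> xN * \<rho> xPb + \<rho> xN) + 3000 * (\<rho> xN * \<rho> xN * \<rho> xL)"
proof -
  let ?n = "\<rho> xN" and ?p = "\<rho> xPb" and ?v = "\<rho> xV"
  have f: "?v * ?p \<le> ?n * ?p" "?p \<le> ?n * ?p" using assms by auto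
  show ?thesis
    by (simp add: first_answer_def configs_def config_step_def scost_clear scost_push algebra_simps del: One_nat_def)
      (use f assms(2) scost_closure[of aVF \<rho>] scost_closure[of aAL \<rho>] scost_candidates[of \<rho>]
        scost_descend[OF assms, of S] in linarith)
qed

lemma lims_macros [simp]:
  "lims (load S) = {xM}" "lims (backward S) = {xN, xPb, xL}"
  "lims (first_answer S) = {xN, xPb, xV, xL}"
  "lims (next_answer S) = {xN, xPb, xV, xL}" "lims print_answer = {xV, xL}"
  by (auto simp: load_def load_step_def Let_def backward_def back_step_def ending_states_def mark_ending_def clear_def
      push_def closure_def visit_def first_answer_def configs_def config_step_def candidates_def descend_def descend_step_def
      choose_rep_def expand_def same_config_def successors_def next_answer_def ascend_def ascend_step_def
      print_answer_def print_bounds_def)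

section \<open>Runs of functional automata\<close>

lemma path_append: "path A p u q \<Longrightarrow> path A q v r \<Longrightarrow> path A p (u @ v) r"
  by (induction rule: path.induct) (auto intro: path.intros)

fun scan :: "('v \<Rightarrow> nat) \<Rightarrow> ('a, 'v) letter list \<Rightarrow> 'v \<Rightarrow> nat" where
  "scan c [] = c"
| "scan c (Sym a # r) = scan c r"
| "scan c (Open x # r) = scan (c(x := 1)) r"
| "scan c (Close x # r) = scan (c(x := 2)) r"

text \<open>There is one entry per symbol, the configuration immediately before it is read.\<close>

fun confs :: "('v \<Rightarrow> nat) \<Rightarrow> ('a, 'v) letter list \<Rightarrow> ('v \<Rightarrow> nat) list" where
  "confs c [] = []"
| "confs c (Sym a # r) = c # confs c r"
| "confs c (Open x # r) = confs (c(x := 1)) r"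
| "confs c (Close x # r) = confs (c(x := 2)) r"

lemma scan_append [simp]: "scan c (u @ v) = scan (scan c u) v"
  by (induction u arbitrary: c rule: clr.induct) auto

lemma confs_append [simp]: "confs c (u @ v) = confs c u @ confs (scan c u) v"
  by (induction u arbitrary: c rule: clr.induct) auto

lemma length_confs [simp]: "length (confs c r) = length (clr r)"
  by (induction r arbitrary: c rule: clr.induct) auto

lemma scan_notin: "Open x \<notin> set u \<Longrightarrow> Close x \<notin> set u \<Longrightarrow> scan c u x = c x"
  by (induction u arbitrary: c rule: clr.induct) auto

lemma confs_notin:
  "Open x \<notin> set u \<Longrightarrow> Close x \<notin> set u \<Longrightarrow> map (\<lambda>c. c x) (confs c u) = replicate (length (clr u)) (c x)"
  by (induction u arbitrary: c rule: clr.induct) auto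

lemma valid_split:
  assumes "valid X r" "x \<in> X"
  obtains r1 r2 r3 where "r = r1 @ Open x # r2 @ Close x # r3"
    "Open x \<notin> set r1" "Close x \<notin> set r1" "Open x \<notin> set r2" "Close x \<notin> set r2"
    "Open x \<notin> set r3" "Close x \<notin> set r3"
proof -
  obtain r1 r2 r3 where r: "r = r1 @ Open x # r2 @ Close x # r3"
    using assms by (auto simp: valid_def)
  have "count_list r (Open x) = 1" "count_list r (Close x) = 1"
    using assms by (auto simp: valid_def)
  then show thesis using r that by (auto simp: count_list_0_iff)
qed

text \<open>The values of one variable run through blocks of 0, 1 and 2, which is why the bounds of
  its span can be found by counting.\<close>

lemma confs_valid:
  assumes "valid X r" "x \<in> X" "r = r1 @ Open x # r2 @ Close x # r3"
  shows "map (\<lambda>c. c x) (confs (\<lambda>_. 0) r) =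
    replicate (length (clr r1)) 0 @ replicate (length (clr r2)) 1 @ replicate (length (clr r3)) 2"
proof -
  have "count_list r (Open x) = 1" "count_list r (Close x) = 1"
    using assms by (auto simp: valid_def)
  then have n: "Open x \<notin> set r1" "Close x \<notin> set r1" "Open x \<notin> set r2" "Close x \<notin> set r2"
    "Open x \<notin> set r3" "Close x \<notin> set r3"
    unfolding assms(3) by (auto simp: count_list_0_iff)
  show ?thesis unfolding assms(3) using n by (simp add: confs_notin scan_notin)
qed

lemma count_one:
  assumes "count_list u a + count_list v a = 1"
  shows "a \<in> set u \<longleftrightarrow> a \<notin> set v"
proof (cases "count_list u a")
  case 0
  then have "count_list v a \<noteq> 0" using assms by simp
  then show ?thesis using 0 by (simp add: count_list_0_iff)
next
  case (Suc k)
  then have "count_list u a \<noteq> 0" "count_list v a = 0" using assms by auto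
  then show ?thesis by (simp add: count_list_0_iff)
qed

text \<open>In a valid word each variable operation occurs once, so what is missing from
  \<open>v\<close> has occurred in \<open>u\<close>: the configuration after \<open>u\<close> is
  determined by \<open>v\<close>. Two prefixes with a common valid continuation therefore have the
  same configuration.\<close>

lemma scan_valid:
  assumes v: "valid X (u @ v)" and x: "x \<in> X"
  shows "scan (\<lambda>_. 0) u x = (if Close x \<in> set v then if Open x \<in> set v then 0 else 1 else 2)"
proof -
  obtain r1 r2 r3 where r: "u @ v = r1 @ Open x # r2 @ Close x # r3"
    and n: "Open x \<notin> set r1" "Close x \<notin> set r1" "Open x \<notin> set r2" "Close x \<notin> set r2"
      "Open x \<notin> set r3" "Close x \<notin> set r3"
    using valid_split[OF v x] by metis
  have cnt: "count_list u (Open x) + count_list v (Open x) = 1"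
    "count_list u (Close x) + count_list v (Close x) = 1"
    using v x by (auto simp: valid_def)
  have iff: "Open x \<in> set u \<longleftrightarrow> Open x \<notin> set v" "Close x \<in> set u \<longleftrightarrow> Close x \<notin> set v"
    using count_one cnt by metis+
  consider "Close x \<in> set u" | "Close x \<notin> set u" "Open x \<in> set u" | "Close x \<notin> set u" "Open x \<notin> set u"
    by blast
  then show ?thesis
  proof cases
    case 1
    then obtain u1 u2 where u: "u = u1 @ Close x # u2" by (meson split_list)
    have eq: "u1 @ Close x # (u2 @ v) = (r1 @ Open x # r2) @ Close x # r3" using r u by simp
    have "Close x \<notin> set (u2 @ v)" "Close x \<notin> set u1"
      using cnt(2) iff(2) 1 u by (auto simp: count_list_0_iff)
    then have "u2 @ v = r3" using eq n append_Cons_eq_iff[of "Close x" u1 "u2 @ v" "r1 @ Open x # r2" r3] by simp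
    then have "Open x \<notin> set u2" "Close x \<notin> set u2" using n by auto
    then show ?thesis using iff 1 by (simp add: u scan_notin)
  next
    case 2
    then obtain u1 u2 where u: "u = u1 @ Open x # u2" by (meson split_list)
    have "Open x \<notin> set u2" using cnt(1) iff(1) 2 u by (auto simp: count_list_0_iff)
    then show ?thesis using iff 2 by (simp add: u scan_notin)
  next
    case 3
    then show ?thesis using iff by (simp add: scan_notin)
  qed
qed

lemma once_split: "count_list (u @ a # v) a = 1 \<Longrightarrow> a \<notin> set u \<and> a \<notin> set v"
  by (simp add: count_list_0_iff)

text \<open>On one accepting run, send \<open>x\<close> to the target \<open>Q x\<close> of the
  transition that opens it. If \<open>x\<close> and \<open>y\<close> had the same target, both ways
  of splicing the run there would be accepted, hence valid, which forces \<open>Open y\<close> to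
  precede \<open>Open x\<close> in \<open>r\<close> and conversely.\<close>

lemma card_vars_le:
  assumes wf: "wf_vset_automaton A" and fn: "functional A" and r: "r \<in> ref_language A"
    and ft: "finite (transitions A)"
  shows "card (vars A) \<le> card (transitions A)" "card (vars A) \<le> card (states A)"
proof -
  have v: "valid (vars A) r" using fn r by (auto simp: functional_def)
  have pth: "path A (initial A) r (final A)" using r by (simp add: ref_language_def)
  have split: "\<exists>p q. path A p' u p \<and> (p, Some a, q) \<in> transitions A \<and> path A q v' r'"
    if "path A p' z r'" "z = u @ a # v'" for p' z r' u v' a
    using that
  proof (induction arbitrary: u rule: path.induct)
    case (eps p1 q1 w r1)
    then obtain p q where "path A q1 u p" "(p, Some a, q) \<in> transitions A" "path A q v' r1" by blast
    then show ?case using path.eps[OF eps.hyps(1)] by blast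
  next
    case (letter p b q w r)
    show ?case
    proof (cases u)
      case Nil
      then show ?thesis using letter by (auto intro: path.refl)
    next
      case (Cons c u')
      then show ?thesis using letter by (auto intro: path.letter)
    qed
  qed simp
  have "\<exists>p q u v'. r = u @ Open x # v' \<and> path A (initial A) u p \<and>
      (p, Some (Open x), q) \<in> transitions A \<and> path A q v' (final A)" if "x \<in> vars A" for x
  proof -
    have "Open x \<in> set r" using valid_split[OF v that] by (metis in_set_conv_decomp)
    then obtain u v' where "r = u @ Open x # v'" by (meson split_list)
    then show ?thesis using split[OF pth] by blast
  qed
  then obtain P Q U W where PQ: "\<And>x. x \<in> vars A \<Longrightarrow> r = U x @ Open x # W x \<and> path A (initial A) (U x) (P x) \<and>
      (P x, Some (Open x), Q x) \<in> transitions A \<and> path A (Q x) (W x) (final A)" by metis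
  have fin: "finite (states A)" "finite (vars A)" using wf by (auto simp: wf_vset_automaton_def)
  have tsub: "p \<in> states A \<and> q \<in> states A" if "(p, l, q) \<in> transitions A" for p l q
    using that wf by (auto simp: transitions_def wf_vset_automaton_def)
  show "card (vars A) \<le> card (states A)"
  proof (rule card_inj_on_le[OF _ _ fin(1)])
    show "Q ` vars A \<subseteq> states A" using PQ tsub by blast
    show "inj_on Q (vars A)"
    proof (rule inj_onI)
      fix x y assume xy: "x \<in> vars A" "y \<in> vars A" "Q x = Q y"
      have px: "path A (initial A) (U x @ [Open x]) (Q x)" if "x \<in> vars A" for x
        using PQ[OF that] path_append path.letter path.refl by metis
      have L: "(U a @ [Open a]) @ W b \<in> ref_language A" if "a \<in> vars A" "b \<in> vars A" "Q a = Q b" for a b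
        unfolding ref_language_def using path_append[OF px[OF that(1)]] PQ[OF that(2)] that(3) by simp
      have val: "valid (vars A) ((U a @ [Open a]) @ W b)" if "a \<in> vars A" "b \<in> vars A" "Q a = Q b" for a b
        using fn L[OF that] by (auto simp: functional_def)
      have sc: "scan (\<lambda>_. 0) (U x @ [Open x]) z = scan (\<lambda>_. 0) (U y @ [Open y]) z" if "z \<in> vars A" for z
        using scan_valid[OF val[OF xy(1,2,3)] that] scan_valid[OF val[OF xy(2,2) HOL.refl] that] by simp
      show "x = y"
      proof (rule ccontr)
        assume ne: "x \<noteq> y"
        have once: "count_list r (Open z) = 1" if "z \<in> vars A" for z using v that by (simp add: valid_def)
        have one: "Open x \<notin> set (U x)" "Open x \<notin> set (W x)" "Open y \<notin> set (U y)" "Open y \<notin> set (W y)"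
          using once_split[of "U x" "Open x" "W x"] once_split[of "U y" "Open y" "W y"]
            once[OF xy(1)] once[OF xy(2)] PQ[OF xy(1)] PQ[OF xy(2)] by metis+
        have "length (U x) = length (U y) \<or> length (U x) < length (U y) \<or> length (U y) < length (U x)" by linarith
        moreover have eq: "U x @ Open x # W x = U y @ Open y # W y" using PQ xy by metis
        have "Open y \<notin> set (U x)" if "length (U x) \<le> length (U y)"
        proof -
          have "U x = take (length (U x)) (U y)" using eq that
            by (metis append_eq_append_conv_if append_take_drop_id)
          then show ?thesis using one(3) by (metis in_set_takeD)
        qed
        moreover have "Open x \<notin> set (U y)" if "length (U y) \<le> length (U x)"
        proof -
          have "U y = take (length (U y)) (U x)" using eq that
            by (metis append_eq_append_conv_if append_take_drop_id)
          then show ?thesis using one(1) by (metis in_set_takeD)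
        qed
        \<comment> \<open>The spliced word has to contain \<open>Open y\<close>, and its second part
          \<open>W y\<close> does not.\<close>
        moreover have "Open y \<in> set (U x)"
        proof -
          have "count_list ((U x @ [Open x]) @ W y) (Open y) = 1"
            using val[OF xy] xy(2) by (simp add: valid_def)
          then have "Open y \<in> set ((U x @ [Open x]) @ W y)" by (metis count_list_0_iff zero_neq_one)
          then show ?thesis using one(4) ne by auto
        qed
        moreover have "Open x \<in> set (U y)"
        proof -
          have "count_list ((U y @ [Open y]) @ W x) (Open x) = 1"
            using val[OF xy(2,1)] xy by (simp add: valid_def)
          then have "Open x \<in> set ((U y @ [Open y]) @ W x)" by (metis count_list_0_iff zero_neq_one)
          then show ?thesis using one(2) ne by auto
        qed
        ultimately show False by auto
      qed
    qed
  qed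
  show "card (vars A) \<le> card (transitions A)"
  proof (rule card_inj_on_le[OF _ _ ft])
    show "(\<lambda>x. (P x, Some (Open x), Q x)) ` vars A \<subseteq> transitions A" using PQ by blast
  qed (auto simp: inj_on_def)
qed

lemma finite_transitions:
  fixes A :: "('a::finite, 'v, 'q) vset_automaton"
  assumes "wf_vset_automaton A"
  shows "finite (transitions A)"
proof (rule finite_subset)
  show "transitions A \<subseteq> states A \<times> labels (vars A) \<times> states A"
    using assms by (auto simp: transitions_def wf_vset_automaton_def)
  show "finite (states A \<times> (labels (vars A) :: ('a, 'v) letter option set) \<times> states A)"
  proof -
    have "finite (vars A)" "finite (states A)" using assms by (auto simp: wf_vset_automaton_def)
    then show ?thesis unfolding labels_def ref_alphabet_def
      by (intro finite_cartesian_product finite.insertI finite_imageI finite_UnI) auto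
  qed
qed

section \<open>The numbered automaton\<close>

locale spanner =
  fixes A :: "('a::finite, 'v, 'q) vset_automaton" and s :: "'a list"
    and fa :: "'a \<Rightarrow> nat" and fv :: "'v \<Rightarrow> nat" and fq :: "'q \<Rightarrow> nat"
  assumes wf: "wf_vset_automaton A" and fn: "functional A"
    and fa: "numbering fa UNIV" and fv: "numbering fv (vars A)" and fq: "numbering fq (states A)"
begin

definition number_transition :: "'q \<times> ('a, 'v) letter option \<times> 'q \<Rightarrow> nat \<times> nat \<times> nat \<times> nat" where
  "number_transition = (\<lambda>(p, l, q). (fq p, encode_label fa fv l ! 0, encode_label fa fv l ! 1, fq q))"

definition T :: "(nat \<times> nat \<times> nat \<times> nat) set" where "T = number_transition ` transitions A"

lemma trans_bounds: "(p, l, q) \<in> transitions A \<Longrightarrow> p \<in> states A \<and> q \<in> states A \<and> l \<in> labels (vars A)"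
  using wf by (auto simp: transitions_def wf_vset_automaton_def)

lemma fq_inj: "p \<in> states A \<Longrightarrow> q \<in> states A \<Longrightarrow> fq p = fq q \<Longrightarrow> p = q"
  using fq by (auto simp: numbering_def bij_betw_def inj_on_def)

lemma fq_less: "p \<in> states A \<Longrightarrow> fq p < card (states A)"
  using fq by (auto simp: numbering_def bij_betw_def)

lemma fv_inj: "x \<in> vars A \<Longrightarrow> y \<in> vars A \<Longrightarrow> fv x = fv y \<Longrightarrow> x = y"
  using fv by (auto simp: numbering_def bij_betw_def inj_on_def)

lemma fv_less: "x \<in> vars A \<Longrightarrow> fv x < card (vars A)"
  using fv by (auto simp: numbering_def bij_betw_def)

definition nth_var :: "nat \<Rightarrow> 'v" where "nth_var = inv_into (vars A) fv"

lemma nth_var: "y < card (vars A) \<Longrightarrow> nth_var y \<in> vars A" "y < card (vars A) \<Longrightarrow> fv (nth_var y) = y"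
  using fv by (auto simp: numbering_def bij_betw_def nth_var_def intro: inv_into_into f_inv_into_f)

lemma fa_inj: "fa a = fa b \<Longrightarrow> a = b"
  using fa by (auto simp: numbering_def bij_betw_def inj_on_def)

lemma fa_less: "fa a < card (UNIV :: 'a set)"
  using fa by (auto simp: numbering_def bij_betw_def)

lemma state_initial: "initial A \<in> states A" and state_final: "final A \<in> states A"
  using wf by (auto simp: wf_vset_automaton_def)

lemma T_I: "(p, l, q) \<in> transitions A \<Longrightarrow> (fq p, encode_label fa fv l ! 0, encode_label fa fv l ! 1, fq q) \<in> T"
  by (force simp: T_def number_transition_def)

lemma T_cases:
  assumes "(x, e, a, y) \<in> T"
  obtains p l q where "(p, l, q) \<in> transitions A" "x = fq p" "y = fq q"
    "e = encode_label fa fv l ! 0" "a = encode_label fa fv l ! 1"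
  using assms by (auto simp: T_def number_transition_def)

sublocale graph "card (states A)" "card (transitions A)" "length s" "card (vars A)"
  "min (card (states A)) (card (transitions A) + 1)" "card (UNIV :: 'a set)"
  "fq (initial A)" "fq (final A)" "\<lambda>i. fa (s ! i)" T
proof
  have f: "finite (transitions A)" by (rule finite_transitions[OF wf])
  show "finite T" "card T \<le> card (transitions A)" using f by (auto simp: T_def intro: card_image_le)
  show "a < card (UNIV :: 'a set)" if T: "(p, 1, a, q) \<in> T" for p a q
  proof -
    obtain p' l q' where l: "1 = encode_label fa fv l ! 0" "a = encode_label fa fv l ! 1"
      using T_cases[OF T] by metis
    show ?thesis using l fa_less by (cases "(fa, fv, l)" rule: encode_label.cases) auto
  qed
  show "fq (initial A) < card (states A)" "fq (final A) < card (states A)"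
    using fq_less state_initial state_final by auto
  show "p < card (states A) \<and> q < card (states A)" if "(p, e, a, q) \<in> T" for p e a q
    using T_cases[OF that] fq_less trans_bounds by metis
qed (simp_all add: fa_less)

lemma al_iff: "al x y \<longleftrightarrow> (\<exists>p l q. (p, l, q) \<in> transitions A \<and> x = fq p \<and> y = fq q)"
proof
  assume "al x y"
  then obtain e a where "(x, e, a, y) \<in> T" by (auto simp: al_def)
  then show "\<exists>p l q. (p, l, q) \<in> transitions A \<and> x = fq p \<and> y = fq q" by (metis T_cases)
next
  assume "\<exists>p l q. (p, l, q) \<in> transitions A \<and> x = fq p \<and> y = fq q"
  then show "al x y" unfolding al_def using T_I by metis
qed

lemma ve_iff: "ve x y \<longleftrightarrow> (\<exists>p l q. (p, l, q) \<in> transitions A \<and> x = fq p \<and> y = fq q \<and> (\<forall>a. l \<noteq> Some (Sym a)))"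
proof
  assume "ve x y"
  then obtain e a where "e \<noteq> 1" "(x, e, a, y) \<in> T" by (auto simp: ve_def)
  moreover from this(2) obtain p l q where "(p, l, q) \<in> transitions A" "x = fq p" "y = fq q"
    "e = encode_label fa fv l ! 0" by (rule T_cases)
  ultimately show "\<exists>p l q. (p, l, q) \<in> transitions A \<and> x = fq p \<and> y = fq q \<and> (\<forall>a. l \<noteq> Some (Sym a))"
    by (intro exI[of _ p] exI[of _ l] exI[of _ q]) auto
next
  assume "\<exists>p l q. (p, l, q) \<in> transitions A \<and> x = fq p \<and> y = fq q \<and> (\<forall>a. l \<noteq> Some (Sym a))"
  then obtain p l q where t: "(p, l, q) \<in> transitions A" "x = fq p" "y = fq q" "\<forall>a. l \<noteq> Some (Sym a)" by blast
  have "encode_label fa fv l ! 0 \<noteq> 1"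
    using t(4) by (cases "(fa, fv, l)" rule: encode_label.cases) auto
  moreover have "(x, encode_label fa fv l ! 0, encode_label fa fv l ! 1, y) \<in> T"
    using t T_I by simp
  ultimately show "ve x y" by (auto simp: ve_def)
qed

lemma mv_iff: "mv (fa a) x y \<longleftrightarrow> (\<exists>p q. (p, Some (Sym a), q) \<in> transitions A \<and> x = fq p \<and> y = fq q)"
proof
  assume "mv (fa a) x y"
  then have "(x, 1, fa a, y) \<in> T" by (simp add: mv_def)
  then obtain p l q where t: "(p, l, q) \<in> transitions A" "x = fq p" "y = fq q"
    "1 = encode_label fa fv l ! 0" "fa a = encode_label fa fv l ! 1" by (rule T_cases)
  then have "l = Some (Sym a)"
    using fa_inj by (cases "(fa, fv, l)" rule: encode_label.cases) auto
  then show "\<exists>p q. (p, Some (Sym a), q) \<in> transitions A \<and> x = fq p \<and> y = fq q" using t by blast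
next
  assume "\<exists>p q. (p, Some (Sym a), q) \<in> transitions A \<and> x = fq p \<and> y = fq q"
  then obtain p q where "(p, Some (Sym a), q) \<in> transitions A" "x = fq p" "y = fq q" by blast
  then show "mv (fa a) x y" using T_I[of p "Some (Sym a)" q] by (simp add: mv_def)
qed

abbreviation c0 :: "'v \<Rightarrow> nat" where "c0 \<equiv> \<lambda>_. 0"

lemma conf_reach_path:
  assumes "conf_reach x c"
  shows "\<exists>p u. x = fq p \<and> p \<in> states A \<and> path A (initial A) u p \<and> (\<forall>z\<in>vars A. c (fv z) = scan c0 u z)"
  using assms
proof (induction rule: conf_reach.induct)
  case start
  then show ?case using state_initial by (auto intro!: exI[of _ "initial A"] exI[of _ "[]"] path.refl)
next
  case (step x c e a y)
  then obtain p u where p: "x = fq p" "p \<in> states A" "path A (initial A) u p"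
    "\<forall>z\<in>vars A. c (fv z) = scan c0 u z" by blast
  obtain p' l q where t: "(p', l, q) \<in> transitions A" "x = fq p'" "y = fq q"
    "e = encode_label fa fv l ! 0" "a = encode_label fa fv l ! 1" using step.hyps(2) by (rule T_cases)
  have p': "p' = p" using fq_inj[of p' p] trans_bounds[OF t(1)] t(2) p by auto
  have q: "q \<in> states A" "l \<in> labels (vars A)" using trans_bounds[OF t(1)] by auto
  have sc: "upd e a c (fv z) = scan c0 (u @ (case l of None \<Rightarrow> [] | Some b \<Rightarrow> [b])) z" if "z \<in> vars A" for z
    using t(4,5) q(2) p(4) that fv_inj
    by (cases "(fa, fv, l)" rule: encode_label.cases) (auto simp: upd.simps labels_def ref_alphabet_def)
  have "path A p (case l of None \<Rightarrow> [] | Some b \<Rightarrow> [b]) q"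
    using t(1) p' by (cases l) (auto intro: path.intros)
  then have "path A (initial A) (u @ (case l of None \<Rightarrow> [] | Some b \<Rightarrow> [b])) q"
    using p(3) path_append by metis
  then show ?case using t(3) q(1) sc by blast
qed

lemma path_al: "path A p u q \<Longrightarrow> al\<^sup>*\<^sup>* (fq p) (fq q)"
proof (induction rule: path.induct)
  case (eps p q w r)
  then show ?case using al_iff by (metis converse_rtranclp_into_rtranclp)
next
  case (letter p a q w r)
  then show ?case using al_iff by (metis converse_rtranclp_into_rtranclp)
qed simp

lemma path_states: "path A p u q \<Longrightarrow> p \<in> states A \<Longrightarrow> q \<in> states A"
  by (induction rule: path.induct) (use trans_bounds in auto)

section \<open>Accepting runs and words of configurations\<close>

definition vec :: "('v \<Rightarrow> nat) \<Rightarrow> nat list" where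
  "vec c = map (\<lambda>y. c (nth_var y)) [0..<card (vars A)]"

definition conf_table :: "(nat \<Rightarrow> nat \<Rightarrow> nat) \<Rightarrow> bool" where
  "conf_table cf \<longleftrightarrow> (\<forall>q. al\<^sup>*\<^sup>* (fq (initial A)) q \<longrightarrow>
     (\<exists>c. conf_reach q c \<and> (\<forall>y<card (vars A). cf q y = c y)))"

text \<open>
  Functionality makes the configuration of a state independent of the path leading to it,
  provided that the final state can be reached from there.
\<close>

lemma conf_table_path:
  assumes cf: "conf_table cf" and u: "path A (initial A) u p" and v: "path A p v (final A)"
  shows "cfv (card (vars A)) cf (fq p) = vec (scan c0 u)"
proof -
  obtain c where c: "conf_reach (fq p) c" "\<forall>y<card (vars A). cf (fq p) y = c y"
    using cf path_al[OF u] by (auto simp: conf_table_def)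
  obtain p' u' where p': "fq p = fq p'" "p' \<in> states A" "path A (initial A) u' p'"
    "\<forall>z\<in>vars A. c (fv z) = scan c0 u' z" using conf_reach_path[OF c(1)] by blast
  have "p' = p" using fq_inj p' path_states[OF u state_initial] by metis
  then have "valid (vars A) (u' @ v)" "valid (vars A) (u @ v)"
    using fn path_append[OF u v] path_append[of A _ u' p' v] p'(3) v by (auto simp: functional_def ref_language_def)
  then have "scan c0 u' z = scan c0 u z" if "z \<in> vars A" for z
    using scan_valid that by metis
  then have "cf (fq p) y = scan c0 u (nth_var y)" if "y < card (vars A)" for y
    using c(2) p'(4) nth_var[OF that] that by metis
  then show ?thesis by (simp add: cfv_def vec_def)
qed

lemma trc_ve: "ve x y \<Longrightarrow> trc cf t y us \<Longrightarrow> trc cf t x us"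
  by (cases us) (auto intro: converse_rtranclp_into_rtranclp)

text \<open>The prefix \<open>u\<close> leading to \<open>p\<close> varies in the induction. As
  \<open>p\<close> reaches the final state along the remaining path, \<open>conf_table_path\<close>
  identifies the table entry of \<open>p\<close> with the configuration after
  \<open>u\<close>.\<close>

lemma trc_of_path:
  assumes cf: "conf_table cf" and "path A p r q" "q = final A"
    and "path A (initial A) u p" "clr r = drop t s" "t \<le> length s"
  shows "trc cf t (fq p) (map vec (confs (scan c0 u) r))"
  using assms(2-)
proof (induction arbitrary: u t rule: path.induct)
  case (refl p)
  have "t = length s" using refl.prems by simp
  then have "trc cf t (fq (final A)) []" unfolding trc.simps by simp
  then show ?case using refl.prems(1) by simp
next
  case (eps p q w r)
  have "path A (initial A) u q"
    using path_append[OF eps.prems(2) path.eps[OF eps.hyps(1) path.refl]] by simp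
  then have "trc cf t (fq q) (map vec (confs (scan c0 u) w))" using eps by blast
  moreover have "ve (fq p) (fq q)" using eps.hyps(1) ve_iff by blast
  ultimately show ?case using trc_ve by blast
next
  case (letter p b q w r)
  have pb: "path A (initial A) (u @ [b]) q"
    using path_append[OF letter.prems(2) path.letter[OF letter.hyps(1) path.refl]] .
  show ?case
  proof (cases b)
    case (Sym a)
    then have e: "drop t s = a # clr w" using letter.prems(3) by simp
    then have t: "t < length s" by (metis drop_eq_Nil2 linorder_not_less list.distinct(1))
    then have "s ! t = a" "clr w = drop (Suc t) s" using e by (metis Cons_nth_drop_Suc list.inject)+
    then have "trc cf (Suc t) (fq q) (map vec (confs (scan c0 (u @ [b])) w))"
      using letter.IH[OF letter.prems(1) pb] t by simp
    moreover have "mv (fa (s ! t)) (fq p) (fq q)"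
      using letter.hyps(1) Sym \<open>s ! t = a\<close> mv_iff by blast
    moreover have "cfv (card (vars A)) cf (fq p) = vec (scan c0 u)"
      using conf_table_path[OF cf letter.prems(2)] path.letter[OF letter.hyps] letter.prems(1) by blast
    ultimately show ?thesis using t Sym by auto
  next
    case (Open x)
    have "trc cf t (fq q) (map vec (confs (scan c0 (u @ [b])) w))"
      by (rule letter.IH[OF letter.prems(1) pb _ letter.prems(4)]) (use letter.prems(3) Open in simp)
    moreover have "ve (fq p) (fq q)" using letter.hyps(1) ve_iff Open by blast
    ultimately show ?thesis using trc_ve[of "fq p" "fq q"] Open by simp
  next
    case (Close x)
    have "trc cf t (fq q) (map vec (confs (scan c0 (u @ [b])) w))"
      by (rule letter.IH[OF letter.prems(1) pb _ letter.prems(4)]) (use letter.prems(3) Close in simp)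
    moreover have "ve (fq p) (fq q)" using letter.hyps(1) ve_iff Close by blast
    ultimately show ?thesis using trc_ve[of "fq p" "fq q"] Close by simp
  qed
qed

lemma ve_path:
  assumes "ve\<^sup>*\<^sup>* x y" "x = fq p" "p \<in> states A"
  shows "\<exists>q r. y = fq q \<and> q \<in> states A \<and> path A p r q \<and> clr r = []"
  using assms
proof (induction rule: rtranclp_induct)
  case base
  then show ?case using path.refl by fastforce
next
  case (step y z)
  then obtain q r where q: "y = fq q" "q \<in> states A" "path A p r q" "clr r = []" by blast
  obtain q' l z' where t: "(q', l, z') \<in> transitions A" "y = fq q'" "z = fq z'" "\<forall>a. l \<noteq> Some (Sym a)"
    using step.hyps(2) ve_iff by blast
  have "q' = q" using fq_inj[of q' q] trans_bounds[OF t(1)] t(2) q by simp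
  then have "path A q (case l of None \<Rightarrow> [] | Some b \<Rightarrow> [b]) z'"
    using t(1) by (cases l) (auto intro: path.intros)
  then have "path A p (r @ (case l of None \<Rightarrow> [] | Some b \<Rightarrow> [b])) z'" using q(3) path_append by metis
  moreover have "clr (case l of None \<Rightarrow> [] | Some b \<Rightarrow> [b]) = []"
    using t(4) by (cases "(fa, fv, l)" rule: encode_label.cases) auto
  ultimately show ?case using q(4) t(3) trans_bounds[OF t(1)]
    by (intro exI[of _ z'] exI[of _ "r @ (case l of None \<Rightarrow> [] | Some b \<Rightarrow> [b])"]) simp
qed

text \<open>A path without symbols contributes no configuration, so each entry of the list
  corresponds to exactly one symbol of the path being rebuilt.\<close>

lemma path_of_trc:
  assumes cf: "conf_table cf" and "trc cf t (fq p) us" "p \<in> states A" "path A (initial A) u p"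
  shows "\<exists>r. path A p r (final A) \<and> clr r = drop t s \<and> us = map vec (confs (scan c0 u) r)"
  using assms(2-)
proof (induction us arbitrary: t p u)
  case Nil
  then obtain q r where q: "fq (final A) = fq q" "q \<in> states A" "path A p r q" "clr r = []"
    using ve_path[of "fq p" "fq (final A)" p] by auto
  then have "q = final A" using fq_inj state_final by metis
  moreover have "confs (scan c0 u) r = []" using q(4) by (metis length_0_conv length_confs)
  ultimately show ?case using q Nil by auto
next
  case (Cons v us)
  then obtain x y where xy: "t < length s" "ve\<^sup>*\<^sup>* (fq p) x" "cfv (card (vars A)) cf x = v"
    "mv (fa (s ! t)) x y" "trc cf (Suc t) y us" by auto
  obtain q r where q: "x = fq q" "q \<in> states A" "path A p r q" "clr r = []"
    using ve_path[OF xy(2) HOL.refl Cons.prems(2)] by blast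
  obtain q' z where z: "(q', Some (Sym (s ! t)), z) \<in> transitions A" "x = fq q'" "y = fq z"
    using xy(4) mv_iff by blast
  have q': "q' = q" using fq_inj[of q' q] trans_bounds[OF z(1)] z(2) q by simp
  have uq: "path A (initial A) (u @ r) q" using path_append[OF Cons.prems(3) q(3)] .
  have uz: "path A (initial A) ((u @ r) @ [Sym (s ! t)]) z"
    using path_append[OF uq path.letter[OF z(1)[unfolded q'] path.refl]] .
  obtain r' where r': "path A z r' (final A)" "clr r' = drop (Suc t) s"
    "us = map vec (confs (scan c0 ((u @ r) @ [Sym (s ! t)])) r')"
    using Cons.IH[OF _ _ uz, of "Suc t"] xy(5) z trans_bounds[OF z(1)] by auto
  have pq: "path A q (Sym (s ! t) # r') (final A)" using path.letter[OF z(1)[unfolded q'] r'(1)] .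
  have "v = vec (scan c0 (u @ r))" using conf_table_path[OF cf uq pq] xy(3) q(1) by simp
  moreover have "confs (scan c0 u) r = []" using q(4) by (metis length_0_conv length_confs)
  ultimately show ?case
    using path_append[OF q(3) pq] q(4) r' xy(1)
    by (intro exI[of _ "r @ Sym (s ! t) # r'"]) (simp add: Cons_nth_drop_Suc)
qed

lemma trc_eq:
  assumes "conf_table cf"
  shows "{us. trc cf 0 (fq (initial A)) us} =
    {map vec (confs c0 r) | r. r \<in> ref_language A \<and> clr r = s}"
  using trc_of_path[OF assms, of "initial A" _ "final A" "[]" 0]
    path_of_trc[OF assms, of 0 "initial A" _ "[]"] state_initial path.refl
  by (fastforce simp: ref_language_def)

text \<open>The word of configurations is computed from the tuple alone. Symbols are counted from 0
  and span bounds from 1, hence the comparisons with \<open>t + 1\<close>.\<close>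

definition decode :: "('v \<rightharpoonup> span) \<Rightarrow> nat list list" where
  "decode \<mu> = map (\<lambda>t. map (\<lambda>y. case the (\<mu> (nth_var y)) of (i, j) \<Rightarrow>
     if t + 1 < i then 0 else if t + 1 < j then 1 else 2) [0..<card (vars A)]) [0..<length s]"

lemma confs_nth:
  assumes r: "valid (vars A) r" "clr r = s" and x: "x \<in> vars A"
  obtains i j where "ref_tuple (vars A) r x = Some (i + 1, i + j + 1)"
    "map (\<lambda>c. c x) (confs c0 r) = replicate i 0 @ replicate j 1 @ replicate (length s - (i + j)) 2"
    "i + j \<le> length s"
proof -
  obtain r1 r2 r3 where d: "r = r1 @ Open x # r2 @ Close x # r3" using valid_split[OF r(1) x] by metis
  have "length s = length (clr r1) + length (clr r2) + length (clr r3)"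
    unfolding r(2)[symmetric] d by simp
  then show thesis
    using that[of "length (clr r1)" "length (clr r2)"] ref_tuple_eq[OF r(1) x d] confs_valid[OF r(1) x d]
    by (simp add: add.commute)
qed

lemma confs_decode:
  assumes r: "valid (vars A) r" "clr r = s"
  shows "map vec (confs c0 r) = decode (ref_tuple (vars A) r)"
proof (rule nth_equalityI)
  show "length (map vec (confs c0 r)) = length (decode (ref_tuple (vars A) r))"
    using r(2) by (simp add: decode_def)
  fix t assume "t < length (map vec (confs c0 r))"
  then have t: "t < length s" "t < length (confs c0 r)" using r(2) by auto
  have n: "[0..<length s] ! t = t" using t by simp
  have dt: "decode \<mu> ! t = map (\<lambda>y. case the (\<mu> (nth_var y)) of (i, j) \<Rightarrow>
     if t + 1 < i then 0 else if t + 1 < j then 1 else 2) [0..<card (vars A)]" for \<mu>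
    unfolding decode_def using t(1) by (subst nth_map) (simp_all only: n length_upt minus_nat.diff_0)
  have "(confs c0 r ! t) (nth_var y) = (case the (ref_tuple (vars A) r (nth_var y)) of (i, j) \<Rightarrow>
     if t + 1 < i then 0 else if t + 1 < j then 1 else 2)" if y: "y < card (vars A)" for y
  proof -
    obtain i j where ij: "ref_tuple (vars A) r (nth_var y) = Some (i + 1, i + j + 1)"
      "map (\<lambda>c. c (nth_var y)) (confs c0 r) = replicate i 0 @ replicate j 1 @ replicate (length s - (i + j)) 2"
      "i + j \<le> length s" using confs_nth[OF r nth_var(1)[OF y]] by blast
    have "(confs c0 r ! t) (nth_var y) = map (\<lambda>c. c (nth_var y)) (confs c0 r) ! t" using t by simp
    then show ?thesis unfolding ij(2) using ij(1,3) t by (auto simp: nth_append)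
  qed
  then show "map vec (confs c0 r) ! t = decode (ref_tuple (vars A) r) ! t"
    using t unfolding dt by (simp add: vec_def del: add_Suc_right)
qed

text \<open>Counting recovers the tuple from the word. This yields both the printed numbers and the
  injectivity of \<open>decode\<close>.\<close>

lemma count_decode:
  assumes r: "valid (vars A) r" "clr r = s" and x: "x \<in> vars A"
  shows "ref_tuple (vars A) r x =
    Some (1 + length (filter (\<lambda>u. u ! fv x < 1) (map vec (confs c0 r))),
      1 + length (filter (\<lambda>u. u ! fv x < 2) (map vec (confs c0 r))))"
proof -
  obtain i j where ij: "ref_tuple (vars A) r x = Some (i + 1, i + j + 1)"
    "map (\<lambda>c. c x) (confs c0 r) = replicate i 0 @ replicate j 1 @ replicate (length s - (i + j)) 2"
    "i + j \<le> length s" using confs_nth[OF r x] by blast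
  have "nth_var (fv x) = x" using nth_var fv_inj fv_less x by metis
  then have v: "vec c ! fv x = c x" for c using fv_less[OF x] by (simp add: vec_def)
  have c: "length (filter (\<lambda>u. u ! fv x < d) (map vec (confs c0 r))) =
      length (filter (\<lambda>v. v < d) (map (\<lambda>c. c x) (confs c0 r)))" for d
    by (simp add: filter_map o_def v)
  show ?thesis unfolding c ij(1,2) by simp
qed

lemma encode_print:
  assumes "valid (vars A) r" "clr r = s"
  shows "encode_tuple fv (vars A) (ref_tuple (vars A) r) = print_word (map vec (confs c0 r))"
proof -
  have "(case the (ref_tuple (vars A) r (inv_into (vars A) fv y)) of (a, b) \<Rightarrow> [a, b]) =
    [1 + length (filter (\<lambda>u. u ! y < 1) (map vec (confs c0 r))),
     1 + length (filter (\<lambda>u. u ! y < 2) (map vec (confs c0 r)))]" if "y < card (vars A)" for y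
    using count_decode[OF assms nth_var(1)[OF that]] nth_var(2)[OF that] by (simp add: nth_var_def)
  then show ?thesis unfolding encode_tuple_def print_word_def
    by (intro arg_cong[of _ _ concat] map_cong) auto
qed

text \<open>Several ref-words can define the same tuple, but their word of configurations depends on
  the tuple only and determines it. So distinct words correspond to distinct tuples.\<close>

lemma answers:
  assumes cf: "conf_table cf" and us: "distinct us" "set us = {us. trc cf 0 (fq (initial A)) us}"
  shows "\<exists>xs. distinct xs \<and> set xs = evaluate A s \<and> map (encode_tuple fv (vars A)) xs = map print_word us"
proof -
  have val: "valid (vars A) r" if "r \<in> ref_language A" for r using fn that by (simp add: functional_def)
  have ev: "\<exists>r. \<mu> = ref_tuple (vars A) r \<and> valid (vars A) r \<and> clr r = s" if "\<mu> \<in> evaluate A s" for \<mu>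
    using that by (auto simp: evaluate_def)
  have "set us = decode ` evaluate A s"
  proof -
    have e: "evaluate A s = ref_tuple (vars A) ` {r \<in> ref_language A. clr r = s}"
      using val by (auto simp: evaluate_def)
    have "set us = (\<lambda>r. map vec (confs c0 r)) ` {r \<in> ref_language A. clr r = s}"
      unfolding us(2) trc_eq[OF cf] by blast
    also have "\<dots> = (\<lambda>r. decode (ref_tuple (vars A) r)) ` {r \<in> ref_language A. clr r = s}"
      using confs_decode val by (intro image_cong) auto
    finally show ?thesis unfolding e by (simp add: image_image)
  qed
  moreover have "inj_on decode (evaluate A s)"
  proof (rule inj_onI)
    fix \<mu> \<nu> assume a: "\<mu> \<in> evaluate A s" "\<nu> \<in> evaluate A s" "decode \<mu> = decode \<nu>"
    obtain r r' where r: "\<mu> = ref_tuple (vars A) r" "valid (vars A) r" "clr r = s"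
      "\<nu> = ref_tuple (vars A) r'" "valid (vars A) r'" "clr r' = s" using ev[OF a(1)] ev[OF a(2)] by blast
    have eq: "map vec (confs c0 r) = map vec (confs c0 r')" using a(3) r confs_decode by metis
    have "\<mu> x = \<nu> x" for x
    proof (cases "x \<in> vars A")
      case True
      then show ?thesis using count_decode[OF r(2,3) True] count_decode[OF r(5,6) True] eq r(1,4) by simp
    next
      case False
      then show ?thesis using r(1,4) by (simp add: ref_tuple_def)
    qed
    then show "\<mu> = \<nu>" by blast
  qed
  moreover have "encode_tuple fv (vars A) \<mu> = print_word (decode \<mu>)" if "\<mu> \<in> evaluate A s" for \<mu>
    using ev[OF that] encode_print confs_decode by metis
  ultimately show ?thesis using us(1)
    by (intro exI[of _ "map (inv_into (evaluate A s) decode) us"])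
      (auto simp: distinct_map inj_on_inv_into image_image inv_into_into f_inv_into_f inv_into_f_f)
qed

lemma acc_iff:
  assumes "conf_table cf"
  shows "acc (length s) (fq (initial A)) \<longleftrightarrow> evaluate A s \<noteq> {}"
proof -
  have "acc (length s) (fq (initial A)) \<longleftrightarrow> {us. trc cf 0 (fq (initial A)) us} \<noteq> {}"
    using acc_trc[of 0 "fq (initial A)" cf] by auto
  also have "\<dots> \<longleftrightarrow> evaluate A s \<noteq> {}"
    unfolding trc_eq[OF assms] using fn by (simp add: evaluate_def functional_def) blast
  finally show ?thesis .
qed

end

section \<open>The enumeration theorem\<close>

lemma concat_blocks:
  assumes "\<forall>x\<in>set xs. length (f x) = d" "k < length xs" "j < d"
  shows "concat (map f xs) ! (d * k + j) = f (xs ! k) ! j"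
  using assms
proof (induction xs arbitrary: k)
  case (Cons x xs)
  then show ?case by (cases k) (auto simp: nth_append)
qed simp

lemma length_blocks: "\<forall>x\<in>set xs. length (f x) = d \<Longrightarrow> length (concat (map f xs)) = d * length xs"
  by (induction xs) auto

lemma length_encode_label: "length (encode_label fa fv l) = 2"
  by (cases "(fa, fv, l)" rule: encode_label.cases) auto

lemma wf_programs:
  "wf_com (S + 10) (preprocess S)" "wf_com (S + 10) (next_answer S)" "wf_com (S + 10) print_answer"
  by (auto simp: preprocess_def no_transitions_def tables_def header_def load_def load_step_def Let_def
      backward_def back_step_def ending_states_def mark_ending_def clear_def push_def closure_def visit_def
      first_answer_def configs_def config_step_def candidates_def descend_def descend_step_def
      choose_rep_def expand_def same_config_def successors_def next_answer_def ascend_def ascend_step_def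
      print_answer_def print_bounds_def sym_code_def sym_addr_def)

definition spanner_program :: "nat \<Rightarrow> program" where
  "spanner_program S = enumerator (S + 10) (preprocess S) xGo print_answer (next_answer S)"

lemma mods_first_answer [simp]:
  "mods (first_answer S) = {xH, xQ, xP, xY, xCnt, xI, xK, xR, xA, xF, xGo}"
  by (auto simp: first_answer_def)

lemma cost_print_next:
  assumes "var \<tau> xN = n" "var \<tau> xV = v" "var \<tau> xL = l" "var \<tau> xPb \<le> n" "1 \<le> n" "v \<le> n"
  shows "cost print_answer \<tau> \<le> 200 * (v * l + v + 1)"
    "cost (next_answer S) ((sem print_answer \<tau>)\<lparr>outp := []\<rparr>) \<le> 4000 * (n * n * l) + 100"
proof -
  have "cost print_answer \<tau> \<le> scost print_answer (var \<tau>)" by (rule cost_le_scost) simp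
  then show "cost print_answer \<tau> \<le> 200 * (v * l + v + 1)"
    using scost_print_answer[of "var \<tau>"] assms(2,3) by simp
  let ?\<rho> = "(sem print_answer \<tau>)\<lparr>outp := []\<rparr>"
  have "cost (next_answer S) ?\<rho> \<le> scost (next_answer S) (var ?\<rho>)" by (rule cost_le_scost) simp
  moreover have "var ?\<rho> xN = n" "var ?\<rho> xV = v" "var ?\<rho> xL = l" "var ?\<rho> xPb = var \<tau> xPb"
    using assms by (simp_all add: var_sem)
  ultimately show "cost (next_answer S) ?\<rho> \<le> 4000 * (n * n * l) + 100"
    using scost_next_answer[of "var ?\<rho>" S] assms(4-6) by simp
qed

context graph
begin

lemma ready_vars: "ready cf \<sigma> \<Longrightarrow> var \<sigma> xN = n \<and> var \<sigma> xV = nv \<and> var \<sigma> xL = l \<and> var \<sigma> xPb \<le> n"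
proof -
  have "pb \<le> n" using pb by simp
  moreover assume "ready cf \<sigma>"
  ultimately show ?thesis by (simp add: ready_def basic_def)
qed

text \<open>The bound on the number of variables is available only if the string is accepted;
  otherwise the program stops before any loop over the variables.\<close>

lemma cost_preprocess:
  assumes z: "arr \<sigma> = (\<lambda>_ _ _. 0)" and D: "m < var \<sigma> 0" "l < var \<sigma> 0" and m: "1 \<le> m"
    and h: "inp \<sigma> 0 = n" "inp \<sigma> 1 = m" "inp \<sigma> 2 = nv" "inp \<sigma> 3 = l" "inp \<sigma> 4 = ini" "inp \<sigma> 5 = fin"
    and T: "T = tr ` {..<m}"
      "\<And>k. k < m \<Longrightarrow> tr k = (inp \<sigma> (6 + 4 * k), inp \<sigma> (7 + 4 * k), inp \<sigma> (8 + 4 * k), inp \<sigma> (9 + 4 * k))"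
    and w: "\<And>i. i < l \<Longrightarrow> inp \<sigma> (6 + 4 * m + i) = w i"
    and nv: "acc l ini \<Longrightarrow> nv \<le> n"
  shows "cost (preprocess S) \<sigma> \<le> 15000 * (m * n) + 5000 * (n * n * l)"
proof -
  define \<sigma>1 where "\<sigma>1 = sem header \<sigma>"
  define \<sigma>2 where "\<sigma>2 = sem (tables S) \<sigma>1"
  note H = header_correct[OF h, folded \<sigma>1_def]
  have s1: "arr \<sigma>1 = (\<lambda>_ _ _. 0)" "var \<sigma>1 0 = var \<sigma> 0" "inp \<sigma>1 = inp \<sigma>"
    using z by (simp_all add: \<sigma>1_def header_def)
  have "basic \<sigma>2 \<and> marked n \<sigma>2 = {q. acc l q}"
    using tables_correct[of \<sigma>1 tr, folded \<sigma>2_def] s1 D H T w by simp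
  then have b2: "basic \<sigma>2" and m2: "marked n \<sigma>2 = {q. acc l q}" by auto
  define \<sigma>1a where "\<sigma>1a = sem (IfLess (V xN) (V xPb) (Assign xPb (V xN)) Skip) (sem (Inc xPb) (sem (Assign xPb (V xM)) \<sigma>1))"
  define \<sigma>1b where "\<sigma>1b = sem (load S) \<sigma>1a"
  have 2: "\<sigma>2 = sem (backward S) \<sigma>1b" by (simp only: \<sigma>2_def tables_def sem.simps(7) \<sigma>1b_def \<sigma>1a_def)
  have vb: "var \<sigma>1b x = var \<sigma>2 x" if "x \<le> 7" for x
    unfolding 2 by (rule var_sem[symmetric]) (use that in auto)
  have va: "var \<sigma>1a xM = m" using H by (simp add: \<sigma>1a_def)
  have "cost (load S) \<sigma>1a \<le> scost (load S) (var \<sigma>1a)" by (rule cost_le_scost) simp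
  then have c1: "cost (load S) \<sigma>1a \<le> 300 * m + 300" using scost_load[of S "var \<sigma>1a"] va by simp
  have n1: "1 \<le> n" using ini by simp
  \<comment> \<open>As there is a transition, m + 1 is at most 2 * m, so n * pb is of order m *
    n.\<close>
  have pbn: "pb \<le> n" "pb \<le> 2 * m" using pb m by auto
  have vars: "var \<sigma>2 xN = n" "var \<sigma>2 xPb = pb" "var \<sigma>2 xL = l" "var \<sigma>2 xV = nv" using b2 by (auto simp: basic_def)
  have "cost (backward S) \<sigma>1b \<le> scost (backward S) (var \<sigma>1b)" by (rule cost_le_scost) simp
  then have c2: "cost (backward S) \<sigma>1b \<le> 2000 * (n * pb + n) + 2000 * (n * n * l)"
    using scost_backward[of "var \<sigma>1b" S] vb vars pbn n1 by simp
  have c3: "cost (tables S) \<sigma>1 \<le> 15 + cost (load S) \<sigma>1a + cost (backward S) \<sigma>1b"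
    by (simp add: tables_def \<sigma>1a_def \<sigma>1b_def)
  have c4: "(if acc l ini then cost (first_answer S) \<sigma>2 else 1) \<le> 2000 * (n * pb + n) + 3000 * (n * n * l) + 1"
  proof (cases "acc l ini")
    case True
    have "cost (first_answer S) \<sigma>2 \<le> scost (first_answer S) (var \<sigma>2)" by (rule cost_le_scost) simp
    then show ?thesis using scost_first_answer[of "var \<sigma>2" S] vars pbn n1 nv[OF True] True by simp
  qed simp
  have "var \<sigma>2 xIni = ini" using b2 by (simp add: basic_def)
  then have test: "0 < eval (Arr aMK (N 0) (V xIni)) \<sigma>2 \<longleftrightarrow> acc l ini"
    using m2 ini by (auto simp: marked_def)
  have "cost header \<sigma> = 24" by (simp add: header_def)
  moreover have "\<not> eval (V xM) \<sigma>1 < eval (N 1) \<sigma>1" using H m by simp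
  ultimately have c: "cost (preprocess S) \<sigma> \<le> 50 + cost (tables S) \<sigma>1 + (if acc l ini then cost (first_answer S) \<sigma>2 else 1)"
    unfolding preprocess_def using test by (simp flip: \<sigma>1_def \<sigma>2_def)
  have "n * pb \<le> n * (2 * m)" using pbn by (intro mult_le_mono2)
  then have Y: "n * pb \<le> 2 * (m * n)" "n \<le> m * n" "m \<le> m * n" "1 \<le> m * n" using m n1 by (auto simp: mult_ac)
  have arith: "C \<le> 15000 * y + 5000 * x" if "C \<le> 50 + t + f" "t \<le> 15 + c1 + c2" "c1 \<le> 300 * m' + 300"
    "c2 \<le> 2000 * (p + n') + 2000 * x" "f \<le> 2000 * (p + n') + 3000 * x + 1"
    "p \<le> 2 * y" "n' \<le> y" "m' \<le> y" "1 \<le> y" for C y x t f c1 c2 m' n' p :: nat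
    using that by simp
  show ?thesis by (rule arith[OF c c3 c1 c2 c4 Y])
qed

end

context spanner
begin

lemma input_nth:
  fixes trs
  defines "w \<equiv> encode_input fa fv fq A trs s"
  assumes trs: "distinct trs" "set trs = transitions A"
  shows "length w = 6 + 4 * card (transitions A) + length s"
    and "w ! 0 = card (states A)" "w ! 1 = card (transitions A)" "w ! 2 = card (vars A)" "w ! 3 = length s"
    and "w ! 4 = fq (initial A)" "w ! 5 = fq (final A)"
    and "k < card (transitions A) \<Longrightarrow> number_transition (trs ! k) =
      (w ! (6 + 4 * k), w ! (7 + 4 * k), w ! (8 + 4 * k), w ! (9 + 4 * k))"
    and "i < length s \<Longrightarrow> w ! (6 + 4 * card (transitions A) + i) = fa (s ! i)"
    and "x \<in> set w \<Longrightarrow> x \<le> card (states A) + card (transitions A) + card (vars A) + length s + card (UNIV :: 'a set) + 3"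
proof -
  let ?f = "\<lambda>(p, l, q). fq p # encode_label fa fv l @ [fq q]"
  let ?h = "[card (states A), length trs, card (vars A), length s, fq (initial A), fq (final A)]"
  have m: "length trs = card (transitions A)" using trs distinct_card by metis
  have w: "w = ?h @ concat (map ?f trs) @ map fa s" by (simp add: w_def encode_input_def)
  have l4: "\<forall>x\<in>set trs. length (?f x) = 4" by (auto simp: length_encode_label)
  note L = length_blocks[OF l4]
  show "length w = 6 + 4 * card (transitions A) + length s" unfolding w using L m by simp
  show "w ! 0 = card (states A)" "w ! 1 = card (transitions A)" "w ! 2 = card (vars A)" "w ! 3 = length s"
    "w ! 4 = fq (initial A)" "w ! 5 = fq (final A)" unfolding w by (simp_all add: m)
  show "w ! (6 + 4 * card (transitions A) + i) = fa (s ! i)" if "i < length s"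
  proof -
    have "w ! (6 + (4 * length trs + i)) = map fa s ! i" unfolding w
      by (subst nth_append_right; simp add: L nth_append_right)
    then show ?thesis using that m by (simp add: add.assoc)
  qed
  show "number_transition (trs ! k) = (w ! (6 + 4 * k), w ! (7 + 4 * k), w ! (8 + 4 * k), w ! (9 + 4 * k))"
    if k: "k < card (transitions A)"
  proof -
    have B: "w ! (6 + (4 * k + j)) = ?f (trs ! k) ! j" if "j < 4" for j
    proof -
      have "4 * k + j < length (concat (map ?f trs))" using L k m that by simp
      then have "w ! (6 + (4 * k + j)) = concat (map ?f trs) ! (4 * k + j)"
        unfolding w by (subst nth_append_right; simp add: nth_append_left)
      also have "\<dots> = ?f (trs ! k) ! j" using concat_blocks[OF l4, of k j] k m that by simp
      finally show ?thesis .
    qed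
    obtain p l q where t: "trs ! k = (p, l, q)" by (cases "trs ! k") auto
    obtain e a where e: "encode_label fa fv l = [e, a]"
      using length_encode_label[of fa fv l] by (metis (no_types, opaque_lifting) length_0_conv length_Suc_conv numeral_2_eq_2)
    have "w ! (6 + 4 * k) = fq p" "w ! (7 + 4 * k) = e" "w ! (8 + 4 * k) = a" "w ! (9 + 4 * k) = fq q"
      using B[of 0] B[of 1] B[of 2] B[of 3] by (simp_all add: t e add.commute)
    then show ?thesis by (simp add: number_transition_def t e)
  qed
  show "x \<le> card (states A) + card (transitions A) + card (vars A) + length s + card (UNIV :: 'a set) + 3"
    if x: "x \<in> set w"
  proof -
    have lab: "y \<le> card (vars A) + card (UNIV :: 'a set) + 3" if "y \<in> set (encode_label fa fv l)" "l \<in> labels (vars A)" for y l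
      using that fv_less fa_less
      by (cases "(fa, fv, l)" rule: encode_label.cases)
        (fastforce simp: labels_def ref_alphabet_def intro: less_imp_le trans_le_add1 trans_le_add2)+
    consider "x \<in> set ?h" | p l q where "(p, l, q) \<in> transitions A" "x = fq p \<or> x = fq q \<or> x \<in> set (encode_label fa fv l)"
      | a where "x = fa a"
      using x trs(2) unfolding w by auto
    then show ?thesis
    proof cases
      case 1
      then show ?thesis using m fq_less[OF state_initial] fq_less[OF state_final] by auto
    next
      case 2
      then show ?thesis using lab[of x l] trans_bounds[OF 2(1)] fq_less[of p] fq_less[of q] by fastforce
    next
      case 3
      then show ?thesis using fa_less[of a] by simp
    qed
  qed
qed

definition run :: "nat list \<Rightarrow> nat \<Rightarrow> state" where
  "run w D = sem (preprocess (card (UNIV :: 'a set))) (start_state D w)"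

text \<open>The only ref-word that can be accepted is the empty one. If it is, functionality makes
  it valid, which leaves no variables.\<close>

lemma evaluate_no_transitions:
  assumes "card (transitions A) = 0"
  shows "evaluate A s = (if s = [] \<and> initial A = final A then {\<lambda>_. None} else {})"
    "s = [] \<and> initial A = final A \<Longrightarrow> vars A = {}"
proof -
  have e: "transitions A = {}" using assms finite_transitions[OF wf] by simp
  have p: "path A p r q \<longleftrightarrow> r = [] \<and> p = q" for p r q
    using path.refl by (auto elim: path.cases simp: e)
  have L: "ref_language A = (if initial A = final A then {[]} else {})" by (auto simp: ref_language_def p)
  show v: "s = [] \<and> initial A = final A \<Longrightarrow> vars A = {}"
    using fn L by (auto simp: functional_def valid_def)
  show "evaluate A s = (if s = [] \<and> initial A = final A then {\<lambda>_. None} else {})"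
    using v fn L by (auto simp: evaluate_def functional_def ref_tuple_def)
qed

lemma program_runs:
  fixes trs
  defines "w \<equiv> encode_input fa fv fq A trs s"
  defines "D \<equiv> w ! 0 + 4 * w ! 1 + w ! 2 + w ! 3 + (6 + (card (UNIV :: 'a set) + 10))"
  defines "X \<equiv> card (states A) * card (states A) * length s" and "Y \<equiv> card (transitions A) * card (states A)"
  assumes trs: "distinct trs" "set trs = transitions A"
  shows "\<exists>k xs. (\<forall>i<k. 0 < var ((next_state ^^ i) (run w D)) xGo) \<and> var ((next_state ^^ k) (run w D)) xGo = 0 \<and>
    map (\<lambda>i. outp (sem print_answer ((next_state ^^ i) (run w D)))) [0..<k] = map (encode_tuple fv (vars A)) xs \<and>
    distinct xs \<and> set xs = evaluate A s \<and>
    18 + cost (preprocess (card (UNIV :: 'a set))) (start_state D w) + (if 0 < k then cost print_answer (run w D) else 0) \<le>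
      20000 * (X + Y + 1) \<and>
    (\<forall>i<k. cost (next_answer (card (UNIV :: 'a set))) ((sem print_answer ((next_state ^^ i) (run w D)))\<lparr>outp := []\<rparr>) + 5 +
           (if i + 1 < k then cost print_answer ((next_state ^^ (i + 1)) (run w D)) else 0) \<le> 20000 * (X + 1))"
proof -
  let ?n = "card (states A)" and ?m = "card (transitions A)" and ?nv = "card (vars A)" and ?l = "length s"
  let ?S = "card (UNIV :: 'a set)"
  note I = input_nth[OF trs, folded w_def]
  have D: "D = ?n + 4 * ?m + ?nv + ?l + (6 + (?S + 10))" by (simp add: D_def I del: One_nat_def)
  define \<sigma> where "\<sigma> = start_state D w"
  have \<sigma>: "arr \<sigma> = (\<lambda>_ _ _. 0)" "var \<sigma> 0 = D" "\<And>x. x \<noteq> 0 \<Longrightarrow> var \<sigma> x = 0" "outp \<sigma> = []"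
    "\<And>a. a < length w \<Longrightarrow> inp \<sigma> a = w ! a"
    by (auto simp: \<sigma>_def start_state_def)
  have h: "inp \<sigma> 0 = ?n" "inp \<sigma> 1 = ?m" "inp \<sigma> 2 = ?nv" "inp \<sigma> 3 = ?l" "inp \<sigma> 4 = fq (initial A)"
    "inp \<sigma> 5 = fq (final A)"
    using \<sigma>(5) I by simp_all
  have n1: "1 \<le> ?n" using fq_less[OF state_initial] by simp
  have r: "run w D = sem (preprocess ?S) \<sigma>" by (simp add: run_def \<sigma>_def)
  have out: "outp (run w D) = []" unfolding r by (subst outp_sem) (simp_all add: \<sigma>)
  show ?thesis
  proof (cases "?m = 0")
    case True
    define \<sigma>1 where "\<sigma>1 = sem header \<sigma>"
    note H = header_correct[OF h, folded \<sigma>1_def]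
    have go1: "var \<sigma>1 xGo = 0" "var \<sigma>1 xPb = 0" using \<sigma>(3) by (simp_all add: \<sigma>1_def header_def)
    have r1: "run w D = sem no_transitions \<sigma>1"
      unfolding r preprocess_def using H True by (simp flip: \<sigma>1_def)
    let ?acc = "s = [] \<and> initial A = final A"
    have fqi: "fq (initial A) = fq (final A) \<longleftrightarrow> initial A = final A"
      using fq_inj state_initial state_final by metis
    have go: "var (run w D) xGo = (if ?acc then 1 else 0)"
      unfolding r1 no_transitions_def using H go1 fqi by auto
    have v: "var (run w D) xN = ?n" "var (run w D) xV = ?nv" "var (run w D) xL = ?l" "var (run w D) xPb = 0"
      unfolding r1 no_transitions_def using H go1 by auto
    have c0: "cost (preprocess ?S) \<sigma> \<le> 100"
      using H True by (simp add: preprocess_def cost_le_scost flip: \<sigma>1_def) (simp add: header_def no_transitions_def)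
    show ?thesis
    proof (cases ?acc)
      case False
      then show ?thesis using go c0 evaluate_no_transitions(1)[OF True]
        by (intro exI[of _ 0] exI[of _ "[]"]) (simp add: \<sigma>_def)
    next
      case acc: True
      have ev: "evaluate A s = {\<lambda>_. None}" "?nv = 0" using evaluate_no_transitions[OF True] acc by auto
      have o: "outp (sem print_answer (run w D)) = []"
        using v(2) ev(2) out by (simp add: print_answer_def)
      have "var (next_state (run w D)) xGo = 0"
        using v(3) acc by (simp add: next_state_def next_answer_def ascend_def var_sem)
      moreover have "cost print_answer (run w D) \<le> 200"
        "cost (next_answer ?S) ((sem print_answer (run w D))\<lparr>outp := []\<rparr>) \<le> 100"
        using cost_print_next[of "run w D", OF v(1-3)] v(4) n1 ev(2) acc by auto
      ultimately show ?thesis using go acc c0 ev o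
        by (intro exI[of _ 1] exI[of _ "[\<lambda>_. None]"]) (simp add: \<sigma>_def encode_tuple_def)
    qed
  next
    case False
    have m: "1 \<le> ?m" using False by simp
    define tr where "tr = (\<lambda>k. number_transition (trs ! k))"
    have lt: "length trs = ?m" using trs distinct_card by metis
    have T: "T = tr ` {..<?m}"
    proof -
      have "transitions A = (\<lambda>k. trs ! k) ` {..<length trs}" using trs(2) by (auto simp: set_conv_nth)
      then have "number_transition ` transitions A = number_transition ` ((\<lambda>k. trs ! k) ` {..<?m})"
        unfolding lt by (rule arg_cong)
      then show ?thesis unfolding T_def tr_def image_image .
    qed
    have tr: "tr k = (inp \<sigma> (6 + 4 * k), inp \<sigma> (7 + 4 * k), inp \<sigma> (8 + 4 * k), inp \<sigma> (9 + 4 * k))" if "k < ?m" for k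
      using I(8)[OF that] \<sigma>(5) I(1) that by (simp add: tr_def)
    have ws: "inp \<sigma> (6 + 4 * ?m + i) = fa (s ! i)" if "i < ?l" for i
      using I(9)[OF that] \<sigma>(5) I(1) that by simp
    have Dm: "?m < var \<sigma> 0" "?l < var \<sigma> 0" "var \<sigma> xGo = 0" using \<sigma>(2,3) D by simp_all
    note PC = preprocess_correct[OF \<sigma>(1) Dm m h T tr ws, folded r]
    have nv: "?nv \<le> ?n \<and> ?nv \<le> ?m" if ac: "acc ?l (fq (initial A))"
    proof -
      obtain cf where "conf_table cf" using PC ac by (auto simp: conf_table_def)
      then have "evaluate A s \<noteq> {}" using acc_iff ac by blast
      then obtain r where "r \<in> ref_language A" by (auto simp: evaluate_def)
      then show ?thesis using card_vars_le[OF wf fn _ finite_transitions[OF wf]] by blast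
    qed
    have cp: "cost (preprocess ?S) \<sigma> \<le> 15000 * Y + 5000 * X"
      using cost_preprocess[OF \<sigma>(1) Dm(1,2) m h T tr ws] nv by (simp add: X_def Y_def)
    have Y1: "1 \<le> Y" "?m \<le> Y" using m n1 by (auto simp: Y_def)
    show ?thesis
    proof (cases "acc ?l (fq (initial A))")
      case na: False
      \<comment> \<open>For a rejected string the program never computes configurations, so a table
        is chosen here merely to apply \<open>acc_iff\<close>.\<close>
      have "\<exists>cf. conf_table cf"
      proof -
        define cf where "cf = (\<lambda>q. SOME c. conf_reach q c)"
        have cf: "conf_reach q (cf q)" if "conf_reach q c" for q c unfolding cf_def by (rule someI[of _ c]) (rule that)
        have "conf_reach q (cf q)" if "al\<^sup>*\<^sup>* (fq (initial A)) q" for q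
          using that
        proof (induction rule: rtranclp_induct)
          case base
          show ?case by (rule cf[OF conf_reach.start])
        next
          case (step y z)
          then show ?case using cf[OF conf_reach.step[OF step.IH]] by (auto simp: al_def)
        qed
        then show ?thesis by (auto simp: conf_table_def intro!: exI[of _ cf])
      qed
      then have "evaluate A s = {}" using acc_iff na by blast
      moreover have "var (run w D) xGo = 0" using PC na by simp
      ultimately show ?thesis using cp Y1
        by (intro exI[of _ 0] exI[of _ "[]"]) (simp add: \<sigma>_def)
    next
      case ac: True
      obtain cf where cf: "search_state cf (run w D) {us. trc cf 0 (fq (initial A)) us}" "var (run w D) xI = ?l"
        "0 < var (run w D) xGo" "conf_table cf"
        using PC ac by (auto simp: conf_table_def)
      from enumeration[OF finite_trc cf(1-3) out] obtain us where us:
        "distinct us" "set us = {us. trc cf 0 (fq (initial A)) us}" "us \<noteq> []"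
        "\<forall>i<length us. 0 < var ((next_state ^^ i) (run w D)) xGo"
        "var ((next_state ^^ length us) (run w D)) xGo = 0"
        "\<forall>i<length us. ready cf ((next_state ^^ i) (run w D))"
        "map (\<lambda>i. outp (sem print_answer ((next_state ^^ i) (run w D)))) [0..<length us] = map print_word us"
        by blast
      obtain xs where xs: "distinct xs" "set xs = evaluate A s" "map (encode_tuple fv (vars A)) xs = map print_word us"
        using answers[OF cf(4) us(1,2)] by blast
      have costs: "cost print_answer ((next_state ^^ i) (run w D)) \<le> 200 * (?nv * ?l + ?nv + 1)"
        "cost (next_answer ?S) ((sem print_answer ((next_state ^^ i) (run w D)))\<lparr>outp := []\<rparr>) \<le> 4000 * X + 100"
        if "i < length us" for i
      proof -
        have v: "var ((next_state ^^ i) (run w D)) xN = ?n" "var ((next_state ^^ i) (run w D)) xV = ?nv"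
          "var ((next_state ^^ i) (run w D)) xL = ?l" "var ((next_state ^^ i) (run w D)) xPb \<le> ?n"
          using ready_vars[OF us(6)[rule_format, OF that]] by blast+
        show "cost print_answer ((next_state ^^ i) (run w D)) \<le> 200 * (?nv * ?l + ?nv + 1)"
          "cost (next_answer ?S) ((sem print_answer ((next_state ^^ i) (run w D)))\<lparr>outp := []\<rparr>) \<le> 4000 * X + 100"
          using cost_print_next[OF v n1] nv[OF ac] by (simp_all add: X_def)
      qed
      have "?n \<le> ?n * ?n" by simp
      then have nvl: "?nv * ?l \<le> X" using nv[OF ac] unfolding X_def by (meson le_trans mult_le_mono1)
      have pre: "18 + cost (preprocess ?S) \<sigma> + cost print_answer (run w D) \<le> 20000 * (X + Y + 1)"
      proof -
        have "cost print_answer (run w D) \<le> 200 * (?nv * ?l + ?nv + 1)" using costs(1)[of 0] us(3) by simp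
        moreover have "?nv \<le> Y" using nv[OF ac] Y1 by simp
        ultimately show ?thesis using cp nvl by simp
      qed
      have del: "cost (next_answer ?S) ((sem print_answer ((next_state ^^ i) (run w D)))\<lparr>outp := []\<rparr>) + 5 +
           (if i + 1 < length us then cost print_answer ((next_state ^^ (i + 1)) (run w D)) else 0) \<le> 20000 * (X + 1)"
        if i: "i < length us" for i
      proof (cases "i + 1 < length us")
        case True
        \<comment> \<open>Two answers require a nonempty string, as the empty string admits only the
          empty word of configurations. Then n^2 * |s| is at least n and absorbs the summand |V| in
          the cost of printing.\<close>
        have "?l \<noteq> 0"
        proof
          assume "?l = 0"
          then have "set us \<subseteq> {[]}" using us(2) length_trc by fastforce
          then have "length us \<le> 1" using us(1) by (metis card.empty card_insert_disjoint card_mono distinct_card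
                empty_iff finite.emptyI finite.insertI One_nat_def)
          then show False using True by simp
        qed
        then have "1 \<le> ?n * ?l" using n1 by (simp add: Suc_le_eq)
        then have "?n * 1 \<le> ?n * (?n * ?l)" by (rule mult_le_mono2)
        then have "?n \<le> X" unfolding X_def by (simp add: mult.assoc)
        then have "?nv \<le> X" using nv[OF ac] by simp
        then show ?thesis using True costs(2)[OF i] costs(1)[OF True] nvl by simp
      qed (use costs(2)[OF i] in simp)
      show ?thesis
        by (intro exI[of _ "length us"] exI[of _ xs]) (use us xs pre del in \<open>auto simp: \<sigma>_def\<close>)
    qed
  qed
qed

end

text \<open>With N the base on the right-hand side, \<open>D\<close> is at most (16 + S) * N, and
  since N is at least 2 the factor is at most a fixed power of N. The resulting exponent does not
  depend on the input.\<close>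

lemma word_size:
  fixes n m v l S K :: nat
  assumes "D = n + 4 * m + v + l + (6 + (S + 10))"
  shows "D ^ K * D \<le> (v + n + m + l + 2) ^ ((17 + S) * (K + 1))"
proof -
  define N where "N = v + n + m + l + 2"
  have "16 + S < 2 ^ (16 + S)" by (rule less_exp)
  also have "\<dots> \<le> N ^ (16 + S)" by (rule power_mono) (simp_all add: N_def)
  finally have "(16 + S) * N \<le> N ^ (16 + S) * N" by (intro mult_le_mono1) simp
  moreover have "D \<le> (16 + S) * N"
  proof -
    have "S \<le> S * N" by (simp add: N_def)
    then show ?thesis using assms by (simp add: N_def algebra_simps)
  qed
  moreover have "N ^ (16 + S) * N = N ^ (17 + S)" using power_Suc2[of N "16 + S"] by simp
  ultimately have "D \<le> N ^ (17 + S)" by linarith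
  then have "D ^ (K + 1) \<le> (N ^ (17 + S)) ^ (K + 1)" by (rule power_mono) simp
  also have "\<dots> = N ^ ((17 + S) * (K + 1))" by (rule power_mult[symmetric])
  finally have "D ^ K * D \<le> N ^ ((17 + S) * (K + 1))" by (simp add: mult.commute)
  then show ?thesis unfolding N_def .
qed

text \<open>The program, the factor and the exponent depend on the size of the alphabet only. It
  enters as a constant of the program, in the column index of \<open>aMV\<close> and in the bound
  \<open>S + 10\<close> on constants.\<close>

theorem theorem3p3:
  assumes "card (UNIV :: 'a::finite set) \<ge> 2"
    and "infinite (UNIV :: 'v set)"
  shows "\<exists>(P :: program) (c :: nat) (k :: nat).
    \<forall>(A :: ('a, 'v, 'q) vset_automaton) (s :: 'a list) n m fa fv fq trs.
      wf_vset_automaton A \<longrightarrow> functional A \<longrightarrow>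
      n = card (states A) \<longrightarrow> m = card (transitions A) \<longrightarrow>
      numbering fa UNIV \<longrightarrow> numbering fv (vars A) \<longrightarrow> numbering fq (states A) \<longrightarrow>
      distinct trs \<longrightarrow> set trs = transitions A \<longrightarrow>
      enumerates P (encode_input fa fv fq A trs s)
        (encode_tuple fv (vars A)) (evaluate A s)
        (c * (n\<^sup>2 * length s + m * n + 1)) (c * (n\<^sup>2 * length s + 1)) \<and>
      word_bounded P (encode_input fa fv fq A trs s) ((input_size A s + 2) ^ k)"
proof -
  let ?S = "card (UNIV :: 'a set)"
  let ?K = "csize (preprocess ?S) + csize print_answer + csize (next_answer ?S) + 1"
  have "enumerates (spanner_program ?S) (encode_input fa fv fq A trs s)
        (encode_tuple fv (vars A)) (evaluate A s)
        (20000 * ((card (states A))\<^sup>2 * length s + card (transitions A) * card (states A) + 1))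
        (20000 * ((card (states A))\<^sup>2 * length s + 1)) \<and>
      word_bounded (spanner_program ?S) (encode_input fa fv fq A trs s)
        ((input_size A s + 2) ^ ((17 + ?S) * (?K + 1)))"
    if hyps: "wf_vset_automaton A" "functional A" "numbering fa UNIV" "numbering fv (vars A)"
      "numbering fq (states A)" "distinct trs" "set trs = transitions A"
    for A :: "('a, 'v, 'q) vset_automaton" and s :: "'a list" and fa fv fq trs
  proof -
    interpret spanner A s fa fv fq using hyps by unfold_locales
    define w where "w = encode_input fa fv fq A trs s"
    define D where "D = w ! 0 + 4 * w ! 1 + w ! 2 + w ! 3 + (6 + (?S + 10))"
    note I = input_nth[OF hyps(6,7), folded w_def]
    have D: "D = card (states A) + 4 * card (transitions A) + card (vars A) + length s + (6 + (?S + 10))"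
      by (simp add: D_def I del: One_nat_def)
    obtain k xs where go: "\<forall>i<k. 0 < var ((next_state ^^ i) (run w D)) xGo" "var ((next_state ^^ k) (run w D)) xGo = 0"
      and outs: "map (\<lambda>i. outp (sem print_answer ((next_state ^^ i) (run w D)))) [0..<k] = map (encode_tuple fv (vars A)) xs"
        "distinct xs" "set xs = evaluate A s"
      and p: "18 + cost (preprocess ?S) (start_state D w) + (if 0 < k then cost print_answer (run w D) else 0) \<le>
        20000 * (card (states A) * card (states A) * length s + card (transitions A) * card (states A) + 1)"
      and d: "\<forall>i<k. cost (next_answer ?S) ((sem print_answer ((next_state ^^ i) (run w D)))\<lparr>outp := []\<rparr>) + 5 +
           (if i + 1 < k then cost print_answer ((next_state ^^ (i + 1)) (run w D)) else 0) \<le>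
           20000 * (card (states A) * card (states A) * length s + 1)"
      using program_runs[OF hyps(6,7), folded w_def, folded D_def] by blast
    have ns: "next_state = (\<lambda>\<sigma>. sem (next_answer ?S) ((sem print_answer \<sigma>)\<lparr>outp := []\<rparr>))"
      by (simp add: fun_eq_iff next_state_def)
    have wl: "4 \<le> length w" "length w \<le> D" "\<forall>v\<in>set w. v \<le> D"
      using I(1) I(10) D by (auto, fastforce)
    note E = enumerator_correct[of "?S + 10" w "preprocess ?S" print_answer "next_answer ?S" xGo k
        "encode_tuple fv (vars A)" xs "evaluate A s", folded D_def, folded run_def ns spanner_program_def,
        OF _ wl wf_programs(1,3,2) silent_macros(1,2) _ _ go outs p d]
    have "word_bounded (spanner_program ?S) w (D ^ ?K * D)" using E(2) by simp
    moreover have "D ^ ?K * D \<le> (input_size A s + 2) ^ ((17 + ?S) * (?K + 1))"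
      using word_size[OF D, of ?K] by (simp add: input_size_def)
    ultimately have "word_bounded (spanner_program ?S) w ((input_size A s + 2) ^ ((17 + ?S) * (?K + 1)))"
      unfolding word_bounded_def by (meson less_le_trans)
    moreover have "enumerates (spanner_program ?S) w (encode_tuple fv (vars A)) (evaluate A s)
        (20000 * ((card (states A))\<^sup>2 * length s + card (transitions A) * card (states A) + 1))
        (20000 * ((card (states A))\<^sup>2 * length s + 1))"
      using E(1) by (simp add: power2_eq_square)
    ultimately show ?thesis by (simp add: w_def)
  qed
  then show ?thesis by blast
qed

end
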